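(* Let $(\mathcal A,\mathcal T,\mathcal G)$ be a regularity structure with a model $(\Pi,\Gamma)$, let $\gamma>0$ with $\gamma\notin\mathcal A$, and let $1\le p,q\le\infty$. Then $\mathcal D^\gamma_{p,q}=\mathcal B^\gamma_{p,q}$ in the sense of equivalent norms.
   Context: Basic notation. Fix $d\ge1$ and a scaling $\mathfrak s=(\mathfrak s_1,\dots,\mathfrak s_d)$ of positive integers; $|\mathfrak s|=\sum_i\mathfrak s_i$, $\|x\|_{\mathfrak s}=\max_i|x_i|^{1/\mathfrak s_i}$, $Q(x,R)=\{y\in\mathbf R^d:\|y-x\|_{\mathfrak s}\le R\}$, $|k|_{\mathfrak s}=\sum_ik_i\mathfrak s_i$. $L^p=L^p(\mathbf R^d,dx)$, $L^q_\lambda=L^q((0,1],\lambda^{-1}d\lambda)$; integrals to the power $q$ are replaced by (essential) suprema if $q=\infty$. $\eta^\lambda_x(z)=\lambda^{-|\mathfrak s|}\eta(\lambda^{-\mathfrak s_1}(z_1-x_1),\dots,\lambda^{-\mathfrak s_d}(z_d-x_d))$. $\mathfrak B^r$ is the set of $\eta\in\mathcal C^\infty(\mathbf R^d)$ supported in $Q(0,1)$ with $\mathcal C^r$-norm (involving derivatives $D^k$, $|k|_{\mathfrak s}\le r$) at most $1$. Regularity structure. A triple $(\mathcal A,\mathcal T,\mathcal G)$: $\mathcal A\subset\mathbf R$ bounded below and locally finite; $\mathcal T=\bigoplus_{\zeta\in\mathcal A}\mathcal T_\zeta$ with Banach spaces $\mathcal T_\zeta$; $\mathcal G$ a group of linear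 maps on $\mathcal T$ with $\Gamma\tau-\tau\in\bigoplus_{\beta\in\mathcal A,\beta<\zeta}\mathcal T_\beta$ for $\tau\in\mathcal T_\zeta$. $\mathcal Q_\zeta$ is the projection onto $\mathcal T_\zeta$, $|\tau|_\zeta=\|\mathcal Q_\zeta\tau\|_{\mathcal T_\zeta}$, $\mathcal A_\gamma=\mathcal A\cap(-\infty,\gamma)$, $\mathcal T^-_\gamma=\bigoplus_{\beta\in\mathcal A_\gamma}\mathcal T_\beta$. Model. A pair $(\Pi,\Gamma)$: continuous linear maps $\Pi_x:\mathcal T\to\mathcal D'(\mathbf R^d)$ and $\Gamma:\mathbf R^d\times\mathbf R^d\to\mathcal G$ with $\Gamma_{x,x}=1$, $\Gamma_{x,z}\Gamma_{z,y}=\Gamma_{x,y}$, $\Pi_y=\Pi_x\Gamma_{x,y}$, such that for every $\gamma>0$ (with $r$ the smallest positive integer larger than $|\min\mathcal A|\vee|\max\mathcal A_\gamma|$): $|\langle\Pi_x\tau,\eta^\lambda_x\rangle|\lesssim|\tau|_\zeta\lambda^\zeta$ and $|\Gamma_{x,y}\tau|_\beta\lesssim|\tau|_\zeta\|x-y\|_{\mathfrak s}^{\zeta-\beta}$, uniformly over $x\in\mathbf R^d$, $y\in Q(x,1)$, $\eta\in\mathfrak B^r$, $\lambda\in(0,1]$, $\zeta\in\mathcal A_\gamma$, $\tau\in\mathcal T_\zeta$, $\beta\in\mathcal A$ with $\beta\le\zeta$. Spaces. $\mathcal D^\gamma_{p,q}$ is the Banach space of $f:\mathbf R^d\to\mathcal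 T^-_\gamma$ with finite norm $$\sup_{\zeta\in\mathcal A_\gamma}\big\||f(x)|_\zeta\big\|_{L^p}+\sup_{\zeta\in\mathcal A_\gamma}\bigg\|\Big\|\frac1{|Q(0,4\lambda)|}\int_{Q(0,4\lambda)}\frac{|f(x+h)-\Gamma_{x+h,x}f(x)|_\zeta}{\lambda^{\gamma-\zeta}}\,dh\Big\|_{L^p}\bigg\|_{L^q_\lambda}.$$ $\mathcal B^\gamma_{p,q}$ is the Banach space of $f:\mathbf R^d\to\mathcal T^-_\gamma$ with finite norm $$\sup_{\zeta\in\mathcal A_\gamma}\big\||f(x)|_\zeta\big\|_{L^p}+\sup_{\zeta\in\mathcal A_\gamma}\bigg(\int_{Q(0,1)}\bigg\|\frac{|f(x+h)-\Gamma_{x+h,x}f(x)|_\zeta}{\|h\|_{\mathfrak s}^{\gamma-\zeta}}\bigg\|^q_{L^p}\frac{dh}{\|h\|_{\mathfrak s}^{|\mathfrak s|}}\bigg)^{1/q}.$$ *)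

theory Defs
  imports "HOL-Analysis.Analysis" "HOL-Probability.Essential_Supremum"
begin

section \<open>Scalings\<close>

definition scaling_size :: "('d::finite \<Rightarrow> nat) \<Rightarrow> nat" where
  "scaling_size s = (\<Sum>i\<in>UNIV. s i)"

definition scaled_norm :: "('d::finite \<Rightarrow> nat) \<Rightarrow> real^'d \<Rightarrow> real" where
  "scaled_norm s x = Max (range (\<lambda>i. \<bar>x $ i\<bar> powr (1 / real (s i))))"

definition scaled_ball :: "('d::finite \<Rightarrow> nat) \<Rightarrow> real^'d \<Rightarrow> real \<Rightarrow> (real^'d) set" where
  "scaled_ball s x \<rho> = {y. scaled_norm s (y - x) \<le> \<rho>}"

definition scaled_degree :: "('d::finite \<Rightarrow> nat) \<Rightarrow> ('d \<Rightarrow> nat) \<Rightarrow> nat" where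
  "scaled_degree s k = (\<Sum>i\<in>UNIV. k i * s i)"


section \<open>Test functions and distributions\<close>

definition partial_deriv :: "'d::finite \<Rightarrow> (real^'d \<Rightarrow> real) \<Rightarrow> real^'d \<Rightarrow> real" where
  "partial_deriv i \<phi> x = frechet_derivative \<phi> (at x) (axis i 1)"

primrec n_times_continuously_differentiable :: "nat \<Rightarrow> (real^'d::finite \<Rightarrow> real) \<Rightarrow> bool" where
  "n_times_continuously_differentiable 0 \<phi> \<longleftrightarrow> continuous_on UNIV \<phi>"
| "n_times_continuously_differentiable (Suc n) \<phi> \<longleftrightarrow>
     \<phi> differentiable_on UNIV \<and> (\<forall>i. n_times_continuously_differentiable n (partial_deriv i \<phi>))"

definition smooth :: "(real^'d::finite \<Rightarrow> real) \<Rightarrow> bool" where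
  "smooth \<phi> \<longleftrightarrow> (\<forall>n. n_times_continuously_differentiable n \<phi>)"

text \<open>The index type carries no order, so the coordinates are differentiated in the order of an
  arbitrary enumeration. For smooth functions, the only ones to which this is applied, partial
  derivatives commute and the enumeration does not matter.\<close>

definition multi_deriv :: "('d::finite \<Rightarrow> nat) \<Rightarrow> (real^'d \<Rightarrow> real) \<Rightarrow> real^'d \<Rightarrow> real" where
  "multi_deriv k \<phi> = foldr (\<lambda>i. partial_deriv i ^^ k i) (SOME is. distinct is \<and> set is = UNIV) \<phi>"

definition test_function :: "(real^'d::finite \<Rightarrow> real) \<Rightarrow> bool" where
  "test_function \<phi> \<longleftrightarrow> smooth \<phi> \<and> compact (closure {x. \<phi> x \<noteq> 0})"

text \<open>Continuity is expressed by the usual seminorm estimates on each compact set. A distribution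
  is represented by a function on all of \<^typ>\<open>real^'d \<Rightarrow> real\<close>, of which only the values at test
  functions are meaningful.\<close>

definition distribution :: "((real^'d::finite \<Rightarrow> real) \<Rightarrow> real) \<Rightarrow> bool" where
  "distribution u \<longleftrightarrow>
     (\<forall>\<phi> \<psi>. test_function \<phi> \<longrightarrow> test_function \<psi> \<longrightarrow> u (\<lambda>x. \<phi> x + \<psi> x) = u \<phi> + u \<psi>) \<and>
     (\<forall>c \<phi>. test_function \<phi> \<longrightarrow> u (\<lambda>x. c * \<phi> x) = c * u \<phi>) \<and>
     (\<forall>K. compact K \<longrightarrow> (\<exists>C N. \<forall>\<phi>. test_function \<phi> \<longrightarrow> {x. \<phi> x \<noteq> 0} \<subseteq> K \<longrightarrow>
        \<bar>u \<phi>\<bar> \<le> C * (\<Sum>k\<in>{k. (\<Sum>i\<in>UNIV. k i) \<le> N}. SUP x. \<bar>multi_deriv k \<phi> x\<bar>)))"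

text \<open>Values in \<^typ>\<open>ennreal\<close> make the suprema meaningful without a boundedness condition.\<close>

definition scaled_C_norm :: "('d::finite \<Rightarrow> nat) \<Rightarrow> nat \<Rightarrow> (real^'d \<Rightarrow> real) \<Rightarrow> ennreal" where
  "scaled_C_norm s r \<eta> = (SUP k\<in>{k. scaled_degree s k \<le> r}. SUP x. ennreal \<bar>multi_deriv k \<eta> x\<bar>)"

definition unit_test_functions :: "('d::finite \<Rightarrow> nat) \<Rightarrow> nat \<Rightarrow> (real^'d \<Rightarrow> real) set" where
  "unit_test_functions s r =
     {\<eta>. smooth \<eta> \<and> {x. \<eta> x \<noteq> 0} \<subseteq> scaled_ball s 0 1 \<and> scaled_C_norm s r \<eta> \<le> 1}"

definition rescale ::
    "('d::finite \<Rightarrow> nat) \<Rightarrow> (real^'d \<Rightarrow> real) \<Rightarrow> real \<Rightarrow> real^'d \<Rightarrow> real^'d \<Rightarrow> real" where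
  "rescale s \<eta> l x = (\<lambda>z. \<eta> (\<chi> i. (z $ i - x $ i) / l ^ s i) / l ^ scaling_size s)"


section \<open>Regularity structures\<close>

text \<open>The type \<^typ>\<open>'t\<close> is the whole space $T$; it is the internal algebraic direct sum of the
  subspaces \<^term>\<open>rs_space R a\<close>, each of which has its own norm \<^term>\<open>rs_norm R a\<close>.
  The values of these two fields outside \<^term>\<open>rs_index R\<close> are irrelevant.\<close>

record 't reg_structure =
  rs_index :: "real set"
  rs_space :: "real \<Rightarrow> 't set"
  rs_norm :: "real \<Rightarrow> 't \<Rightarrow> real"
  rs_group :: "('t \<Rightarrow> 't) set"

definition banach_on :: "'t::real_vector set \<Rightarrow> ('t \<Rightarrow> real) \<Rightarrow> bool" where
  "banach_on V N \<longleftrightarrow>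
     subspace V \<and>
     (\<forall>v\<in>V. 0 \<le> N v \<and> (N v = 0 \<longleftrightarrow> v = 0)) \<and>
     (\<forall>c. \<forall>v\<in>V. N (c *\<^sub>R v) = \<bar>c\<bar> * N v) \<and>
     (\<forall>v\<in>V. \<forall>w\<in>V. N (v + w) \<le> N v + N w) \<and>
     (\<forall>X :: nat \<Rightarrow> 't. (\<forall>n. X n \<in> V) \<longrightarrow>
        (\<forall>e>0. \<exists>M. \<forall>m\<ge>M. \<forall>n\<ge>M. N (X m - X n) < e) \<longrightarrow>
        (\<exists>v\<in>V. (\<lambda>n. N (X n - v)) \<longlonglongrightarrow> 0))"

definition decomposition ::
    "'t::real_vector reg_structure \<Rightarrow> 't \<Rightarrow> (real \<Rightarrow> 't) \<Rightarrow> bool" where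
  "decomposition R \<tau> u \<longleftrightarrow>
     (\<forall>a\<in>rs_index R. u a \<in> rs_space R a) \<and> (\<forall>a. a \<notin> rs_index R \<longrightarrow> u a = 0) \<and>
     finite {a. u a \<noteq> 0} \<and> \<tau> = (\<Sum>a | u a \<noteq> 0. u a)"

definition proj :: "'t::real_vector reg_structure \<Rightarrow> real \<Rightarrow> 't \<Rightarrow> 't" where
  "proj R a \<tau> = (THE u. decomposition R \<tau> u) a"

definition comp_norm :: "'t::real_vector reg_structure \<Rightarrow> real \<Rightarrow> 't \<Rightarrow> real" where
  "comp_norm R a \<tau> = rs_norm R a (proj R a \<tau>)"

definition index_below :: "'t reg_structure \<Rightarrow> real \<Rightarrow> real set" where
  "index_below R \<gamma> = rs_index R \<inter> {..<\<gamma>}"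

definition space_below :: "'t::real_vector reg_structure \<Rightarrow> real \<Rightarrow> 't set" where
  "space_below R \<gamma> = span (\<Union>b\<in>index_below R \<gamma>. rs_space R b)"

definition regularity_structure :: "'t::real_vector reg_structure \<Rightarrow> bool" where
  "regularity_structure R \<longleftrightarrow>
     bdd_below (rs_index R) \<and> (\<forall>a b. finite (rs_index R \<inter> {a..b})) \<and>
     (\<forall>a\<in>rs_index R. banach_on (rs_space R a) (rs_norm R a)) \<and>
     (\<forall>\<tau>. \<exists>!u. decomposition R \<tau> u) \<and>
     (\<forall>g\<in>rs_group R. linear g) \<and>
     id \<in> rs_group R \<and>
     (\<forall>g\<in>rs_group R. \<forall>h\<in>rs_group R. g \<circ> h \<in> rs_group R) \<and>
     (\<forall>g\<in>rs_group R. \<exists>h\<in>rs_group R. g \<circ> h = id \<and> h \<circ> g = id) \<and>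
     (\<forall>g\<in>rs_group R. \<forall>a\<in>rs_index R. \<forall>\<tau>\<in>rs_space R a. g \<tau> - \<tau> \<in> space_below R a)"


section \<open>Models\<close>

text \<open>The index set is bounded below and locally finite, so its infimum is attained when it is
  nonempty. If \<^term>\<open>index_below R \<gamma>\<close> is empty, the value is junk, but then nothing is
  required of a model at level \<^term>\<open>\<gamma>\<close>.\<close>

definition test_regularity :: "'t reg_structure \<Rightarrow> real \<Rightarrow> nat" where
  "test_regularity R \<gamma> =
     (LEAST r. 0 < r \<and> max \<bar>Inf (rs_index R)\<bar> \<bar>Max (index_below R \<gamma>)\<bar> < real r)"

text \<open>The library has \<^term>\<open>0 powr 0 = (0::real)\<close>. The bound on $\Gamma_{x,x} = 1$ in the case
  $\beta = \zeta$ needs the convention $0^0 = 1$ instead.\<close>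

definition rpow :: "real \<Rightarrow> real \<Rightarrow> real" where
  "rpow a t = (if t = 0 then 1 else a powr t)"

text \<open>Continuity of \<^term>\<open>PI x\<close> on the direct sum, with values in the distributions, amounts to
  boundedness of \<^term>\<open>\<lambda>\<tau>. PI x \<tau> \<phi>\<close> on each summand, for each test function.\<close>

definition model ::
    "('d::finite \<Rightarrow> nat) \<Rightarrow> 't::real_vector reg_structure \<Rightarrow>
     (real^'d \<Rightarrow> 't \<Rightarrow> (real^'d \<Rightarrow> real) \<Rightarrow> real) \<Rightarrow> (real^'d \<Rightarrow> real^'d \<Rightarrow> 't \<Rightarrow> 't) \<Rightarrow> bool" where
  "model s R PI \<Gamma> \<longleftrightarrow>
     (\<forall>x \<tau>. distribution (PI x \<tau>)) \<and>
     (\<forall>x \<phi>. test_function \<phi> \<longrightarrow> linear (\<lambda>\<tau>. PI x \<tau> \<phi>)) \<and>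
     (\<forall>x \<phi>. test_function \<phi> \<longrightarrow>
        (\<forall>a\<in>rs_index R. \<exists>C. \<forall>\<tau>\<in>rs_space R a. \<bar>PI x \<tau> \<phi>\<bar> \<le> C * rs_norm R a \<tau>)) \<and>
     (\<forall>x y. \<Gamma> x y \<in> rs_group R) \<and>
     (\<forall>x. \<Gamma> x x = id) \<and>
     (\<forall>x y z. \<Gamma> x z \<circ> \<Gamma> z y = \<Gamma> x y) \<and>
     (\<forall>x y \<tau> \<phi>. test_function \<phi> \<longrightarrow> PI y \<tau> \<phi> = PI x (\<Gamma> x y \<tau>) \<phi>) \<and>
     (\<forall>\<gamma>>0. \<exists>C. \<forall>x. \<forall>\<eta>\<in>unit_test_functions s (test_regularity R \<gamma>). \<forall>l\<in>{0<..1}.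
        \<forall>a\<in>index_below R \<gamma>. \<forall>\<tau>\<in>rs_space R a.
          \<bar>PI x \<tau> (rescale s \<eta> l x)\<bar> \<le> C * comp_norm R a \<tau> * l powr a) \<and>
     (\<forall>\<gamma>>0. \<exists>C. \<forall>x. \<forall>y\<in>scaled_ball s x 1.
        \<forall>a\<in>index_below R \<gamma>. \<forall>\<tau>\<in>rs_space R a. \<forall>b\<in>rs_index R. b \<le> a \<longrightarrow>
          comp_norm R b (\<Gamma> x y \<tau>) \<le> C * comp_norm R a \<tau> * rpow (scaled_norm s (x - y)) (a - b))"


section \<open>Lebesgue norms\<close>

text \<open>Only used with positive exponents.\<close>

definition ennreal_powr :: "ennreal \<Rightarrow> real \<Rightarrow> ennreal" where
  "ennreal_powr a t = (if a = \<infinity> then \<infinity> else ennreal (enn2real a powr t))"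

definition L_norm :: "'a measure \<Rightarrow> ennreal \<Rightarrow> ('a \<Rightarrow> ennreal) \<Rightarrow> ennreal" where
  "L_norm M p g =
     (if p = \<infinity> then esssup M g
      else ennreal_powr (\<integral>\<^sup>+x. ennreal_powr (g x) (enn2real p) \<partial>M) (1 / enn2real p))"

definition scale_measure :: "real measure" where
  "scale_measure = density lebesgue (\<lambda>l. ennreal (indicator {0<..1} l / l))"

definition increment_measure :: "('d::finite \<Rightarrow> nat) \<Rightarrow> (real^'d) measure" where
  "increment_measure s =
     density lebesgue (\<lambda>h. ennreal (indicator (scaled_ball s 0 1) h / scaled_norm s h ^ scaling_size s))"


section \<open>Spaces of modelled distributions\<close>

text \<open>Measurability of a modelled distribution is strong (Bochner) measurability of its components,
  as the summands need not be separable. Since the limit is taken almost everywhere, using simple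
  functions for the Borel or for the Lebesgue sets gives the same notion.\<close>

definition modelled_function ::
    "'t::real_vector reg_structure \<Rightarrow> real \<Rightarrow> (real^'d::finite \<Rightarrow> 't) \<Rightarrow> bool" where
  "modelled_function R \<gamma> f \<longleftrightarrow>
     (\<forall>x. f x \<in> space_below R \<gamma>) \<and>
     (\<forall>a\<in>index_below R \<gamma>. \<exists>\<sigma> :: nat \<Rightarrow> real^'d \<Rightarrow> 't.
        (\<forall>n. simple_function lebesgue (\<sigma> n)) \<and> (\<forall>n x. \<sigma> n x \<in> rs_space R a) \<and>
        (AE x in lebesgue. (\<lambda>n. rs_norm R a (\<sigma> n x - proj R a (f x))) \<longlonglongrightarrow> 0))"

definition increment ::
    "'t::real_vector reg_structure \<Rightarrow> (real^'d \<Rightarrow> real^'d \<Rightarrow> 't \<Rightarrow> 't) \<Rightarrow> (real^'d::finite \<Rightarrow> 't) \<Rightarrow>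
     real \<Rightarrow> real^'d \<Rightarrow> real^'d \<Rightarrow> real" where
  "increment R \<Gamma> f a x h = comp_norm R a (f (x + h) - \<Gamma> (x + h) x (f x))"

definition D_norm ::
    "('d::finite \<Rightarrow> nat) \<Rightarrow> 't::real_vector reg_structure \<Rightarrow> (real^'d \<Rightarrow> real^'d \<Rightarrow> 't \<Rightarrow> 't) \<Rightarrow>
     real \<Rightarrow> ennreal \<Rightarrow> ennreal \<Rightarrow> (real^'d \<Rightarrow> 't) \<Rightarrow> ennreal" where
  "D_norm s R \<Gamma> \<gamma> p q f =
     (SUP a\<in>index_below R \<gamma>. L_norm lebesgue p (\<lambda>x. ennreal (comp_norm R a (f x)))) +
     (SUP a\<in>index_below R \<gamma>. L_norm scale_measure q (\<lambda>l. L_norm lebesgue p (\<lambda>x.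
        (\<integral>\<^sup>+h\<in>scaled_ball s 0 (4 * l). ennreal (increment R \<Gamma> f a x h / l powr (\<gamma> - a)) \<partial>lebesgue)
          / emeasure lebesgue (scaled_ball s 0 (4 * l)))))"

definition B_norm ::
    "('d::finite \<Rightarrow> nat) \<Rightarrow> 't::real_vector reg_structure \<Rightarrow> (real^'d \<Rightarrow> real^'d \<Rightarrow> 't \<Rightarrow> 't) \<Rightarrow>
     real \<Rightarrow> ennreal \<Rightarrow> ennreal \<Rightarrow> (real^'d \<Rightarrow> 't) \<Rightarrow> ennreal" where
  "B_norm s R \<Gamma> \<gamma> p q f =
     (SUP a\<in>index_below R \<gamma>. L_norm lebesgue p (\<lambda>x. ennreal (comp_norm R a (f x)))) +
     (SUP a\<in>index_below R \<gamma>. L_norm (increment_measure s) q (\<lambda>h. L_norm lebesgue p (\<lambda>x.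
        ennreal (increment R \<Gamma> f a x h / scaled_norm s h powr (\<gamma> - a)))))"

text \<open>The elements are representatives: functions that agree almost everywhere are not
  identified.\<close>

definition D_space ::
    "('d::finite \<Rightarrow> nat) \<Rightarrow> 't::real_vector reg_structure \<Rightarrow> (real^'d \<Rightarrow> real^'d \<Rightarrow> 't \<Rightarrow> 't) \<Rightarrow>
     real \<Rightarrow> ennreal \<Rightarrow> ennreal \<Rightarrow> (real^'d \<Rightarrow> 't) set" where
  "D_space s R \<Gamma> \<gamma> p q = {f. modelled_function R \<gamma> f \<and> D_norm s R \<Gamma> \<gamma> p q f < \<infinity>}"

definition B_space ::
    "('d::finite \<Rightarrow> nat) \<Rightarrow> 't::real_vector reg_structure \<Rightarrow> (real^'d \<Rightarrow> real^'d \<Rightarrow> 't \<Rightarrow> 't) \<Rightarrow>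
     real \<Rightarrow> ennreal \<Rightarrow> ennreal \<Rightarrow> (real^'d \<Rightarrow> 't) set" where
  "B_space s R \<Gamma> \<gamma> p q = {f. modelled_function R \<gamma> f \<and> B_norm s R \<Gamma> \<gamma> p q f < \<infinity>}"

end

theory Submission
  imports Defs
begin

text \<open>
  The norm of $\mathcal D^\gamma_{p,q}$ measures averages of the increments
  $f(x+h) - \<Gamma>_{x+h,x} f(x)$ over $h \in Q(0,4\lambda)$, that of $\mathcal B^\gamma_{p,q}$ measures
  the increments for each single $h$. Both weigh the $\zeta$-component by the distance to the power
  $\zeta - \gamma$, and the two integrals to the power $q$ can be traded for each other because
  $\int_{\lambda \le \|h\| \le 2\lambda} \|h\|^{-|\mathfrak s|} dh$ is a constant.

  From averages to single increments, the average over $h$ has to be undone without losing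
  regularity. Fix $x$ and $y = x + h$ and insert a third point $z = x + k$:
  \[ f(y) - \<Gamma>_{y,x} f(x) =
     \<Gamma>_{y,z} \bigl[ (f(z) - \<Gamma>_{z,x} f(x)) - (f(z) - \<Gamma>_{z,y} f(y)) \bigr]. \]
  The left hand side does not depend on $z$, while on the right there are only increments based at
  $x$ and at $y$, so averaging over $\|k\| \le \lambda$, where $\lambda \le \|h\| \le 2 \lambda$, gives
  the averages at scale $\lambda$ at the points $x$ and $x + h$. The map $\<Gamma>_{y,z}$ mixes the
  components, but at the right rate: the norm
  $\sum_\zeta \lambda^\zeta |\tau|_\zeta$ is preserved up to a constant by $\<Gamma>_{y,z}$ if
  $\|y - z\|$ is at most a multiple of $\lambda$ (\<open>weighted_norm_\<Gamma>_le\<close>). Taking the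
  $L^p$-norm in $x$, which is invariant under translation, bounds the $L^p$-norm of the increment by
  the $L^p$-norms of the averages at all comparable scales
  (\<open>increment_Lp_le_average_Lp\<close>), and an integration over $h$ concludes
  (\<open>L_norm_increment_le_scale\<close>).

  From single increments to averages, Minkowski's integral inequality takes the $L^p$-norm inside
  the average (\<open>average_Lp_le_average_increment_Lp\<close>), and for $\lambda \le 1/4$
  Jensen's inequality and Fubini's theorem do the rest (\<open>L_norm_scale_le_increment\<close>). For
  $\lambda > 1/4$ the average involves $\|h\| > 1$, which the norm of $\mathcal B^\gamma_{p,q}$ does
  not see; but there the increments are simply bounded by the values of $f$
  (\<open>average_Lp_le_values\<close>).

  Both parts use Fubini's theorem for increments, so the increments must be jointly measurable
  in $x$ and $h$. A modelled distribution is a limit of simple functions almost everywhere, and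
  $\<Gamma>_{x,y} \tau$ is continuous in $x$ and $y$ because of the bounds on the model. Hence the
  increments agree, for almost all $x$ and $x + h$, with a Borel function of the pair $(x, h)$
  (\<open>modelled_Borel_version\<close>), and all norms can be computed with that function.
\<close>

section \<open>Powers of extended nonnegative numbers\<close>

lemma ennreal_powr_ennreal: "0 \<le> x \<Longrightarrow> ennreal_powr (ennreal x) t = ennreal (x powr t)"
  by (simp add: ennreal_powr_def)

lemma ennreal_powr_top [simp]: "ennreal_powr top t = top"
  by (simp add: ennreal_powr_def)

lemma ennreal_powr_0 [simp]: "ennreal_powr 0 t = 0"
  by (simp add: ennreal_powr_def)

lemma ennreal_powr_one [simp]: "ennreal_powr a 1 = a"
  by (cases a) (auto simp: ennreal_powr_ennreal)

lemma ennreal_powr_eq_0_iff [simp]: "ennreal_powr a t = 0 \<longleftrightarrow> a = 0"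
  by (cases a) (auto simp: ennreal_powr_ennreal)

lemma ennreal_powr_mono: "0 \<le> t \<Longrightarrow> a \<le> b \<Longrightarrow> ennreal_powr a t \<le> ennreal_powr b t"
  by (cases a; cases b)
     (auto simp: ennreal_powr_ennreal ennreal_leI top_unique intro!: ennreal_leI powr_mono2)

lemma ennreal_powr_mult: "ennreal_powr (a * b) t = ennreal_powr a t * ennreal_powr b t"
proof (cases "a = 0 \<or> b = 0 \<or> a = top \<or> b = top")
  case True
  then show ?thesis
    by (cases "a = 0"; cases "b = 0")
       (auto simp: ennreal_mult_eq_top_iff ennreal_top_mult ennreal_mult_top)
next
  case False
  then obtain x y where "a = ennreal x" "0 \<le> x" "b = ennreal y" "0 \<le> y"
    by (cases a; cases b) auto
  then show ?thesis
    by (simp add: ennreal_powr_ennreal powr_mult flip: ennreal_mult)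
qed

lemma ennreal_powr_powr: "ennreal_powr (ennreal_powr a t) u = ennreal_powr a (t * u)"
  by (cases a) (auto simp: ennreal_powr_ennreal powr_powr)

lemma ennreal_powr_le_iff:
  assumes "0 < t"
  shows "ennreal_powr a (1 / t) \<le> b \<longleftrightarrow> a \<le> ennreal_powr b t"
  using ennreal_powr_mono[of t "ennreal_powr a (1 / t)" b] ennreal_powr_mono[of "1 / t" a "ennreal_powr b t"] assms
  by (auto simp: ennreal_powr_powr)

lemma measurable_ennreal_powr [measurable]:
  "(\<lambda>a. ennreal_powr a t) \<in> borel_measurable borel"
  unfolding ennreal_powr_def by measurable

lemma ennreal_inverse_times_self: "a \<noteq> 0 \<Longrightarrow> a \<noteq> top \<Longrightarrow> inverse a * a = (1::ennreal)"
  using ennreal_divide_self[of a] by (simp add: divide_ennreal_def mult.commute top.not_eq_extremum)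

text \<open>The graph of the convex function $u \mapsto u^t$ lies above its tangent at $c$.\<close>

lemma tangent_powr_ineq:
  fixes t c u :: real
  assumes "1 \<le> t" "0 < c" "0 \<le> u"
  shows "t * c powr (t - 1) * u \<le> u powr t + (t - 1) * c powr t"
proof -
  have *: "t * v \<le> v powr t + (t - 1)" if "0 \<le> v" for v :: real
  proof (cases "v = 0")
    case False
    then have "v \<le> v powr t / t + (1 - 1 / t)"
      using Youngs_inequality_0[of "1 / t" "1 - 1 / t" "v powr t" 1] assms that
      by (simp add: powr_powr)
    then have "t * v \<le> t * (v powr t / t + (1 - 1 / t))"
      using assms by (intro mult_left_mono) auto
    then show ?thesis using assms by (simp add: algebra_simps)
  qed (use assms in auto)
  have "c powr t * (t * (u / c)) \<le> c powr t * ((u / c) powr t + (t - 1))"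
    using *[of "u / c"] assms by (intro mult_left_mono) auto
  moreover have "c powr t * (u / c) powr t = u powr t"
    using assms by (simp flip: powr_mult)
  moreover have "c powr t = c * c powr (t - 1)"
    using assms by (simp add: powr_diff)
  ultimately show ?thesis using assms by (simp add: algebra_simps)
qed

text \<open>Integrating the tangent inequality at $c = \int u$ gives Jensen's inequality. If that integral
  is infinite, the tangent at 1 already shows that both sides are.\<close>

lemma jensen_ennreal_powr:
  assumes prob: "emeasure M (space M) = 1" and [measurable]: "u \<in> borel_measurable M" and t: "1 \<le> t"
  shows "ennreal_powr (\<integral>\<^sup>+x. u x \<partial>M) t \<le> (\<integral>\<^sup>+x. ennreal_powr (u x) t \<partial>M)"
proof -
  have *: "ennreal (t * c powr (t - 1)) * (\<integral>\<^sup>+x. u x \<partial>M) \<le> (\<integral>\<^sup>+x. ennreal_powr (u x) t \<partial>M) + ennreal ((t - 1) * c powr t)"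
    if c: "0 < c" for c
  proof -
    have "ennreal (t * c powr (t - 1)) * u x \<le> ennreal_powr (u x) t + ennreal ((t - 1) * c powr t)" for x
    proof (cases "u x")
      case (real v)
      then show ?thesis
        using tangent_powr_ineq[OF t c, of v] t
        by (simp add: ennreal_powr_ennreal flip: ennreal_mult ennreal_plus)
    qed auto
    then have "(\<integral>\<^sup>+x. ennreal (t * c powr (t - 1)) * u x \<partial>M) \<le>
        (\<integral>\<^sup>+x. ennreal_powr (u x) t + ennreal ((t - 1) * c powr t) \<partial>M)"
      by (intro nn_integral_mono) auto
    then show ?thesis
      by (simp add: nn_integral_cmult nn_integral_add prob)
  qed
  show ?thesis
  proof (cases "\<integral>\<^sup>+x. u x \<partial>M")
    case top
    then have "top \<le> (\<integral>\<^sup>+x. ennreal_powr (u x) t \<partial>M) + ennreal (t - 1)"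
      using *[of 1] t by (simp add: ennreal_mult_top)
    then show ?thesis by (simp add: top_unique ennreal_add_eq_top)
  next
    case (real c)
    show ?thesis
    proof (cases "c = 0")
      case False
      then have "ennreal (t * c powr t) \<le> (\<integral>\<^sup>+x. ennreal_powr (u x) t \<partial>M) + ennreal ((t - 1) * c powr t)"
        using *[of c] real t by (simp add: powr_diff flip: ennreal_mult)
      also have "ennreal (t * c powr t) = ennreal (c powr t) + ennreal ((t - 1) * c powr t)"
        using t mult_right_mono[of 1 t "c powr t"]
        by (subst ennreal_plus[symmetric]) (auto simp: left_diff_distrib)
      finally show ?thesis using real by (simp add: ennreal_powr_ennreal)
    qed (use real in simp)
  qed
qed

lemma self_le_ennreal_powr: "1 \<le> a \<Longrightarrow> 1 \<le> t \<Longrightarrow> a \<le> ennreal_powr a t"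
  by (cases a) (auto simp: ennreal_powr_ennreal intro!: ennreal_leI
    intro: order_trans[OF eq_refl[OF powr_one[symmetric]] powr_mono[of 1]])

lemma one_le_ennreal_power2: "1 \<le> ennreal (2 ^ n)"
  using ennreal_leI[of 1 "2 ^ n"] by simp

lemma average_powr_le:
  assumes A [measurable]: "A \<in> sets M" and fin: "emeasure M A \<noteq> 0" "emeasure M A \<noteq> top"
    and [measurable]: "u \<in> borel_measurable M" and t: "1 \<le> t"
  shows "ennreal_powr ((\<integral>\<^sup>+x\<in>A. u x \<partial>M) / emeasure M A) t \<le>
    (\<integral>\<^sup>+x\<in>A. ennreal_powr (u x) t \<partial>M) / emeasure M A"
proof -
  let ?\<nu> = "density M (\<lambda>x. indicator A x / emeasure M A)"
  have *: "(\<integral>\<^sup>+x. v x \<partial>?\<nu>) = (\<integral>\<^sup>+x\<in>A. v x \<partial>M) / emeasure M A"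
    if [measurable]: "v \<in> borel_measurable M" for v
    by (subst nn_integral_density)
       (auto simp: ac_simps ennreal_times_divide simp flip: nn_integral_divide)
  have "emeasure ?\<nu> (space ?\<nu>) = 1"
    using *[of "\<lambda>_. 1"] fin by (simp add: top.not_eq_extremum)
  then show ?thesis
    using jensen_ennreal_powr[of ?\<nu> u t] t by (simp add: *)
qed

section \<open>Lebesgue norms of nonnegative functions\<close>

lemma L_norm_top [simp]: "L_norm M top g = esssup M g"
  by (simp add: L_norm_def)

lemma enn2real_ge_1: "1 \<le> p \<Longrightarrow> p \<noteq> top \<Longrightarrow> 1 \<le> enn2real p"
  by (cases p) auto

lemma L_norm_le_iff:
  assumes "1 \<le> p" "p \<noteq> top"
  shows "L_norm M p g \<le> c \<longleftrightarrow>
    (\<integral>\<^sup>+x. ennreal_powr (g x) (enn2real p) \<partial>M) \<le> ennreal_powr c (enn2real p)"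
  using enn2real_ge_1[OF assms] assms(2) by (simp add: L_norm_def ennreal_powr_le_iff)

lemma L_norm_powr:
  assumes "1 \<le> p" "p \<noteq> top"
  shows "ennreal_powr (L_norm M p g) (enn2real p) = (\<integral>\<^sup>+x. ennreal_powr (g x) (enn2real p) \<partial>M)"
  using enn2real_ge_1[OF assms] assms(2) by (simp add: L_norm_def ennreal_powr_powr)

lemma esssup_le_iff:
  fixes g :: "'a \<Rightarrow> ennreal"
  assumes "g \<in> borel_measurable M"
  shows "esssup M g \<le> c \<longleftrightarrow> (AE x in M. g x \<le> c)"
  using esssup_AE[of g M] esssup_I[OF assms, of c] by (auto elim: eventually_mono)

lemma L_norm_mono_AE:
  assumes "1 \<le> p" and [measurable]: "f \<in> borel_measurable M" and le: "AE x in M. f x \<le> g x"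
  shows "L_norm M p f \<le> L_norm M p g"
proof (cases "p = top")
  case True
  then show ?thesis using le by (simp add: esssup_AE_mono)
next
  case False
  have "AE x in M. ennreal_powr (f x) (enn2real p) \<le> ennreal_powr (g x) (enn2real p)"
    using le by (auto elim!: eventually_mono intro: ennreal_powr_mono)
  then show ?thesis
    by (simp add: L_norm_le_iff L_norm_powr nn_integral_mono_AE assms False)
qed

lemma L_norm_cong_AE:
  assumes "1 \<le> p" "f \<in> borel_measurable M" "g \<in> borel_measurable M" "AE x in M. f x = g x"
  shows "L_norm M p f = L_norm M p g"
  using assms by (intro antisym L_norm_mono_AE) auto

lemma L_norm_cmult_le:
  assumes "1 \<le> p" and [measurable]: "f \<in> borel_measurable M"
  shows "L_norm M p (\<lambda>x. c * f x) \<le> c * L_norm M p f"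
proof (cases "p = top")
  case True
  have "AE x in M. c * f x \<le> c * esssup M f"
    using esssup_AE[of f M] by eventually_elim (simp add: mult_left_mono)
  with True show ?thesis by (auto intro: esssup_I)
next
  case False
  then show ?thesis
    by (simp add: L_norm_le_iff L_norm_powr ennreal_powr_mult nn_integral_cmult assms)
qed

lemma L_norm_distr:
  assumes [measurable]: "T \<in> measurable M N" "f \<in> borel_measurable N"
  shows "L_norm (distr M N T) p f = L_norm M p (\<lambda>x. f (T x))"
  by (auto simp: L_norm_def nn_integral_distr esssup_eq_AE AE_distr_iff)

lemma L_norm_translation:
  fixes f :: "'a::euclidean_space \<Rightarrow> ennreal"
  assumes [measurable]: "f \<in> borel_measurable borel"
  shows "L_norm lborel p (\<lambda>x. f (x + h)) = L_norm lborel p f"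
proof -
  have "L_norm lborel p f = L_norm (distr lborel borel ((+) h)) p f"
    by (simp add: lborel_distr_plus)
  also have "\<dots> = L_norm lborel p (\<lambda>x. f (h + x))"
    by (intro L_norm_distr) auto
  finally show ?thesis by (simp add: add.commute)
qed

text \<open>Only null sets and integrals enter the norm, and neither sees the completion. This is what
  reduces Lebesgue measure to Borel measure, for which products of measures are manageable.\<close>

lemma L_norm_density_completion:
  assumes [measurable]: "w \<in> borel_measurable M" "f \<in> borel_measurable M"
  shows "L_norm (density (completion M) w) p f = L_norm (density M w) p f"
proof -
  have [measurable]: "w \<in> borel_measurable (completion M)" "f \<in> borel_measurable (completion M)"
    by (auto intro: measurable_completion)
  show ?thesis
    by (simp add: L_norm_def nn_integral_density nn_integral_completion esssup_eq_AE AE_density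
        AE_completion_iff)
qed

lemma L_norm_completion:
  "f \<in> borel_measurable M \<Longrightarrow> L_norm (completion M) p f = L_norm M p f"
  using L_norm_density_completion[of "\<lambda>_. 1" M f p] by (simp add: density_1)

text \<open>For $p = \infty$, an essential supremum is at most $c$ iff the integral of the indicator of the
  superlevel set vanishes, which is a measurable condition on the parameter.\<close>

lemma borel_measurable_L_norm:
  assumes "sigma_finite_measure M" and [measurable]: "F \<in> borel_measurable (N \<Otimes>\<^sub>M M)"
  shows "(\<lambda>y. L_norm M p (\<lambda>x. F (y, x))) \<in> borel_measurable N"
proof -
  interpret sigma_finite_measure M by fact
  show ?thesis
  proof (cases "p = top")
    case False
    then show ?thesis unfolding L_norm_def by simp
  next
    case True
    have "(\<lambda>y. esssup M (\<lambda>x. F (y, x))) \<in> borel_measurable N"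
    proof (rule borel_measurableI_le)
      fix c :: ennreal
      have "{y \<in> space N. esssup M (\<lambda>x. F (y, x)) \<le> c} =
          {y \<in> space N. (\<integral>\<^sup>+x. indicator {c<..} (F (y, x)) \<partial>M) = 0}"
        by (auto simp: esssup_le_iff nn_integral_0_iff_AE indicator_eq_0_iff not_less)
      also have "\<dots> \<in> sets N" by measurable
      finally show "{y \<in> space N. esssup M (\<lambda>x. F (y, x)) \<le> c} \<in> sets N" .
    qed
    with True show ?thesis by simp
  qed
qed

lemma L_norm_eq_0_imp_AE:
  assumes p: "1 \<le> p" and [measurable]: "f \<in> borel_measurable M" and 0: "L_norm M p f = 0"
  shows "AE x in M. f x = 0"
proof (cases "p = top")
  case True
  then show ?thesis using 0 esssup_AE[of f M] by simp
next
  case False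
  have "(\<integral>\<^sup>+x. ennreal_powr (f x) (enn2real p) \<partial>M) = 0"
    using L_norm_powr[OF p False, of M f] 0 by simp
  then show ?thesis by (simp add: nn_integral_0_iff_AE)
qed

text \<open>Minkowski's integral inequality. The usual proof by duality divides by a power of the norm
  of the left hand side, which may be infinite. Instead, let $G(y)$ be the $L^p$-norm of
  $F(\cdot, y)$ and $K = \int G$, and write $F = (K F / G) \cdot (G / K)$, where $G / K$ is a
  probability density in $y$. Jensen's inequality for that density and Fubini's theorem give
  $\int (\int F\, dy)^p dx \le \int K^p G^{-p} (\int F^p dx)\, G / K\, dy = K^p$.\<close>

lemma L_norm_nn_integral_le:
  assumes "sigma_finite_measure M" "sigma_finite_measure N"
    and F [measurable]: "F \<in> borel_measurable (M \<Otimes>\<^sub>M N)" and p: "1 \<le> p"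
  shows "L_norm M p (\<lambda>x. \<integral>\<^sup>+y. F (x, y) \<partial>N) \<le> (\<integral>\<^sup>+y. L_norm M p (\<lambda>x. F (x, y)) \<partial>N)"
proof -
  interpret M: sigma_finite_measure M by fact
  interpret N: sigma_finite_measure N by fact
  interpret pair_sigma_finite M N by unfold_locales
  define G where "G y = L_norm M p (\<lambda>x. F (x, y))" for y
  define K where "K = (\<integral>\<^sup>+y. G y \<partial>N)"
  have G [measurable]: "G \<in> borel_measurable N"
    unfolding G_def using borel_measurable_L_norm[OF assms(1), of "\<lambda>(y, x). F (x, y)" N p] by simp
  show ?thesis
  proof (cases "p = top")
    case True
    have "AE y in N. AE x in M. F (x, y) \<le> G y"
      unfolding G_def using True esssup_AE[of "\<lambda>x. F (x, y)" M for y] by (intro AE_I2[of N]) simp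
    then have "AE x in M. AE y in N. F (x, y) \<le> G y"
      by (subst AE_commute) auto
    then have "AE x in M. (\<integral>\<^sup>+y. F (x, y) \<partial>N) \<le> K"
      unfolding K_def by eventually_elim (rule nn_integral_mono_AE)
    then show ?thesis
      unfolding K_def[unfolded G_def, symmetric] using True by (auto intro: esssup_I)
  next
    case False
    define t where "t = enn2real p"
    have t: "1 \<le> t" unfolding t_def using p False by (rule enn2real_ge_1)
    \<comment> \<open>Dividing $F$ by $G$ loses nothing where $G$ vanishes.\<close>
    have zero: "AE x in M. AE y in N. G y = 0 \<longrightarrow> F (x, y) = 0"
    proof (subst AE_commute)
      have "AE x in M. G y = 0 \<longrightarrow> F (x, y) = 0" if "y \<in> space N" for y
        using L_norm_eq_0_imp_AE[OF p, of "\<lambda>x. F (x, y)" M] that by (cases "G y = 0") (auto simp: G_def)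
      then show "AE y in N. AE x in M. G y = 0 \<longrightarrow> F (x, y) = 0" by (intro AE_I2[of N])
    qed measurable
    consider "K = top" | "K = 0" | "K \<noteq> 0" "K \<noteq> top" by blast
    then have "L_norm M p (\<lambda>x. \<integral>\<^sup>+y. F (x, y) \<partial>N) \<le> K"
    proof cases
      case 2
      then have G0: "AE y in N. G y = 0" unfolding K_def by (simp add: nn_integral_0_iff_AE)
      have "AE x in M. (\<integral>\<^sup>+y. F (x, y) \<partial>N) = 0"
        using zero
      proof (eventually_elim, goal_cases)
        case (1 x)
        then have "AE y in N. F (x, y) = 0" using G0 by eventually_elim simp
        then have "(\<integral>\<^sup>+y. F (x, y) \<partial>N) = (\<integral>\<^sup>+y. 0 \<partial>N)" by (rule nn_integral_cong_AE)
        then show ?case by simp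
      qed
      then have "L_norm M p (\<lambda>x. \<integral>\<^sup>+y. F (x, y) \<partial>N) \<le> L_norm M p (\<lambda>x. 0)"
        by (intro L_norm_mono_AE p) auto
      also have "\<dots> = 0" using False by (simp add: L_norm_def)
      finally show ?thesis by simp
    next
      case 3
      have KK: "K / K = 1" using 3 by (simp add: top.not_eq_extremum)
      \<comment> \<open>The probability density with respect to which Jensen's inequality is used.\<close>
      define \<nu> where "\<nu> = density N (\<lambda>y. G y / K)"
      have prob: "emeasure \<nu> (space \<nu>) = 1"
        by (simp add: KK \<nu>_def emeasure_density K_def[symmetric] nn_integral_divide cong: nn_integral_cong)
      have fin: "AE y in N. G y \<noteq> top"
        using nn_integral_PInf_AE[OF G] 3 by (simp add: K_def)
      have "AE x in M. ennreal_powr (\<integral>\<^sup>+y. F (x, y) \<partial>N) t \<le>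
          (\<integral>\<^sup>+y. ennreal_powr (K * inverse (G y) * F (x, y)) t * (G y / K) \<partial>N)"
        using zero AE_space
      proof (eventually_elim, goal_cases)
        case (1 x)
        then have [measurable]: "(\<lambda>y. F (x, y)) \<in> borel_measurable N" by simp
        note KK' = KK[unfolded divide_ennreal_def]
        have "(\<integral>\<^sup>+y. F (x, y) \<partial>N) = (\<integral>\<^sup>+y. G y / K * (K * inverse (G y) * F (x, y)) \<partial>N)"
        proof (intro nn_integral_cong_AE, use 1(1) fin in eventually_elim)
          case (elim y)
          have "G y / K * (K * inverse (G y) * F (x, y)) = (K * inverse K) * (inverse (G y) * G y) * F (x, y)"
            by (simp add: divide_ennreal_def ac_simps)
          then show ?case
            using elim by (cases "G y = 0") (auto simp: KK' ennreal_inverse_times_self)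
        qed
        also have "\<dots> = (\<integral>\<^sup>+y. K * inverse (G y) * F (x, y) \<partial>\<nu>)"
          unfolding \<nu>_def by (intro nn_integral_density[symmetric]) measurable
        also have "ennreal_powr \<dots> t \<le> (\<integral>\<^sup>+y. ennreal_powr (K * inverse (G y) * F (x, y)) t \<partial>\<nu>)"
          by (intro jensen_ennreal_powr prob t) (simp add: \<nu>_def)
        also have "\<dots> = (\<integral>\<^sup>+y. ennreal_powr (K * inverse (G y) * F (x, y)) t * (G y / K) \<partial>N)"
          unfolding \<nu>_def by (subst nn_integral_density) (auto simp: mult.commute)
        finally show ?case .
      qed
      then have "(\<integral>\<^sup>+x. ennreal_powr (\<integral>\<^sup>+y. F (x, y) \<partial>N) t \<partial>M) \<le>
          (\<integral>\<^sup>+x. \<integral>\<^sup>+y. ennreal_powr (K * inverse (G y) * F (x, y)) t * (G y / K) \<partial>N \<partial>M)"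
        by (rule nn_integral_mono_AE)
      also have "\<dots> = (\<integral>\<^sup>+y. \<integral>\<^sup>+x. ennreal_powr (K * inverse (G y) * F (x, y)) t * (G y / K) \<partial>M \<partial>N)"
        by (rule Fubini'[symmetric]) measurable
      also have "\<dots> \<le> (\<integral>\<^sup>+y. ennreal_powr K t * (G y / K) \<partial>N)"
      proof (intro nn_integral_mono_AE, use fin AE_space in eventually_elim)
        case (elim y)
        then have [measurable]: "(\<lambda>x. F (x, y)) \<in> borel_measurable M" by simp
        have "(\<integral>\<^sup>+x. ennreal_powr (K * inverse (G y) * F (x, y)) t * (G y / K) \<partial>M) =
            ennreal_powr (K * inverse (G y)) t * ennreal_powr (G y) t * (G y / K)"
          unfolding G_def t_def
          by (subst L_norm_powr[OF p False]) (simp add: ennreal_powr_mult nn_integral_cmult nn_integral_multc)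
        also have "\<dots> \<le> ennreal_powr K t * (G y / K)"
          using elim by (cases "G y = 0")
            (auto simp: mult.assoc ennreal_inverse_times_self simp flip: ennreal_powr_mult)
        finally show ?case .
      qed
      also have "\<dots> = ennreal_powr K t"
        using prob 3 by (simp add: \<nu>_def emeasure_density nn_integral_cmult K_def[symmetric] nn_integral_divide)
      finally show ?thesis
        using p False by (simp add: L_norm_le_iff t_def)
    qed simp
    then show ?thesis by (simp add: K_def G_def)
  qed
qed

text \<open>A finite sum is an integral with respect to the counting measure.\<close>

lemma L_norm_sum_le:
  fixes F :: "'i \<Rightarrow> 'a \<Rightarrow> ennreal"
  assumes "sigma_finite_measure M" "finite B"
    and [measurable]: "\<And>b. b \<in> B \<Longrightarrow> F b \<in> borel_measurable M" and p: "1 \<le> p"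
  shows "L_norm M p (\<lambda>x. \<Sum>b\<in>B. F b x) \<le> (\<Sum>b\<in>B. L_norm M p (F b))"
proof -
  have "L_norm M p (\<lambda>x. \<integral>\<^sup>+b. (case (x, b) of (x, b) \<Rightarrow> F b x) \<partial>count_space B)
      \<le> (\<integral>\<^sup>+b. L_norm M p (\<lambda>x. case (x, b) of (x, b) \<Rightarrow> F b x) \<partial>count_space B)"
  proof (rule L_norm_nn_integral_le[OF assms(1) _ _ p])
    show "sigma_finite_measure (count_space B)"
      using assms(2) by (intro sigma_finite_measure_count_space_countable countable_finite)
    show "(\<lambda>(x, b). F b x) \<in> borel_measurable (M \<Otimes>\<^sub>M count_space B)"
      using assms(2) 
      by (subst measurable_pair_swap_iff) (auto intro!: measurable_pair_measure_countable1 countable_finite)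
  qed
  then show ?thesis using assms(2) by (simp add: nn_integral_count_space_finite)
qed

lemma L_norm_add_le:
  assumes "sigma_finite_measure M" "1 \<le> p" "f \<in> borel_measurable M" "g \<in> borel_measurable M"
  shows "L_norm M p (\<lambda>x. f x + g x) \<le> L_norm M p f + L_norm M p g"
  using L_norm_sum_le[OF assms(1) finite[of UNIV], of "\<lambda>b. if b then f else g" p] assms(2-)
  by (simp add: UNIV_bool add.commute)

text \<open>A function that agrees with a measurable one almost everywhere is measurable for the
  completion. For $p = \infty$ this matters also for the value of the norm, since the essential
  supremum of a function that is not measurable is infinite by convention.\<close>

lemma measurable_completion_AE_cong:
  fixes f g :: "'a \<Rightarrow> 'b::topological_space"
  assumes [measurable]: "g \<in> borel_measurable M" and ae: "AE x in M. f x = g x"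
  shows "f \<in> borel_measurable (completion M)"
proof (rule measurableI)
  fix S :: "'b set" assume "S \<in> sets borel"
  then have "Measurable.pred M (\<lambda>x. g x \<in> S)" by measurable
  then have "Measurable.pred (completion M) (\<lambda>x. g x \<in> S)" by (rule measurable_completion)
  moreover have "Measurable.pred (completion M) (\<lambda>x. f x \<noteq> g x)"
    by (rule sets_completion_AE) (use ae in auto)
  moreover have "Measurable.pred (completion M) (\<lambda>x. f x \<in> S \<and> f x \<noteq> g x)"
    by (rule sets_completion_AE) (use ae in eventually_elim, auto)
  ultimately have "Measurable.pred (completion M) (\<lambda>x. (g x \<in> S \<and> \<not> f x \<noteq> g x) \<or> (f x \<in> S \<and> f x \<noteq> g x))"
    by measurable
  also have "(\<lambda>x. (g x \<in> S \<and> \<not> f x \<noteq> g x) \<or> (f x \<in> S \<and> f x \<noteq> g x)) = (\<lambda>x. f x \<in> S)"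
    by auto
  finally show "f -` S \<inter> space (completion M) \<in> sets (completion M)"
    by (simp add: pred_def vimage_def Int_def conj_commute)
qed simp

lemma L_norm_completion_AE:
  assumes "1 \<le> p" and g: "g \<in> borel_measurable M" and ae: "AE x in M. f x = g x"
  shows "L_norm (completion M) p f = L_norm M p g"
proof -
  have "L_norm (completion M) p f = L_norm (completion M) p g"
    using assms by (intro L_norm_cong_AE measurable_completion_AE_cong[OF g ae] measurable_completion[OF g] AE_completion) auto
  then show ?thesis using L_norm_completion[OF g] by simp
qed

lemma sum_le_card_SUP:
  fixes u :: "'a \<Rightarrow> ennreal"
  shows "(\<Sum>b\<in>B. u b) \<le> of_nat (card B) * (SUP b\<in>B. u b)"
  by (rule sum_bounded_above) (rule SUP_upper)

section \<open>The measures on scales and on increments\<close>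

text \<open>The measures $\lambda^{-1} d\lambda$ on $(0,1]$ and $\|h\|^{-|\mathfrak s|} dh$ on $Q(0,1)$ on the
  Borel sets, so that Fubini's theorem can be used for functions that are Borel in both variables.\<close>

definition scale_lborel :: "real measure" where
  "scale_lborel = density lborel (\<lambda>l. ennreal (indicator {0<..1} l / l))"

definition increment_lborel :: "('d::finite \<Rightarrow> nat) \<Rightarrow> (real^'d) measure" where
  "increment_lborel s =
     density lborel (\<lambda>h. ennreal (indicator (scaled_ball s 0 1) h / scaled_norm s h ^ scaling_size s))"

lemma sets_scale_lborel [simp, measurable_cong]: "sets scale_lborel = sets borel"
  by (simp add: scale_lborel_def)

lemma sets_increment_lborel [simp, measurable_cong]: "sets (increment_lborel s) = sets borel"
  by (simp add: increment_lborel_def)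

lemma AE_lborel_ex_in_interval:
  fixes a b :: real
  assumes "AE l in lborel. P l" "a < b"
  shows "\<exists>l\<in>{a..b}. P l"
proof (rule ccontr)
  assume *: "\<not> (\<exists>l\<in>{a..b}. P l)"
  have "AE l in lborel. l \<notin> {a..b}"
    using assms(1) by eventually_elim (use * in blast)
  then have "{a..b} \<in> null_sets lborel" by (subst AE_iff_null_sets) auto
  then show False using \<open>a < b\<close> by (simp add: null_sets_def)
qed

lemma AE_scale_lborel: "(AE l in scale_lborel. P l) \<longleftrightarrow> (AE l in lborel. 0 < l \<and> l \<le> 1 \<longrightarrow> P l)"
  unfolding scale_lborel_def by (subst AE_density) (auto simp: indicator_def)

lemma sigma_finite_scale_lborel: "sigma_finite_measure scale_lborel"
  unfolding scale_lborel_def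
  by (subst sigma_finite_measure.sigma_finite_iff_density_finite[OF sigma_finite_lborel]) auto

section \<open>The scaled norm\<close>

lemma power_add_ge_add_power:
  fixes a b :: real
  assumes "0 \<le> a" "0 \<le> b" "0 < n"
  shows "a ^ n + b ^ n \<le> (a + b) ^ n"
  using \<open>0 < n\<close>
proof (induction n rule: nat_induct_non_zero)
  case (Suc n)
  have "a ^ Suc n + b ^ Suc n \<le> (a + b) * (a ^ n + b ^ n)"
    using assms by (simp add: algebra_simps)
  also have "\<dots> \<le> (a + b) * (a + b) ^ n"
    using Suc assms by (intro mult_left_mono) auto
  finally show ?case by simp
qed simp

context
  fixes s :: "'d::finite \<Rightarrow> nat"
  assumes s_pos: "\<And>i. 0 < s i"
begin

lemma scaled_norm_le_iff:
  assumes "0 \<le> r"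
  shows "scaled_norm s x \<le> r \<longleftrightarrow> (\<forall>i. \<bar>x $ i\<bar> \<le> r ^ s i)"
proof -
  have "a powr (1 / real (s i)) \<le> r \<longleftrightarrow> a \<le> r ^ s i" if "0 \<le> a" for a i
  proof -
    have "a powr (1 / real (s i)) \<le> r \<longleftrightarrow> (a powr (1 / real (s i))) ^ s i \<le> r ^ s i"
      using assms s_pos[of i] by (simp add: power_mono_iff)
    also have "(a powr (1 / real (s i))) ^ s i = a"
      using that s_pos[of i] by (simp add: powr_powr flip: powr_realpow')
    finally show ?thesis .
  qed
  then show ?thesis by (auto simp: scaled_norm_def)
qed

lemma scaled_norm_nonneg [simp]: "0 \<le> scaled_norm s x"
proof -
  have "0 \<le> \<bar>x $ undefined\<bar> powr (1 / real (s undefined))" by simp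
  also have "\<dots> \<le> scaled_norm s x" unfolding scaled_norm_def by (rule Max_ge) auto
  finally show ?thesis .
qed

lemma abs_le_scaled_norm: "\<bar>x $ i\<bar> \<le> scaled_norm s x ^ s i"
  using scaled_norm_le_iff[of "scaled_norm s x" x] by simp

lemma scaled_norm_0 [simp]: "scaled_norm s 0 = 0"
  using scaled_norm_le_iff[of 0 0] by (intro antisym) auto

lemma scaled_norm_eq_0_iff [simp]: "scaled_norm s x = 0 \<longleftrightarrow> x = 0"
proof
  assume "scaled_norm s x = 0"
  then have "\<bar>x $ i\<bar> \<le> 0" for i
    using abs_le_scaled_norm[of x i] s_pos[of i] by (simp add: power_0_left)
  then show "x = 0" by (simp add: vec_eq_iff)
qed simp

lemma scaled_norm_pos: "x \<noteq> 0 \<Longrightarrow> 0 < scaled_norm s x"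
  by (simp add: order_less_le)

lemma scaled_norm_minus [simp]: "scaled_norm s (- x) = scaled_norm s x"
  by (simp add: scaled_norm_def)

text \<open>The scaled norm is not homogeneous, but it is subadditive, since $t \mapsto t^{1/n}$ is.\<close>

lemma scaled_norm_triangle: "scaled_norm s (x + y) \<le> scaled_norm s x + scaled_norm s y"
proof -
  have "\<bar>(x + y) $ i\<bar> \<le> (scaled_norm s x + scaled_norm s y) ^ s i" for i
  proof -
    have "\<bar>(x + y) $ i\<bar> \<le> scaled_norm s x ^ s i + scaled_norm s y ^ s i"
      using abs_le_scaled_norm[of x i] abs_le_scaled_norm[of y i] by simp
    also have "\<dots> \<le> (scaled_norm s x + scaled_norm s y) ^ s i"
      using s_pos by (intro power_add_ge_add_power) auto
    finally show ?thesis .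
  qed
  then show ?thesis by (simp add: scaled_norm_le_iff)
qed

text \<open>Halving a vector reduces its scaled norm by a fixed factor below 1, although not by $1/2$. This
  is enough to join two points by a chain of small steps.\<close>

lemma scaled_norm_half: "scaled_norm s (x /\<^sub>R 2) \<le> 2 powr (- 1 / scaling_size s) * scaled_norm s x"
proof -
  let ?\<theta> = "2 powr (- 1 / scaling_size s) :: real"
  have "\<bar>(x /\<^sub>R 2) $ i\<bar> \<le> (?\<theta> * scaled_norm s x) ^ s i" for i
  proof -
    have "s i \<le> scaling_size s" unfolding scaling_size_def by (rule member_le_sum) auto
    then have "real (s i) / scaling_size s \<le> 1" by (simp add: divide_le_eq)
    then have "2 powr -1 \<le> (2 powr (- (real (s i) / scaling_size s)) :: real)"
      by (intro powr_mono) auto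
    then have "1 / 2 \<le> ?\<theta> ^ s i"
      by (simp add: powr_powr mult.commute flip: powr_realpow)
    then have "1 / 2 * \<bar>x $ i\<bar> \<le> ?\<theta> ^ s i * scaled_norm s x ^ s i"
      by (intro mult_mono abs_le_scaled_norm) auto
    then show ?thesis by (simp add: power_mult_distrib)
  qed
  then show ?thesis by (simp add: scaled_norm_le_iff)
qed

lemma scaled_ball_eq_cbox: "0 \<le> r \<Longrightarrow> scaled_ball s 0 r = cbox (- (\<chi> i. r ^ s i)) (\<chi> i. r ^ s i)"
  by (auto simp: scaled_ball_def scaled_norm_le_iff mem_box_cart abs_le_iff)
    (use minus_le_iff in blast)+

lemma scaled_ball_0_iff: "h \<in> scaled_ball s 0 r \<longleftrightarrow> scaled_norm s h \<le> r"
  by (simp add: scaled_ball_def)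

lemma borel_measurable_scaled_norm [measurable]: "scaled_norm s \<in> borel_measurable borel"
proof (rule borel_measurableI_le)
  fix r :: real
  have "{x \<in> space borel. scaled_norm s x \<le> r} = (if 0 \<le> r then cbox (- (\<chi> i. r ^ s i)) (\<chi> i. r ^ s i) else {})"
    using scaled_ball_eq_cbox[of r] order_trans[OF scaled_norm_nonneg] by (auto simp: scaled_ball_def)
  then show "{x \<in> space borel. scaled_norm s x \<le> r} \<in> sets borel" by simp
qed

lemma scaled_ball_borel [measurable]: "scaled_ball s 0 r \<in> sets borel"
  unfolding scaled_ball_def by measurable

lemma emeasure_scaled_ball:
  assumes "0 \<le> r"
  shows "emeasure lborel (scaled_ball s 0 r) = ennreal (2 ^ CARD('d) * r ^ scaling_size s)"
proof -
  have "emeasure lborel (scaled_ball s 0 r) = ennreal (measure lborel (cbox (- (\<chi> i. r ^ s i)) (\<chi> i. r ^ s i)))"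
    using emeasure_lborel_cbox_finite[of "- (\<chi> i. r ^ s i)" "\<chi> i. r ^ s i"]
    by (subst emeasure_eq_ennreal_measure[symmetric]) (auto simp: scaled_ball_eq_cbox assms)
  also have "0 \<in> cbox (- (\<chi> i. r ^ s i)) (\<chi> i. r ^ s i)"
    using assms by (simp add: mem_box_cart)
  then have "cbox (- (\<chi> i. r ^ s i)) (\<chi> i. r ^ s i) \<noteq> {}" by blast
  then have "measure lborel (cbox (- (\<chi> i. r ^ s i)) (\<chi> i. r ^ s i)) = (\<Prod>i\<in>UNIV. 2 * r ^ s i)"
    by (simp add: content_cbox_cart)
  also have "\<dots> = 2 ^ CARD('d) * r ^ scaling_size s"
    by (simp add: prod.distrib scaling_size_def power_sum)
  finally show ?thesis .
qed

lemma tendsto_scaled_norm_0: "(scaled_norm s \<longlongrightarrow> 0) (nhds 0)"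
proof (rule order_tendstoI)
  fix e :: real
  show "\<forall>\<^sub>F x in nhds 0. e < scaled_norm s x" if "e < 0"
    using that by (intro always_eventually allI) (rule less_le_trans, auto)
  show "\<forall>\<^sub>F x in nhds 0. scaled_norm s x < e" if "0 < e"
  proof -
    let ?v = "\<chi> i. (e / 2) ^ s i"
    have "open (box (- ?v) ?v)" "0 \<in> box (- ?v) ?v"
      using that by (auto simp: mem_box_cart)
    moreover have "scaled_norm s x < e" if "x \<in> box (- ?v) ?v" for x
    proof -
      have "scaled_norm s x \<le> e / 2"
        using that \<open>0 < e\<close> by (subst scaled_norm_le_iff) (auto simp: mem_box_cart abs_le_iff minus_le_iff[of "x $ i" for i] less_imp_le)
      then show ?thesis using \<open>0 < e\<close> by simp
    qed
    ultimately show ?thesis by (auto simp: eventually_nhds)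
  qed
qed

section \<open>Trading integrals over scales for integrals over increments\<close>

lemma AE_increment_lborel:
  "(AE h in increment_lborel s. P h) \<longleftrightarrow> (AE h in lborel. scaled_norm s h \<le> 1 \<longrightarrow> P h)"
proof -
  have "(AE h in increment_lborel s. P h) \<longleftrightarrow>
      (AE h in lborel. 0 < ennreal (indicator (scaled_ball s 0 1) h / scaled_norm s h ^ scaling_size s) \<longrightarrow> P h)"
    unfolding increment_lborel_def by (rule AE_density) measurable
  also have "\<dots> \<longleftrightarrow> (AE h in lborel. scaled_norm s h \<le> 1 \<longrightarrow> P h)"
  proof (rule eventually_subst, use AE_lborel_singleton[of "0::real^'d"] in eventually_elim)
    case (elim h)
    then show ?case using scaled_norm_pos[of h] by (simp add: indicator_def scaled_ball_0_iff)
  qed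
  finally show ?thesis .
qed

text \<open>The scales between $\|h\|/2$ and $\|h\|$ have measure at least $1/2$ for $\lambda^{-1} d\lambda$, so
  $\varphi(h)^q$ is at most twice the integral of $D^q$ over them; and by Fubini's theorem each
  scale $\lambda$ is counted with the integral of $\|h\|^{-|\mathfrak s|}$ over the $h$ with
  $\lambda \le \|h\| \le 2 \lambda$, which is at most $2^{d + |\mathfrak s|}$.\<close>

lemma L_norm_increment_le_scale:
  assumes [measurable]: "\<phi> \<in> borel_measurable borel" "D \<in> borel_measurable borel"
    and q: "1 \<le> q"
    and le: "\<And>h l. h \<noteq> 0 \<Longrightarrow> scaled_norm s h \<le> 1 \<Longrightarrow> scaled_norm s h / 2 \<le> l \<Longrightarrow>
      l \<le> scaled_norm s h \<Longrightarrow> \<phi> h \<le> D l"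
  shows "L_norm (increment_lborel s) q \<phi> \<le> ennreal (2 ^ (CARD('d) + scaling_size s + 1)) * L_norm scale_lborel q D"
proof (cases "q = top")
  case True
  have *: "\<phi> h \<le> esssup scale_lborel D" if h: "h \<noteq> 0" "scaled_norm s h \<le> 1" for h
  proof -
    have pos: "0 < scaled_norm s h" using h scaled_norm_pos by simp
    have "AE l in lborel. 0 < l \<and> l \<le> 1 \<longrightarrow> D l \<le> esssup scale_lborel D"
      using esssup_AE[of D scale_lborel] by (simp add: AE_scale_lborel)
    then obtain l where "l \<in> {scaled_norm s h / 2..scaled_norm s h}" "D l \<le> esssup scale_lborel D"
      using AE_lborel_ex_in_interval[of _ "scaled_norm s h / 2" "scaled_norm s h"] pos h by force
    then show ?thesis using le[OF h, of l] by auto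
  qed
  have "AE h in increment_lborel s. \<phi> h \<le> esssup scale_lborel D"
    using AE_lborel_singleton[of "0::real^'d"] unfolding AE_increment_lborel
    by eventually_elim (use * in auto)
  then have "esssup (increment_lborel s) \<phi> \<le> esssup scale_lborel D"
    by (intro esssup_I) measurable
  then have "L_norm (increment_lborel s) q \<phi> \<le> 1 * L_norm scale_lborel q D"
    using True by simp
  also have "\<dots> \<le> ennreal (2 ^ (CARD('d) + scaling_size s + 1)) * L_norm scale_lborel q D"
    by (intro mult_right_mono one_le_ennreal_power2) simp
  finally show ?thesis .
next
  case False
  define t where "t = enn2real q"
  have t: "1 \<le> t" unfolding t_def using q False by (rule enn2real_ge_1)
  define w where "w h = ennreal (indicator (scaled_ball s 0 1) h / scaled_norm s h ^ scaling_size s)" for h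
  \<comment> \<open>The joint density in $h$ and $\lambda$ of the pairs of comparable size.\<close>
  define k where "k h l = ennreal (if scaled_norm s h \<le> 1 \<and> scaled_norm s h / 2 \<le> l \<and> l \<le> scaled_norm s h \<and> 0 < l
    then 1 / (l * scaled_norm s h ^ scaling_size s) else 0)" for h l
  have [measurable]: "w \<in> borel_measurable borel" "case_prod k \<in> borel_measurable (borel \<Otimes>\<^sub>M borel)"
    unfolding w_def k_def case_prod_beta by measurable
  have 1: "w h * ennreal_powr (\<phi> h) t \<le> 2 * (\<integral>\<^sup>+l. k h l * ennreal_powr (D l) t \<partial>lborel)" if "h \<noteq> 0" for h
  proof (cases "scaled_norm s h \<le> 1")
    case True
    let ?r = "scaled_norm s h"
    have pos: "0 < ?r" using \<open>h \<noteq> 0\<close> by (rule scaled_norm_pos)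
    have "w h * ennreal_powr (\<phi> h) t =
      2 * (\<integral>\<^sup>+l. ennreal (1 / (?r * ?r ^ scaling_size s)) * ennreal_powr (\<phi> h) t * indicator {?r / 2..?r} l \<partial>lborel)"
    proof -
      have "ennreal (1 / ?r ^ scaling_size s) = ennreal (2 * (1 / (?r * ?r ^ scaling_size s)) * (?r / 2))"
        using \<open>h \<noteq> 0\<close> by simp
      also have "\<dots> = 2 * ennreal (1 / (?r * ?r ^ scaling_size s)) * ennreal (?r / 2)"
        using pos by (subst ennreal_mult | simp)+
      finally have "2 * (ennreal (1 / (?r * ?r ^ scaling_size s)) * ennreal_powr (\<phi> h) t * ennreal (?r / 2)) =
          ennreal (1 / ?r ^ scaling_size s) * ennreal_powr (\<phi> h) t"
        by (simp only: ac_simps)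
      then show ?thesis using pos True by (simp add: nn_integral_cmult w_def scaled_ball_0_iff)
    qed
    also have "\<dots> \<le> 2 * (\<integral>\<^sup>+l. k h l * ennreal_powr (D l) t \<partial>lborel)"
    proof (intro mult_left_mono nn_integral_mono)
      fix l
      show "ennreal (1 / (?r * ?r ^ scaling_size s)) * ennreal_powr (\<phi> h) t * indicator {?r / 2..?r} l
        \<le> k h l * ennreal_powr (D l) t"
      proof (cases "l \<in> {?r / 2..?r}")
        case l: True
        then have "1 / (?r * ?r ^ scaling_size s) \<le> 1 / (l * ?r ^ scaling_size s)"
          using pos by (intro divide_left_mono mult_right_mono mult_pos_pos) auto
        then show ?thesis
          using l pos True t le[OF \<open>h \<noteq> 0\<close>, of l]
          by (auto simp: k_def intro!: mult_mono ennreal_leI ennreal_powr_mono)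
      qed simp
    qed simp
    finally show ?thesis .
  qed (simp add: w_def scaled_ball_0_iff)
  have 2: "2 * (\<integral>\<^sup>+h. k h l \<partial>lborel) \<le> ennreal (2 ^ (CARD('d) + scaling_size s + 1)) * ennreal (indicator {0<..1} l / l)" for l
  proof (cases "0 < l \<and> l \<le> 1")
    case True
    have "k h l \<le> ennreal (1 / (l * l ^ scaling_size s)) * indicator (scaled_ball s 0 (2 * l)) h" for h
      using True by (auto simp: k_def indicator_def scaled_ball_0_iff
        intro!: ennreal_leI divide_left_mono mult_left_mono power_mono mult_pos_pos zero_less_power)
    then have "(\<integral>\<^sup>+h. k h l \<partial>lborel) \<le> (\<integral>\<^sup>+h. ennreal (1 / (l * l ^ scaling_size s)) * indicator (scaled_ball s 0 (2 * l)) h \<partial>lborel)"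
      by (intro nn_integral_mono)
    also have "\<dots> = ennreal (1 / (l * l ^ scaling_size s)) * ennreal (2 ^ CARD('d) * (2 * l) ^ scaling_size s)"
      using True by (simp add: nn_integral_cmult emeasure_scaled_ball)
    also have "\<dots> = ennreal (2 ^ (CARD('d) + scaling_size s) / l)"
      using True by (simp add: power_mult_distrib power_add flip: ennreal_mult)
    finally have "2 * (\<integral>\<^sup>+h. k h l \<partial>lborel) \<le> ennreal 2 * ennreal (2 ^ (CARD('d) + scaling_size s) / l)"
      by (intro mult_mono) auto
    also have "\<dots> = ennreal (2 * (2 ^ (CARD('d) + scaling_size s) / l))"
      using True by (intro ennreal_mult[symmetric]) auto
    also have "\<dots> = ennreal (2 ^ (CARD('d) + scaling_size s + 1) * (indicator {0<..1} l / l))"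
      using True by simp
    also have "\<dots> = ennreal (2 ^ (CARD('d) + scaling_size s + 1)) * ennreal (indicator {0<..1} l / l)"
      using True by (intro ennreal_mult) auto
    finally show ?thesis .
  next
    case False
    then have "k h l = 0" for h by (auto simp: k_def)
    then show ?thesis by simp
  qed
  have "(\<integral>\<^sup>+h. ennreal_powr (\<phi> h) t \<partial>increment_lborel s) = (\<integral>\<^sup>+h. w h * ennreal_powr (\<phi> h) t \<partial>lborel)"
    unfolding increment_lborel_def w_def by (subst nn_integral_density) auto
  also have "\<dots> \<le> (\<integral>\<^sup>+h. 2 * (\<integral>\<^sup>+l. k h l * ennreal_powr (D l) t \<partial>lborel) \<partial>lborel)"
    by (intro nn_integral_mono_AE, use AE_lborel_singleton[of "0::real^'d"] in eventually_elim) (rule 1)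
  also have "\<dots> = 2 * (\<integral>\<^sup>+h. (\<integral>\<^sup>+l. k h l * ennreal_powr (D l) t \<partial>lborel) \<partial>lborel)"
    by (subst nn_integral_cmult) auto
  also have "(\<integral>\<^sup>+h. (\<integral>\<^sup>+l. k h l * ennreal_powr (D l) t \<partial>lborel) \<partial>lborel) =
     (\<integral>\<^sup>+l. (\<integral>\<^sup>+h. k h l * ennreal_powr (D l) t \<partial>lborel) \<partial>lborel)"
    by (rule lborel_pair.Fubini'[symmetric]) simp
  also have "2 * \<dots> = (\<integral>\<^sup>+l. 2 * (\<integral>\<^sup>+h. k h l \<partial>lborel) * ennreal_powr (D l) t \<partial>lborel)"
    by (subst nn_integral_cmult[symmetric]) (simp_all add: nn_integral_multc mult.assoc)
  also have "\<dots> \<le> (\<integral>\<^sup>+l. ennreal (2 ^ (CARD('d) + scaling_size s + 1)) *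
      (ennreal (indicator {0<..1} l / l) * ennreal_powr (D l) t) \<partial>lborel)"
  proof (rule nn_integral_mono)
    fix l
    show "2 * (\<integral>\<^sup>+h. k h l \<partial>lborel) * ennreal_powr (D l) t \<le>
        ennreal (2 ^ (CARD('d) + scaling_size s + 1)) * (ennreal (indicator {0<..1} l / l) * ennreal_powr (D l) t)"
      using mult_right_mono[OF 2[of l], of "ennreal_powr (D l) t"] by (simp only: mult.assoc zero_le)
  qed
  also have "\<dots> = ennreal (2 ^ (CARD('d) + scaling_size s + 1)) * (\<integral>\<^sup>+l. ennreal_powr (D l) t \<partial>scale_lborel)"
    unfolding scale_lborel_def by (subst nn_integral_density) (auto simp: nn_integral_cmult)
  also have "\<dots> \<le> ennreal_powr (ennreal (2 ^ (CARD('d) + scaling_size s + 1))) t * (\<integral>\<^sup>+l. ennreal_powr (D l) t \<partial>scale_lborel)"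
    by (intro mult_right_mono self_le_ennreal_powr one_le_ennreal_power2 t) simp
  finally show ?thesis
    unfolding t_def L_norm_le_iff[OF q False] ennreal_powr_mult L_norm_powr[OF q False] .
qed

text \<open>A Hardy inequality: by Jensen's inequality the $q$-th power of the average is at most the average
  of $\varphi^q$, and an increment $h$ is counted with the weight
  $\int_{\|h\|/4}^{1/4} |Q(0,4\lambda)|^{-1} \lambda^{-1} d\lambda \le \|h\|^{-|\mathfrak s|}$. The scales
  above $1/4$ have finite measure for $\lambda^{-1} d\lambda$.\<close>

lemma L_norm_scale_le_increment:
  assumes [measurable]: "\<phi> \<in> borel_measurable borel" "D \<in> borel_measurable borel"
    and q: "1 \<le> q"
    and small: "\<And>l. 0 < l \<Longrightarrow> l \<le> 1 / 4 \<Longrightarrow>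
      D l \<le> (\<integral>\<^sup>+h\<in>scaled_ball s 0 (4 * l). \<phi> h \<partial>lborel) / emeasure lborel (scaled_ball s 0 (4 * l))"
    and large: "\<And>l. 1 / 4 < l \<Longrightarrow> l \<le> 1 \<Longrightarrow> D l \<le> K"
  shows "L_norm scale_lborel q D \<le> 5 * (L_norm (increment_lborel s) q \<phi> + K)"
proof (cases "q = top")
  case True
  let ?E = "esssup (increment_lborel s) \<phi>"
  have "AE h in lborel. scaled_norm s h \<le> 1 \<longrightarrow> \<phi> h \<le> ?E"
    using esssup_AE[of \<phi> "increment_lborel s"] by (simp add: AE_increment_lborel)
  note E = this
  have "D l \<le> ?E + K" if l: "0 < l" "l \<le> 1" for l
  proof (cases "l \<le> 1 / 4")
    case True
    have "(\<integral>\<^sup>+h\<in>scaled_ball s 0 (4 * l). \<phi> h \<partial>lborel) \<le> (\<integral>\<^sup>+h\<in>scaled_ball s 0 (4 * l). ?E \<partial>lborel)"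
    proof (intro nn_integral_mono_AE, use E in eventually_elim)
      case (elim h)
      then show ?case using True by (auto simp: indicator_def scaled_ball_0_iff)
    qed
    also have "\<dots> = ?E * emeasure lborel (scaled_ball s 0 (4 * l))"
      by (simp add: nn_integral_cmult)
    finally have "D l \<le> ?E * emeasure lborel (scaled_ball s 0 (4 * l)) / emeasure lborel (scaled_ball s 0 (4 * l))"
      using small[OF \<open>0 < l\<close> True] by (meson divide_right_mono_ennreal order_trans)
    also have "\<dots> = ?E"
      using l by (intro ennreal_mult_divide_eq) (auto simp: emeasure_scaled_ball)
    finally show ?thesis by (simp add: add_increasing2)
  next
    case False
    then show ?thesis using large[of l] l by (simp add: add_increasing)
  qed
  then have "AE l in scale_lborel. D l \<le> ?E + K"
    by (simp add: AE_scale_lborel)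
  then have "esssup scale_lborel D \<le> ?E + K"
    by (intro esssup_I) measurable
  then have "L_norm scale_lborel q D \<le> 1 * (L_norm (increment_lborel s) q \<phi> + K)"
    using True by simp
  also have "\<dots> \<le> 5 * (L_norm (increment_lborel s) q \<phi> + K)"
    by (intro mult_right_mono) auto
  finally show ?thesis .
next
  case False
  define t where "t = enn2real q"
  have t: "1 \<le> t" unfolding t_def using q False by (rule enn2real_ge_1)
  define w where "w h = ennreal (indicator (scaled_ball s 0 1) h / scaled_norm s h ^ scaling_size s)" for h
  define k where "k l h = ennreal (if 0 < l \<and> l \<le> 1 / 4 \<and> scaled_norm s h \<le> 4 * l
    then 1 / (l * (2 ^ CARD('d) * (4 * l) ^ scaling_size s)) else 0)" for h l
  have [measurable]: "w \<in> borel_measurable borel" "case_prod k \<in> borel_measurable (borel \<Otimes>\<^sub>M borel)"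
    unfolding w_def k_def case_prod_beta by measurable
  have S: "0 < scaling_size s"
    unfolding scaling_size_def using s_pos by (intro sum_pos) auto
  have 1: "ennreal (indicator {0<..1} l / l) * ennreal_powr (D l) t \<le>
    (\<integral>\<^sup>+h. k l h * ennreal_powr (\<phi> h) t \<partial>lborel) + 4 * ennreal_powr K t * indicator {1/4<..1} l" for l
  proof -
    consider "l \<le> 0 \<or> 1 < l" | "0 < l" "l \<le> 1 / 4" | "1 / 4 < l" "l \<le> 1" by linarith
    then show ?thesis
    proof cases
      case 2
      let ?v = "2 ^ CARD('d) * (4 * l) ^ scaling_size s"
      have v: "0 < ?v" using 2 by simp
      have "ennreal_powr (D l) t \<le> ennreal_powr ((\<integral>\<^sup>+h\<in>scaled_ball s 0 (4 * l). \<phi> h \<partial>lborel) / emeasure lborel (scaled_ball s 0 (4 * l))) t"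
        using t small 2 by (intro ennreal_powr_mono) auto
      also have "\<dots> \<le> (\<integral>\<^sup>+h\<in>scaled_ball s 0 (4 * l). ennreal_powr (\<phi> h) t \<partial>lborel) / emeasure lborel (scaled_ball s 0 (4 * l))"
        using 2 t by (intro average_powr_le) (auto simp: emeasure_scaled_ball)
      also have "\<dots> = ennreal (1 / ?v) * (\<integral>\<^sup>+h\<in>scaled_ball s 0 (4 * l). ennreal_powr (\<phi> h) t \<partial>lborel)"
        using 2 v by (simp add: emeasure_scaled_ball divide_ennreal_def inverse_ennreal inverse_eq_divide mult.commute
            del: inverse_mult_distrib)
      finally have "ennreal (1 / l) * ennreal_powr (D l) t \<le>
        ennreal (1 / l) * (ennreal (1 / ?v) * (\<integral>\<^sup>+h\<in>scaled_ball s 0 (4 * l). ennreal_powr (\<phi> h) t \<partial>lborel))"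
        by (intro mult_left_mono) auto
      also have "\<dots> = (\<integral>\<^sup>+h. k l h * ennreal_powr (\<phi> h) t \<partial>lborel)"
      proof -
        have "ennreal (1 / (l * ?v)) = ennreal (1 / l) * ennreal (1 / ?v)"
          using 2 v by (simp flip: ennreal_mult)
        then have "k l h = ennreal (1 / l) * ennreal (1 / ?v) * indicator (scaled_ball s 0 (4 * l)) h" for h
          using 2 by (simp add: k_def scaled_ball_0_iff)
        then have "k l h * ennreal_powr (\<phi> h) t =
            ennreal (1 / l) * ennreal (1 / ?v) * (ennreal_powr (\<phi> h) t * indicator (scaled_ball s 0 (4 * l)) h)" for h
          by (simp only: mult.assoc mult.commute[of "ennreal_powr (\<phi> h) t"])
        then show ?thesis by (simp add: nn_integral_cmult mult.assoc)
      qed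
      finally show ?thesis using 2 by simp
    next
      case 3
      have "ennreal (1 / l) * ennreal_powr (D l) t \<le> ennreal 4 * ennreal_powr K t"
        using 3 large[OF 3] t by (intro mult_mono ennreal_leI ennreal_powr_mono) (auto simp: field_simps)
      then show ?thesis using 3 by (simp add: add_increasing)
    qed auto
  qed
  have 2: "(\<integral>\<^sup>+l. k l h \<partial>lborel) \<le> w h" if "h \<noteq> 0" for h
  proof (cases "scaled_norm s h \<le> 1")
    case True
    let ?r = "scaled_norm s h" and ?S = "scaling_size s"
    have pos: "0 < ?r" using that by (rule scaled_norm_pos)
    \<comment> \<open>Since $|\mathfrak s| \ge 1$, a factor $\lambda^{-2}$ can be split off that is integrable at infinity.\<close>
    have "k l h \<le> ennreal (1 / (?r / 4) ^ (?S - 1) / 4 ^ ?S) * (ennreal (1 / l ^ 2) * indicator {?r / 4..} l)" for l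
    proof (cases "0 < l \<and> l \<le> 1 / 4 \<and> ?r \<le> 4 * l")
      case l: True
      have "1 / (l * (2 ^ CARD('d) * (4 * l) ^ ?S)) \<le> 1 / (l * (4 * l) ^ ?S)"
        using l by (intro divide_left_mono) (auto simp: mult_le_cancel_left1)
      also have "\<dots> = 1 / l ^ (?S - 1) / 4 ^ ?S * (1 / l ^ 2)"
        using S l by (cases ?S) (auto simp: power_mult_distrib power2_eq_square)
      also have "\<dots> \<le> 1 / (?r / 4) ^ (?S - 1) / 4 ^ ?S * (1 / l ^ 2)"
        using l pos by (intro mult_right_mono divide_right_mono divide_left_mono power_mono) auto
      finally show ?thesis
        using l pos by (auto simp: k_def simp flip: ennreal_mult intro!: ennreal_leI)
    qed (auto simp: k_def)
    then have "(\<integral>\<^sup>+l. k l h \<partial>lborel) \<le> ennreal (1 / (?r / 4) ^ (?S - 1) / 4 ^ ?S) * (\<integral>\<^sup>+l. ennreal (1 / l ^ 2) * indicator {?r / 4..} l \<partial>lborel)"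
      by (subst nn_integral_cmult[symmetric]) (auto intro!: nn_integral_mono)
    also have "(\<integral>\<^sup>+l. ennreal (1 / l ^ 2) * indicator {?r / 4..} l \<partial>lborel) = ennreal (0 - (- (1 / (?r / 4))))"
    proof (rule nn_integral_FTC_atLeast)
      show "((\<lambda>l. - (1 / l)) \<longlongrightarrow> (0::real)) at_top"
        using tendsto_minus[OF tendsto_inverse_0_at_top[OF filterlim_ident]]
        by (simp add: inverse_eq_divide)
      show "DERIV (\<lambda>l. - (1 / l)) x :> 1 / x\<^sup>2" if "?r / 4 \<le> x" for x :: real
        using that pos by (auto intro!: derivative_eq_intros simp: power2_eq_square)
    qed auto
    also have "ennreal (1 / (?r / 4) ^ (?S - 1) / 4 ^ ?S) * \<dots> = w h"
      using S True pos by (cases ?S) (auto simp: w_def scaled_ball_0_iff power_divide simp flip: ennreal_mult)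
    finally show ?thesis .
  next
    case False
    then have "k l h = 0" for l by (auto simp: k_def)
    then show ?thesis by simp
  qed
  have "(\<integral>\<^sup>+l. ennreal_powr (D l) t \<partial>scale_lborel) = (\<integral>\<^sup>+l. ennreal (indicator {0<..1} l / l) * ennreal_powr (D l) t \<partial>lborel)"
    unfolding scale_lborel_def by (subst nn_integral_density) auto
  also have "\<dots> \<le> (\<integral>\<^sup>+l. (\<integral>\<^sup>+h. k l h * ennreal_powr (\<phi> h) t \<partial>lborel) + 4 * ennreal_powr K t * indicator {1/4<..1} l \<partial>lborel)"
    by (intro nn_integral_mono 1)
  also have "\<dots> = (\<integral>\<^sup>+l. (\<integral>\<^sup>+h. k l h * ennreal_powr (\<phi> h) t \<partial>lborel) \<partial>lborel) + 4 * ennreal_powr K t * ennreal (3 / 4)"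
    by (subst nn_integral_add) (auto simp: nn_integral_cmult)
  also have "(\<integral>\<^sup>+l. (\<integral>\<^sup>+h. k l h * ennreal_powr (\<phi> h) t \<partial>lborel) \<partial>lborel) = (\<integral>\<^sup>+h. (\<integral>\<^sup>+l. k l h * ennreal_powr (\<phi> h) t \<partial>lborel) \<partial>lborel)"
    by (rule lborel_pair.Fubini'[symmetric]) simp
  also have "\<dots> \<le> (\<integral>\<^sup>+h. w h * ennreal_powr (\<phi> h) t \<partial>lborel)"
    by (intro nn_integral_mono_AE, use AE_lborel_singleton[of "0::real^'d"] in eventually_elim)
       (simp add: nn_integral_multc mult_right_mono 2)
  also have "\<dots> = (\<integral>\<^sup>+h. ennreal_powr (\<phi> h) t \<partial>increment_lborel s)"
    unfolding increment_lborel_def w_def by (subst nn_integral_density) auto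
  also have "\<dots> = ennreal_powr (L_norm (increment_lborel s) q \<phi>) t"
    using q False by (simp add: L_norm_powr t_def)
  also have "\<dots> + 4 * ennreal_powr K t * ennreal (3 / 4) \<le>
    ennreal_powr (L_norm (increment_lborel s) q \<phi> + K) t + 4 * ennreal_powr (L_norm (increment_lborel s) q \<phi> + K) t * 1"
    using t by (intro add_mono mult_mono ennreal_powr_mono) auto
  also have "\<dots> = 5 * ennreal_powr (L_norm (increment_lborel s) q \<phi> + K) t"
    using distrib_right[of 1 4 "ennreal_powr (L_norm (increment_lborel s) q \<phi> + K) t"] by simp
  also have "\<dots> \<le> ennreal_powr 5 t * ennreal_powr (L_norm (increment_lborel s) q \<phi> + K) t"
    using t by (intro mult_right_mono self_le_ennreal_powr) auto
  finally show ?thesis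
    using q False by (simp add: L_norm_le_iff ennreal_powr_mult t_def del: distrib_left_numeral)
qed

end

section \<open>The action of the structure group\<close>

locale regularity_model =
  fixes s :: "'d::finite \<Rightarrow> nat"
    and R :: "'t::real_vector reg_structure"
    and PI :: "real^'d \<Rightarrow> 't \<Rightarrow> (real^'d \<Rightarrow> real) \<Rightarrow> real"
    and \<Gamma> :: "real^'d \<Rightarrow> real^'d \<Rightarrow> 't \<Rightarrow> 't"
    and \<gamma> :: real
  assumes s_pos: "\<And>i. 0 < s i"
    and reg: "regularity_structure R"
    and model: "model s R PI \<Gamma>"
    and \<gamma>_pos: "0 < \<gamma>"
begin

abbreviation "A \<equiv> index_below R \<gamma>"
abbreviation "T \<equiv> space_below R \<gamma>"

lemma finite_A: "finite A"
proof -
  obtain m where m: "\<And>a. a \<in> rs_index R \<Longrightarrow> m \<le> a"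
    using reg by (auto simp: regularity_structure_def bdd_below_def)
  have "A \<subseteq> rs_index R \<inter> {m..\<gamma>}"
    using m by (auto simp: index_below_def)
  then show ?thesis
    using reg by (auto simp only: regularity_structure_def intro: finite_subset)
qed

lemma A_index: "a \<in> A \<Longrightarrow> a \<in> rs_index R" and A_less: "a \<in> A \<Longrightarrow> a < \<gamma>"
  by (auto simp: index_below_def)

lemma banach: "a \<in> rs_index R \<Longrightarrow> banach_on (rs_space R a) (rs_norm R a)"
  using reg by (auto simp: regularity_structure_def)

lemma decomposition_proj: "decomposition R \<tau> (\<lambda>a. proj R a \<tau>)"
proof -
  have "\<exists>!u. decomposition R \<tau> u" using reg by (auto simp: regularity_structure_def)
  then have "decomposition R \<tau> (THE u. decomposition R \<tau> u)" by (rule theI')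
  then show ?thesis by (simp add: proj_def[abs_def])
qed

lemma proj_eqI: "decomposition R \<tau> u \<Longrightarrow> proj R a \<tau> = u a"
  using decomposition_proj[of \<tau>] reg unfolding regularity_structure_def by metis

lemma subspace_rs: "a \<in> rs_index R \<Longrightarrow> subspace (rs_space R a)"
  using banach by (auto simp: banach_on_def)

lemma proj_mem: "a \<in> rs_index R \<Longrightarrow> proj R a \<tau> \<in> rs_space R a"
  using decomposition_proj[of \<tau>] by (auto simp: decomposition_def)

lemma decompositionI:
  assumes "finite B" "B \<subseteq> rs_index R" "\<And>b. b \<in> B \<Longrightarrow> u b \<in> rs_space R b" "\<And>b. b \<notin> B \<Longrightarrow> u b = 0"
  shows "decomposition R (\<Sum>b\<in>B. u b) u"
proof -
  have sub: "{a. u a \<noteq> 0} \<subseteq> B" using assms(4) by auto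
  have "(\<Sum>b\<in>B. u b) = (\<Sum>a | u a \<noteq> 0. u a)"
    using assms(1) sub by (intro sum.mono_neutral_right) auto
  then show ?thesis
    using assms sub subspace_rs by (auto simp: decomposition_def intro: finite_subset subspace_0)
      (metis subspace_0 subsetD)+
qed

text \<open>The components of a sum are the sums of the components, because decompositions are unique.\<close>

lemma linear_proj: "linear (proj R a)"
proof (rule linearI)
  fix x y
  let ?B = "{a. proj R a x \<noteq> 0} \<union> {a. proj R a y \<noteq> 0}"
  have x: "finite {a. proj R a x \<noteq> 0}" "{a. proj R a x \<noteq> 0} \<subseteq> rs_index R"
      "x = (\<Sum>a | proj R a x \<noteq> 0. proj R a x)" for x
    using decomposition_proj[of x] by (auto simp: decomposition_def)
  have "x = (\<Sum>a\<in>?B. proj R a x)" "y = (\<Sum>a\<in>?B. proj R a y)"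
    using x(1)[of x] x(1)[of y] by (subst x(3), intro sum.mono_neutral_left; auto)+
  then have "x + y = (\<Sum>a\<in>?B. proj R a x + proj R a y)"
    by (simp only: sum.distrib)
  moreover have "decomposition R (\<Sum>a\<in>?B. proj R a x + proj R a y) (\<lambda>a. proj R a x + proj R a y)"
    using x(1,2)[of x] x(1,2)[of y]
    by (intro decompositionI) (auto intro: subspace_add subspace_rs proj_mem)
  ultimately show "proj R a (x + y) = proj R a x + proj R a y"
    using proj_eqI by metis
next
  fix c x
  let ?B = "{a. proj R a x \<noteq> 0}"
  have x: "finite ?B" "?B \<subseteq> rs_index R" "x = (\<Sum>a\<in>?B. proj R a x)"
    using decomposition_proj[of x] by (auto simp: decomposition_def)
  have "c *\<^sub>R x = (\<Sum>a\<in>?B. c *\<^sub>R proj R a x)"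
    by (subst x(3)) (simp only: scaleR_sum_right)
  moreover have "decomposition R (\<Sum>a\<in>?B. c *\<^sub>R proj R a x) (\<lambda>a. c *\<^sub>R proj R a x)"
    using x(1,2) by (intro decompositionI) (auto intro: subspace_scale subspace_rs proj_mem)
  ultimately show "proj R a (c *\<^sub>R x) = c *\<^sub>R proj R a x"
    using proj_eqI by metis
qed

lemma proj_homogeneous:
  assumes "\<tau> \<in> rs_space R b" "b \<in> rs_index R"
  shows "proj R a \<tau> = (if a = b then \<tau> else 0)"
proof -
  have "decomposition R (\<Sum>c\<in>{b}. if c = b then \<tau> else 0) (\<lambda>c. if c = b then \<tau> else 0)"
    using assms by (intro decompositionI) auto
  then show ?thesis using proj_eqI by simp
qed

lemma proj_space_below:
  assumes "\<tau> \<in> space_below R b" "a \<notin> index_below R b"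
  shows "proj R a \<tau> = 0"
proof -
  have "subspace {\<tau>. proj R a \<tau> = 0}"
    using linear_proj by (auto intro!: subspaceI simp: linear_0 linear_add linear_scale)
  moreover have "(\<Union>c\<in>index_below R b. rs_space R c) \<subseteq> {\<tau>. proj R a \<tau> = 0}"
    using assms(2) by (auto simp: proj_homogeneous index_below_def)
  ultimately show ?thesis
    using assms(1) span_minimal unfolding space_below_def by blast
qed

lemma sum_proj:
  assumes "\<tau> \<in> T"
  shows "\<tau> = (\<Sum>b\<in>A. proj R b \<tau>)"
proof -
  have "\<tau> = (\<Sum>a | proj R a \<tau> \<noteq> 0. proj R a \<tau>)"
    using decomposition_proj[of \<tau>] by (auto simp: decomposition_def)
  also have "\<dots> = (\<Sum>b\<in>A. proj R b \<tau>)"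
    using proj_space_below[OF assms] finite_A by (intro sum.mono_neutral_left) auto
  finally show ?thesis .
qed

lemma T_I: "(\<And>b. b \<in> A \<Longrightarrow> u b \<in> rs_space R b) \<Longrightarrow> (\<Sum>b\<in>A. u b) \<in> T"
  unfolding space_below_def by (intro span_sum) (auto intro: span_base)

lemma subspace_T: "subspace T"
  by (simp add: space_below_def)

lemma comp_norm_nonneg: "a \<in> rs_index R \<Longrightarrow> 0 \<le> comp_norm R a \<tau>"
  using banach[of a] proj_mem[of a \<tau>] by (auto simp: comp_norm_def banach_on_def)

lemma comp_norm_triangle: "a \<in> rs_index R \<Longrightarrow> comp_norm R a (\<sigma> + \<tau>) \<le> comp_norm R a \<sigma> + comp_norm R a \<tau>"
  using banach[of a] proj_mem[of a] by (auto simp: comp_norm_def banach_on_def linear_add[OF linear_proj])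

lemma comp_norm_scale: "a \<in> rs_index R \<Longrightarrow> comp_norm R a (c *\<^sub>R \<tau>) = \<bar>c\<bar> * comp_norm R a \<tau>"
  using banach[of a] proj_mem[of a] by (auto simp: comp_norm_def banach_on_def linear_scale[OF linear_proj])

lemma comp_norm_0: "a \<in> rs_index R \<Longrightarrow> comp_norm R a 0 = 0"
  using comp_norm_scale[of a 0 0] by simp

lemma comp_norm_minus: "a \<in> rs_index R \<Longrightarrow> comp_norm R a (- \<tau>) = comp_norm R a \<tau>"
  using comp_norm_scale[of a "-1" \<tau>] by simp

lemma comp_norm_diff: "a \<in> rs_index R \<Longrightarrow> comp_norm R a (\<sigma> - \<tau>) \<le> comp_norm R a \<sigma> + comp_norm R a \<tau>"
  using comp_norm_triangle[of a \<sigma> "- \<tau>"] by (simp add: comp_norm_minus)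

lemma comp_norm_proj: "b \<in> rs_index R \<Longrightarrow> comp_norm R b (proj R b \<tau>) = comp_norm R b \<tau>"
  by (simp add: comp_norm_def proj_homogeneous[OF proj_mem])

lemma linear_\<Gamma>: "linear (\<Gamma> x y)"
  using model reg by (auto simp: model_def regularity_structure_def)

lemma \<Gamma>_refl: "\<Gamma> x x = id" and \<Gamma>_trans: "\<Gamma> x z (\<Gamma> z y \<tau>) = \<Gamma> x y \<tau>"
  using model by (auto simp: model_def fun_eq_iff)

lemma \<Gamma>_triangular: "a \<in> rs_index R \<Longrightarrow> \<tau> \<in> rs_space R a \<Longrightarrow> \<Gamma> x y \<tau> - \<tau> \<in> space_below R a"
  using model reg by (auto simp: model_def regularity_structure_def)

lemma proj_\<Gamma>_homogeneous:
  assumes "b \<in> rs_index R" "\<tau> \<in> rs_space R b" "b \<le> a"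
  shows "proj R a (\<Gamma> x y \<tau> - \<tau>) = 0"
  using proj_space_below[OF \<Gamma>_triangular[OF assms(1,2)]] assms(3) by (auto simp: index_below_def)

lemma \<Gamma>_mem_T:
  assumes "\<tau> \<in> T"
  shows "\<Gamma> x y \<tau> \<in> T"
proof -
  have "\<Gamma> x y (proj R b \<tau>) \<in> T" if b: "b \<in> A" for b
  proof -
    have "space_below R b \<subseteq> T"
      unfolding space_below_def using b by (intro span_mono) (auto simp: index_below_def)
    then have "\<Gamma> x y (proj R b \<tau>) - proj R b \<tau> \<in> T"
      using \<Gamma>_triangular[OF A_index[OF b] proj_mem[OF A_index[OF b]]] by blast
    moreover have "proj R b \<tau> \<in> T"
      unfolding space_below_def using b proj_mem[OF A_index[OF b]] by (auto intro: span_base)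
    ultimately show ?thesis
      using subspace_add[OF subspace_T] by fastforce
  qed
  then have "(\<Sum>b\<in>A. \<Gamma> x y (proj R b \<tau>)) \<in> T"
    by (intro subspace_sum subspace_T)
  then show ?thesis
    using sum_proj[OF assms] linear_sum[OF linear_\<Gamma>] by metis
qed

text \<open>An element of degree $\zeta$ and unit norm describes a function of size $\rho^\zeta$ at distance
  $\rho$ from its base point; the weights are these sizes.\<close>

definition weighted_norm :: "real \<Rightarrow> 't \<Rightarrow> real" where
  "weighted_norm \<rho> \<tau> = (\<Sum>a\<in>A. \<rho> powr a * comp_norm R a \<tau>)"

lemma weighted_norm_nonneg [simp]: "0 \<le> weighted_norm \<rho> \<tau>"
  unfolding weighted_norm_def by (intro sum_nonneg mult_nonneg_nonneg comp_norm_nonneg A_index) auto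

lemma weighted_norm_triangle: "weighted_norm \<rho> (\<sigma> + \<tau>) \<le> weighted_norm \<rho> \<sigma> + weighted_norm \<rho> \<tau>"
  unfolding weighted_norm_def sum.distrib[symmetric] distrib_left[symmetric]
  by (intro sum_mono mult_left_mono comp_norm_triangle A_index) auto

lemma weighted_norm_diff: "weighted_norm \<rho> (\<sigma> - \<tau>) \<le> weighted_norm \<rho> \<sigma> + weighted_norm \<rho> \<tau>"
  unfolding weighted_norm_def sum.distrib[symmetric] distrib_left[symmetric]
  by (intro sum_mono mult_left_mono comp_norm_diff A_index) auto

lemma comp_norm_le_weighted_norm:
  assumes "a \<in> A" "0 < \<rho>"
  shows "comp_norm R a \<tau> \<le> \<rho> powr (- a) * weighted_norm \<rho> \<tau>"
proof -
  have "\<rho> powr a * comp_norm R a \<tau> \<le> weighted_norm \<rho> \<tau>"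
    unfolding weighted_norm_def using assms finite_A
    by (intro member_le_sum) (auto intro!: mult_nonneg_nonneg comp_norm_nonneg A_index)
  then have "\<rho> powr (- a) * (\<rho> powr a * comp_norm R a \<tau>) \<le> \<rho> powr (- a) * weighted_norm \<rho> \<tau>"
    by (intro mult_left_mono) auto
  then show ?thesis using assms by (simp add: powr_minus field_simps)
qed

lemma comp_norm_le_weighted_norm_1: "a \<in> A \<Longrightarrow> comp_norm R a \<tau> \<le> weighted_norm 1 \<tau>"
  using comp_norm_le_weighted_norm[of a 1] by simp

lemma weighted_norm_sum: "finite B \<Longrightarrow> weighted_norm \<rho> (\<Sum>b\<in>B. u b) \<le> (\<Sum>b\<in>B. weighted_norm \<rho> (u b))"
  by (induction B rule: finite_induct)
     (auto simp: weighted_norm_def comp_norm_0[OF A_index] intro: order_trans[OF weighted_norm_triangle[unfolded weighted_norm_def]])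

lemma comp_norm_abs_diff_le:
  assumes "a \<in> A"
  shows "\<bar>comp_norm R a \<sigma> - comp_norm R a \<tau>\<bar> \<le> weighted_norm 1 (\<sigma> - \<tau>)"
proof -
  note a = A_index[OF assms]
  have "comp_norm R a \<sigma> \<le> comp_norm R a \<tau> + comp_norm R a (\<sigma> - \<tau>)"
    using comp_norm_triangle[OF a, of \<tau> "\<sigma> - \<tau>"] by simp
  moreover have "comp_norm R a \<tau> \<le> comp_norm R a \<sigma> + comp_norm R a (\<sigma> - \<tau>)"
    using comp_norm_diff[OF a, of \<sigma> "\<sigma> - \<tau>"] by simp
  ultimately show ?thesis using comp_norm_le_weighted_norm_1[OF assms, of "\<sigma> - \<tau>"] by linarith
qed

text \<open>The bound of the model at level $\gamma$, with a nonnegative constant so that estimates can be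
  multiplied by it.\<close>

lemma \<Gamma>_model_bound:
  obtains C where "0 \<le> C" "\<And>x y a b \<tau>. scaled_norm s (x - y) \<le> 1 \<Longrightarrow> a \<in> A \<Longrightarrow> \<tau> \<in> rs_space R a \<Longrightarrow>
    b \<in> rs_index R \<Longrightarrow> b \<le> a \<Longrightarrow>
    comp_norm R b (\<Gamma> x y \<tau>) \<le> C * comp_norm R a \<tau> * rpow (scaled_norm s (x - y)) (a - b)"
proof -
  have "\<forall>\<gamma>>0. \<exists>C. \<forall>x. \<forall>y\<in>scaled_ball s x 1.
        \<forall>a\<in>index_below R \<gamma>. \<forall>\<tau>\<in>rs_space R a. \<forall>b\<in>rs_index R. b \<le> a \<longrightarrow>
          comp_norm R b (\<Gamma> x y \<tau>) \<le> C * comp_norm R a \<tau> * rpow (scaled_norm s (x - y)) (a - b)"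
    using model by (simp add: model_def)
  then obtain C where C: "\<forall>x. \<forall>y\<in>scaled_ball s x 1.
        \<forall>a\<in>A. \<forall>\<tau>\<in>rs_space R a. \<forall>b\<in>rs_index R. b \<le> a \<longrightarrow>
          comp_norm R b (\<Gamma> x y \<tau>) \<le> C * comp_norm R a \<tau> * rpow (scaled_norm s (x - y)) (a - b)"
    using \<gamma>_pos by blast
  show ?thesis
  proof (rule that[of "max C 0"])
    fix x y a b \<tau>
    assume *: "scaled_norm s (x - y) \<le> 1" "a \<in> A" "\<tau> \<in> rs_space R a" "b \<in> rs_index R" "b \<le> a"
    have "y \<in> scaled_ball s x 1"
      using *(1) scaled_norm_minus[of s "x - y"] by (simp add: scaled_ball_def s_pos)
    then have "comp_norm R b (\<Gamma> x y \<tau>) \<le> C * comp_norm R a \<tau> * rpow (scaled_norm s (x - y)) (a - b)"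
      using C * by blast
    also have "\<dots> \<le> max C 0 * comp_norm R a \<tau> * rpow (scaled_norm s (x - y)) (a - b)"
      using *(2) by (intro mult_right_mono comp_norm_nonneg A_index) (auto simp: rpow_def)
    finally show "comp_norm R b (\<Gamma> x y \<tau>) \<le> max C 0 * comp_norm R a \<tau> * rpow (scaled_norm s (x - y)) (a - b)" .
  qed simp
qed

text \<open>Here the weights match the bounds on the model: passing from degree $b$ to $a \le b$ costs
  $\|x - y\|^{b - a} \le \rho^{b - a}$, which is exactly the quotient of the weights.\<close>

lemma weighted_norm_\<Gamma>_le_homogeneous:
  obtains C where "0 \<le> C" "\<And>\<rho> x y b \<tau>. 0 < \<rho> \<Longrightarrow> \<rho> \<le> 1 \<Longrightarrow> scaled_norm s (x - y) \<le> \<rho> \<Longrightarrow>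
    b \<in> A \<Longrightarrow> \<tau> \<in> rs_space R b \<Longrightarrow> weighted_norm \<rho> (\<Gamma> x y \<tau>) \<le> C * (\<rho> powr b * comp_norm R b \<tau>)"
proof -
  obtain C where C: "0 \<le> C" "\<And>x y a b \<tau>. scaled_norm s (x - y) \<le> 1 \<Longrightarrow> a \<in> A \<Longrightarrow> \<tau> \<in> rs_space R a \<Longrightarrow>
    b \<in> rs_index R \<Longrightarrow> b \<le> a \<Longrightarrow>
    comp_norm R b (\<Gamma> x y \<tau>) \<le> C * comp_norm R a \<tau> * rpow (scaled_norm s (x - y)) (a - b)"
    by (rule \<Gamma>_model_bound) blast
  show ?thesis
  proof (rule that[of "card A * C"])
    fix \<rho> x y b \<tau>
    assume *: "0 < \<rho>" "\<rho> \<le> 1" "scaled_norm s (x - y) \<le> \<rho>" "b \<in> A" "\<tau> \<in> rs_space R b"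
    have "\<rho> powr a * comp_norm R a (\<Gamma> x y \<tau>) \<le> C * (\<rho> powr b * comp_norm R b \<tau>)" if a: "a \<in> A" for a
    proof (cases "a \<le> b")
      case True
      have "rpow (scaled_norm s (x - y)) (b - a) \<le> \<rho> powr (b - a)"
        using True * s_pos by (auto simp: rpow_def intro!: powr_mono2)
      then have "C * comp_norm R b \<tau> * rpow (scaled_norm s (x - y)) (b - a) \<le> C * comp_norm R b \<tau> * \<rho> powr (b - a)"
        using C * by (intro mult_left_mono mult_nonneg_nonneg comp_norm_nonneg A_index)
      moreover have "comp_norm R a (\<Gamma> x y \<tau>) \<le> C * comp_norm R b \<tau> * rpow (scaled_norm s (x - y)) (b - a)"
        using * True a by (intro C A_index) auto
      ultimately have "\<rho> powr a * comp_norm R a (\<Gamma> x y \<tau>) \<le> \<rho> powr a * (C * comp_norm R b \<tau> * \<rho> powr (b - a))"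
        by (intro mult_left_mono) auto
      also have "\<dots> = C * (\<rho> powr b * comp_norm R b \<tau>)"
        using * by (simp add: powr_diff)
      finally show ?thesis .
    next
      case False
      have "proj R a (\<Gamma> x y \<tau>) = proj R a (\<Gamma> x y \<tau> - \<tau>) + proj R a \<tau>"
        by (simp flip: linear_add[OF linear_proj])
      also have "\<dots> = 0"
        using False * proj_\<Gamma>_homogeneous[OF A_index, where a=a and b=b and \<tau>=\<tau>] by (simp add: proj_homogeneous A_index)
      finally have "comp_norm R a (\<Gamma> x y \<tau>) = 0"
        using comp_norm_0[OF A_index[OF a]] by (simp add: comp_norm_def linear_0[OF linear_proj])
      then show ?thesis
        using C * by (auto intro!: mult_nonneg_nonneg comp_norm_nonneg A_index)
    qed
    then have "weighted_norm \<rho> (\<Gamma> x y \<tau>) \<le> (\<Sum>a\<in>A. C * (\<rho> powr b * comp_norm R b \<tau>))"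
      unfolding weighted_norm_def by (rule sum_mono)
    then show "weighted_norm \<rho> (\<Gamma> x y \<tau>) \<le> card A * C * (\<rho> powr b * comp_norm R b \<tau>)"
      by simp
  qed (use C in simp)
qed

lemma weighted_norm_\<Gamma>_le_step:
  obtains C where "0 \<le> C" "\<And>\<rho> x y \<tau>. 0 < \<rho> \<Longrightarrow> \<rho> \<le> 1 \<Longrightarrow> scaled_norm s (x - y) \<le> \<rho> \<Longrightarrow>
    \<tau> \<in> T \<Longrightarrow> weighted_norm \<rho> (\<Gamma> x y \<tau>) \<le> C * weighted_norm \<rho> \<tau>"
proof -
  obtain C where C: "0 \<le> C" "\<And>\<rho> x y b \<tau>. 0 < \<rho> \<Longrightarrow> \<rho> \<le> 1 \<Longrightarrow> scaled_norm s (x - y) \<le> \<rho> \<Longrightarrow>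
    b \<in> A \<Longrightarrow> \<tau> \<in> rs_space R b \<Longrightarrow> weighted_norm \<rho> (\<Gamma> x y \<tau>) \<le> C * (\<rho> powr b * comp_norm R b \<tau>)"
    by (rule weighted_norm_\<Gamma>_le_homogeneous) blast
  show ?thesis
  proof (rule that[OF C(1)])
    fix \<rho> x y \<tau>
    assume *: "0 < \<rho>" "\<rho> \<le> 1" "scaled_norm s (x - y) \<le> \<rho>" "\<tau> \<in> T"
    have "weighted_norm \<rho> (\<Gamma> x y \<tau>) = weighted_norm \<rho> (\<Sum>b\<in>A. \<Gamma> x y (proj R b \<tau>))"
      by (subst sum_proj[OF *(4)]) (simp add: linear_sum[OF linear_\<Gamma>])
    also have "\<dots> \<le> (\<Sum>b\<in>A. weighted_norm \<rho> (\<Gamma> x y (proj R b \<tau>)))"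
      by (rule weighted_norm_sum[OF finite_A])
    also have "\<dots> \<le> (\<Sum>b\<in>A. C * (\<rho> powr b * comp_norm R b (proj R b \<tau>)))"
      using * by (intro sum_mono C proj_mem A_index) auto
    also have "\<dots> = C * weighted_norm \<rho> \<tau>"
      by (simp add: weighted_norm_def sum_distrib_left comp_norm_proj[OF A_index])
    finally show "weighted_norm \<rho> (\<Gamma> x y \<tau>) \<le> C * weighted_norm \<rho> \<tau>" .
  qed
qed

text \<open>Points at distance $r \rho$ are joined by a number of steps of length at most $\rho$ that depends
  only on $r$, obtained by repeatedly inserting the midpoint. For large $r$ this goes beyond the
  distance 1 up to which the bounds of the model hold.\<close>

lemma weighted_norm_\<Gamma>_le:
  obtains C where "0 \<le> C" "\<And>\<rho> x y \<tau>. 0 < \<rho> \<Longrightarrow> \<rho> \<le> 1 \<Longrightarrow> scaled_norm s (x - y) \<le> r * \<rho> \<Longrightarrow>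
    \<tau> \<in> T \<Longrightarrow> weighted_norm \<rho> (\<Gamma> x y \<tau>) \<le> C * weighted_norm \<rho> \<tau>"
proof -
  define \<theta> :: real where "\<theta> = 2 powr (1 / scaling_size s)"
  have S: "0 < scaling_size s"
    unfolding scaling_size_def using s_pos by (intro sum_pos) auto
  have \<theta>: "1 < \<theta>" unfolding \<theta>_def using S by (intro gr_one_powr) auto
  have half: "scaled_norm s (x /\<^sub>R 2) \<le> scaled_norm s x / \<theta>" for x
    using scaled_norm_half[of s x] s_pos by (simp add: \<theta>_def powr_minus field_simps)
  have *: "\<exists>C\<ge>0. \<forall>\<rho> x y. \<forall>\<tau>\<in>T. 0 < \<rho> \<longrightarrow> \<rho> \<le> 1 \<longrightarrow> scaled_norm s (x - y) \<le> \<theta> ^ n * \<rho> \<longrightarrow>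
      weighted_norm \<rho> (\<Gamma> x y \<tau>) \<le> C * weighted_norm \<rho> \<tau>" for n
  proof (induction n)
    case 0
    show ?case using weighted_norm_\<Gamma>_le_step by (metis mult_1 power_0)
  next
    case (Suc n)
    then obtain C where C: "0 \<le> C" "\<And>\<rho> x y \<tau>. \<tau> \<in> T \<Longrightarrow> 0 < \<rho> \<Longrightarrow> \<rho> \<le> 1 \<Longrightarrow>
        scaled_norm s (x - y) \<le> \<theta> ^ n * \<rho> \<Longrightarrow> weighted_norm \<rho> (\<Gamma> x y \<tau>) \<le> C * weighted_norm \<rho> \<tau>"
      by blast
    have "weighted_norm \<rho> (\<Gamma> x y \<tau>) \<le> C * C * weighted_norm \<rho> \<tau>"
      if "\<tau> \<in> T" "0 < \<rho>" "\<rho> \<le> 1" "scaled_norm s (x - y) \<le> \<theta> ^ Suc n * \<rho>" for \<rho> x y \<tau>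
    proof -
      define z where "z = (x + y) /\<^sub>R 2"
      have "x - z = (x - y) /\<^sub>R 2" "z - y = (x - y) /\<^sub>R 2"
        by (simp_all add: z_def vec_eq_iff field_simps)
      moreover have "scaled_norm s ((x - y) /\<^sub>R 2) \<le> \<theta> ^ n * \<rho>"
      proof -
        have "scaled_norm s ((x - y) /\<^sub>R 2) \<le> \<theta> ^ Suc n * \<rho> / \<theta>"
          using half[of "x - y"] divide_right_mono[OF that(4), of \<theta>] \<theta> by linarith
        then show ?thesis using \<theta> by simp
      qed
      ultimately have 1: "weighted_norm \<rho> (\<Gamma> x z (\<Gamma> z y \<tau>)) \<le> C * weighted_norm \<rho> (\<Gamma> z y \<tau>)" and 2: "weighted_norm \<rho> (\<Gamma> z y \<tau>) \<le> C * weighted_norm \<rho> \<tau>"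
        using that by (auto intro!: C(2) \<Gamma>_mem_T)
      show ?thesis
        using order_trans[OF 1 mult_left_mono[OF 2 C(1)]] by (simp add: \<Gamma>_trans mult.assoc)
    qed
    then show ?case using C(1) by (intro exI[of _ "C * C"]) auto
  qed
  obtain n where n: "r < \<theta> ^ n" using real_arch_pow[OF \<theta>] by blast
  from *[of n] obtain C where C: "0 \<le> C" "\<And>\<rho> x y \<tau>. \<tau> \<in> T \<Longrightarrow> 0 < \<rho> \<Longrightarrow> \<rho> \<le> 1 \<Longrightarrow>
        scaled_norm s (x - y) \<le> \<theta> ^ n * \<rho> \<Longrightarrow> weighted_norm \<rho> (\<Gamma> x y \<tau>) \<le> C * weighted_norm \<rho> \<tau>"
    by blast
  show ?thesis
  proof (rule that[OF C(1)])
    fix \<rho> x y \<tau>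
    assume *: "0 < \<rho>" "\<rho> \<le> 1" "scaled_norm s (x - y) \<le> r * \<rho>" "\<tau> \<in> T"
    have "r * \<rho> \<le> \<theta> ^ n * \<rho>" using n * by (intro mult_right_mono) auto
    then show "weighted_norm \<rho> (\<Gamma> x y \<tau>) \<le> C * weighted_norm \<rho> \<tau>"
      using C(2)[OF *(4,1,2) order_trans[OF *(3)]] by blast
  qed
qed

text \<open>\<open>\<Gamma> x y \<tau> - \<tau>\<close> has only components of degree lower than that of $\tau$; the exponent is the
  smallest gap between two degrees below $\gamma$, or 1 if that is smaller.\<close>

lemma weighted_norm_\<Gamma>_diff_le:
  obtains C \<delta> where "0 \<le> C" "0 < \<delta>" "\<And>x y \<tau>. scaled_norm s (x - y) \<le> 1 \<Longrightarrow> \<tau> \<in> T \<Longrightarrow>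
    weighted_norm 1 (\<Gamma> x y \<tau> - \<tau>) \<le> C * scaled_norm s (x - y) powr \<delta> * weighted_norm 1 \<tau>"
proof -
  obtain C where C: "0 \<le> C" "\<And>x y a b \<tau>. scaled_norm s (x - y) \<le> 1 \<Longrightarrow> a \<in> A \<Longrightarrow> \<tau> \<in> rs_space R a \<Longrightarrow>
    b \<in> rs_index R \<Longrightarrow> b \<le> a \<Longrightarrow>
    comp_norm R b (\<Gamma> x y \<tau>) \<le> C * comp_norm R a \<tau> * rpow (scaled_norm s (x - y)) (a - b)"
    by (rule \<Gamma>_model_bound) blast
  define gaps where "gaps = insert 1 ((\<lambda>(a, b). b - a) ` {(a, b) \<in> A \<times> A. a < b})"
  define \<delta> where "\<delta> = Min gaps"
  have gaps: "finite gaps" "gaps \<noteq> {}"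
    using finite_subset[OF _ finite_cartesian_product[OF finite_A finite_A], of "{(a, b) \<in> A \<times> A. a < b}"]
    by (auto simp: gaps_def)
  have \<delta>: "0 < \<delta>" using gaps by (auto simp: \<delta>_def gaps_def)
  have \<delta>_le: "\<delta> \<le> b - a" if "a \<in> A" "b \<in> A" "a < b" for a b
    unfolding \<delta>_def using gaps that by (intro Min_le) (auto simp: gaps_def)
  show ?thesis
  proof (rule that[of "card A * C" \<delta>])
    fix x y \<tau>
    assume *: "scaled_norm s (x - y) \<le> 1" "\<tau> \<in> T"
    let ?n = "scaled_norm s (x - y)"
    have homogeneous: "comp_norm R a (\<Gamma> x y (proj R b \<tau>) - proj R b \<tau>) \<le> C * ?n powr \<delta> * comp_norm R b \<tau>"
      if ab: "a \<in> A" "b \<in> A" for a b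
    proof (cases "a < b")
      case True
      have "comp_norm R a (\<Gamma> x y (proj R b \<tau>) - proj R b \<tau>) = comp_norm R a (\<Gamma> x y (proj R b \<tau>))"
        using True ab by (simp add: comp_norm_def linear_diff[OF linear_proj] proj_homogeneous[OF proj_mem] A_index)
      also have "\<dots> \<le> C * comp_norm R b (proj R b \<tau>) * rpow ?n (b - a)"
        using True ab * by (intro C proj_mem A_index) auto
      also have "\<dots> = C * ?n powr (b - a) * comp_norm R b \<tau>"
        using True ab by (simp add: rpow_def comp_norm_proj A_index)
      also have "\<dots> \<le> C * ?n powr \<delta> * comp_norm R b \<tau>"
        using \<delta>_le[OF ab True] * ab C s_pos
        by (intro mult_right_mono mult_left_mono comp_norm_nonneg A_index powr_mono') auto
      finally show ?thesis .
    next
      case False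
      then have "comp_norm R a (\<Gamma> x y (proj R b \<tau>) - proj R b \<tau>) = 0"
        using ab comp_norm_0[of a] proj_\<Gamma>_homogeneous[OF A_index proj_mem, where a=a and b=b]
        by (simp add: comp_norm_def linear_0[OF linear_proj] A_index)
      then show ?thesis using C ab by (auto intro!: mult_nonneg_nonneg comp_norm_nonneg A_index)
    qed
    have "\<Gamma> x y \<tau> - \<tau> = (\<Sum>b\<in>A. \<Gamma> x y (proj R b \<tau>) - proj R b \<tau>)"
      unfolding sum_subtractf linear_sum[OF linear_\<Gamma>, symmetric] using sum_proj[OF *(2)] by simp
    then have "weighted_norm 1 (\<Gamma> x y \<tau> - \<tau>) \<le> (\<Sum>b\<in>A. weighted_norm 1 (\<Gamma> x y (proj R b \<tau>) - proj R b \<tau>))"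
      using weighted_norm_sum[OF finite_A] by simp
    also have "\<dots> \<le> (\<Sum>b\<in>A. \<Sum>a\<in>A. C * ?n powr \<delta> * comp_norm R b \<tau>)"
      unfolding weighted_norm_def using homogeneous by (intro sum_mono) auto
    also have "\<dots> = card A * C * ?n powr \<delta> * weighted_norm 1 \<tau>"
      by (simp add: weighted_norm_def sum_distrib_left mult.assoc)
    finally show "weighted_norm 1 (\<Gamma> x y \<tau> - \<tau>) \<le> card A * C * ?n powr \<delta> * weighted_norm 1 \<tau>" .
  qed (use C \<delta> in auto)
qed

text \<open>Moving $x$ to $x'$ and $y$ to $y'$ replaces $\<Gamma>_{y,x}$ by
  $\<Gamma>_{y',y} \<Gamma>_{y,x} \<Gamma>_{x,x'}$, and the outer factors are close to the identity.\<close>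

lemma isCont_comp_norm_\<Gamma>:
  assumes a: "a \<in> A" and \<sigma>: "\<sigma> \<in> T"
  shows "isCont (\<lambda>z. comp_norm R a (\<tau> - \<Gamma> (fst z + snd z) (fst z) \<sigma>)) z0"
proof -
  obtain x0 h0 where z0: "z0 = (x0, h0)" by (cases z0)
  define y0 where "y0 = x0 + h0"
  obtain C \<delta> where C: "0 \<le> C" "0 < \<delta>" "\<And>x y \<tau>. scaled_norm s (x - y) \<le> 1 \<Longrightarrow> \<tau> \<in> T \<Longrightarrow>
    weighted_norm 1 (\<Gamma> x y \<tau> - \<tau>) \<le> C * scaled_norm s (x - y) powr \<delta> * weighted_norm 1 \<tau>"
    by (rule weighted_norm_\<Gamma>_diff_le) blast
  obtain K where K: "0 \<le> K" "\<And>\<rho> x y \<tau>. 0 < \<rho> \<Longrightarrow> \<rho> \<le> 1 \<Longrightarrow> scaled_norm s (x - y) \<le> scaled_norm s (y0 - x0) * \<rho> \<Longrightarrow>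
    \<tau> \<in> T \<Longrightarrow> weighted_norm \<rho> (\<Gamma> x y \<tau>) \<le> K * weighted_norm \<rho> \<tau>"
    by (rule weighted_norm_\<Gamma>_le) blast
  define n1 where "n1 z = scaled_norm s (x0 - fst z)" for z :: "(real^'d) \<times> (real^'d)"
  define n2 where "n2 z = scaled_norm s (fst z + snd z - y0)" for z :: "(real^'d) \<times> (real^'d)"
  have n1: "(n1 \<longlongrightarrow> 0) (at z0)"
    unfolding n1_def
    by (rule filterlim_compose[OF tendsto_scaled_norm_0[OF s_pos]])
       (auto intro!: tendsto_eq_intros simp: z0)
  have n2: "(n2 \<longlongrightarrow> 0) (at z0)"
    unfolding n2_def
    by (rule filterlim_compose[OF tendsto_scaled_norm_0[OF s_pos]])
       (auto intro!: tendsto_eq_intros simp: z0 y0_def)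
  let ?B = "\<lambda>z. C * n2 z powr \<delta> * (weighted_norm 1 (\<Gamma> y0 x0 \<sigma>) + K * (C * n1 z powr \<delta> * weighted_norm 1 \<sigma>)) + K * (C * n1 z powr \<delta> * weighted_norm 1 \<sigma>)"
  have "\<forall>\<^sub>F z in at z0. \<bar>comp_norm R a (\<tau> - \<Gamma> (fst z + snd z) (fst z) \<sigma>) - comp_norm R a (\<tau> - \<Gamma> y0 x0 \<sigma>)\<bar> \<le> ?B z"
    using order_tendstoD(2)[OF n1, of 1, simplified] order_tendstoD(2)[OF n2, of 1, simplified]
  proof eventually_elim
    case (elim z)
    let ?x = "fst z" and ?y = "fst z + snd z"
    define v where "v = \<Gamma> y0 ?x \<sigma>"
    have v: "v \<in> T" unfolding v_def by (intro \<Gamma>_mem_T \<sigma>)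
    have d: "v - \<Gamma> y0 x0 \<sigma> = \<Gamma> y0 x0 (\<Gamma> x0 ?x \<sigma> - \<sigma>)"
      by (simp add: v_def linear_diff[OF linear_\<Gamma>] \<Gamma>_trans)
    have "weighted_norm 1 (v - \<Gamma> y0 x0 \<sigma>) \<le> K * weighted_norm 1 (\<Gamma> x0 ?x \<sigma> - \<sigma>)"
      unfolding d by (intro K(2) subspace_diff[OF subspace_T] \<Gamma>_mem_T \<sigma>) auto
    also have "\<dots> \<le> K * (C * n1 z powr \<delta> * weighted_norm 1 \<sigma>)"
      unfolding n1_def using elim \<sigma> by (intro mult_left_mono K C) (auto simp: n1_def)
    finally have 1: "weighted_norm 1 (v - \<Gamma> y0 x0 \<sigma>) \<le> K * (C * n1 z powr \<delta> * weighted_norm 1 \<sigma>)" .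
    have "weighted_norm 1 v \<le> weighted_norm 1 (\<Gamma> y0 x0 \<sigma>) + weighted_norm 1 (v - \<Gamma> y0 x0 \<sigma>)"
      using weighted_norm_triangle[of 1 "\<Gamma> y0 x0 \<sigma>" "v - \<Gamma> y0 x0 \<sigma>"] by simp
    with 1 have 2: "weighted_norm 1 v \<le> weighted_norm 1 (\<Gamma> y0 x0 \<sigma>) + K * (C * n1 z powr \<delta> * weighted_norm 1 \<sigma>)" by linarith
    have "weighted_norm 1 (\<Gamma> ?y y0 v - v) \<le> C * n2 z powr \<delta> * weighted_norm 1 v"
      unfolding n2_def using elim v by (intro C) (auto simp: n2_def)
    also have "\<dots> \<le> C * n2 z powr \<delta> * (weighted_norm 1 (\<Gamma> y0 x0 \<sigma>) + K * (C * n1 z powr \<delta> * weighted_norm 1 \<sigma>))"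
      using C 2 by (intro mult_left_mono) auto
    finally have 3: "weighted_norm 1 (\<Gamma> ?y y0 v - v) \<le> \<dots>" .
    have e: "\<Gamma> ?y ?x \<sigma> - \<Gamma> y0 x0 \<sigma> = (\<Gamma> ?y y0 v - v) + (v - \<Gamma> y0 x0 \<sigma>)"
      by (simp add: v_def \<Gamma>_trans)
    have "weighted_norm 1 (\<Gamma> ?y ?x \<sigma> - \<Gamma> y0 x0 \<sigma>) \<le> ?B z"
      unfolding e using weighted_norm_triangle[of 1 "\<Gamma> ?y y0 v - v" "v - \<Gamma> y0 x0 \<sigma>"] 1 3 by linarith
    moreover have "\<bar>comp_norm R a (\<tau> - \<Gamma> ?y ?x \<sigma>) - comp_norm R a (\<tau> - \<Gamma> y0 x0 \<sigma>)\<bar> \<le>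
        weighted_norm 1 (\<Gamma> ?y ?x \<sigma> - \<Gamma> y0 x0 \<sigma>)"
    proof -
      have "weighted_norm 1 (\<tau> - \<Gamma> ?y ?x \<sigma> - (\<tau> - \<Gamma> y0 x0 \<sigma>)) \<le> weighted_norm 1 (\<Gamma> ?y ?x \<sigma> - \<Gamma> y0 x0 \<sigma>)"
        unfolding weighted_norm_def
        by (intro sum_mono mult_left_mono)
           (use comp_norm_minus[OF A_index, of _ "\<Gamma> ?y ?x \<sigma> - \<Gamma> y0 x0 \<sigma>"] in \<open>auto simp: algebra_simps\<close>)
      then show ?thesis using comp_norm_abs_diff_le[OF a] order_trans by blast
    qed
    ultimately show ?case by linarith
  qed
  moreover have "(?B \<longlongrightarrow> 0) (at z0)"
  proof -
    have 1: "((\<lambda>z. n1 z powr \<delta>) \<longlongrightarrow> 0) (at z0)"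
      by (rule tendsto_zero_powrI[OF n1 tendsto_const _ C(2)]) (simp add: n1_def s_pos)
    have 2: "((\<lambda>z. n2 z powr \<delta>) \<longlongrightarrow> 0) (at z0)"
      by (rule tendsto_zero_powrI[OF n2 tendsto_const _ C(2)]) (simp add: n2_def s_pos)
    have "(?B \<longlongrightarrow> C * 0 * (weighted_norm 1 (\<Gamma> y0 x0 \<sigma>) + K * (C * 0 * weighted_norm 1 \<sigma>)) + K * (C * 0 * weighted_norm 1 \<sigma>)) (at z0)"
      by (intro tendsto_add tendsto_mult tendsto_const 1 2)
    then show ?thesis by simp
  qed
  ultimately have "((\<lambda>z. comp_norm R a (\<tau> - \<Gamma> (fst z + snd z) (fst z) \<sigma>) - comp_norm R a (\<tau> - \<Gamma> y0 x0 \<sigma>)) \<longlongrightarrow> 0) (at z0)"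
    unfolding real_norm_def[symmetric] by (rule Lim_null_comparison)
  then show ?thesis
    by (simp add: isCont_def LIM_zero_iff z0 y0_def)
qed

end

section \<open>Borel versions of modelled distributions\<close>

lemma AE_lborel_translate:
  fixes h :: "'a::euclidean_space"
  assumes "AE x in lborel. P x"
  shows "AE x in lborel. P (x + h)"
proof -
  have "AE x in distr lborel borel ((+) h). P x"
    using assms by (subst lborel_distr_plus)
  from AE_distrD[OF _ this] have "AE x in lborel. P (h + x)" by simp
  then show ?thesis by (simp add: add.commute)
qed

text \<open>A simple function for the completion can be changed on a null set to become measurable. Keeping
  its values in $V$ matters for modelled distributions: their increments are continuous in the two
  points only for values in the span of the components below $\gamma$.\<close>

lemma simple_function_completion_finite_range:
  fixes f :: "'a \<Rightarrow> 'b"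
  assumes f: "simple_function (completion M) f" and V: "finite V" "V \<noteq> {}" "f ` space M \<subseteq> V"
  obtains g where "g \<in> measurable M (count_space V)" "AE x in M. f x = g x"
proof -
  obtain f' where f': "simple_function M f'" "AE x in M. f x = f' x"
    using completion_ex_simple_function[OF f] by blast
  obtain v where v: "v \<in> V" using V by auto
  define g where "g x = (if f' x \<in> V then f' x else v)" for x
  have "(\<lambda>x. if f' x \<in> V then f' x else v) \<in> measurable M (count_space UNIV)"
    using measurable_simple_function[OF f'(1)] by (rule measurable_compose) simp
  then have "g \<in> measurable M (count_space UNIV)" by (simp add: g_def[abs_def])
  moreover have "g x \<in> V" for x using v by (simp add: g_def)
  ultimately have "g \<in> measurable M (count_space V)"
    using V(1) by (auto simp: measurable_count_space_eq2 measurable_count_space_eq2_countable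
       intro: measurable_sets[of g M "count_space UNIV"])
  moreover have "AE x in M. f x = g x"
    using f'(2) AE_space by eventually_elim (use V in \<open>auto simp: g_def\<close>)
  ultimately show ?thesis using that by blast
qed

context regularity_model
begin

lemma modelled_mem_T: "modelled_function R \<gamma> f \<Longrightarrow> f x \<in> T"
  by (simp add: modelled_function_def)

text \<open>With $f$ replaced by simple functions, the norm of the increment is a continuous function of
  $(x, h)$ on each of finitely many Borel sets of pairs, and the limit is taken as a lower limit to have it
  defined everywhere. The good points are described by a predicate $P$, so that they can
  be translated: for fixed $h$ almost all $x$, and for fixed good $x$ almost all $h$, are such that
  $x$ and $x + h$ are both good.\<close>

lemma modelled_Borel_version:
  assumes f: "modelled_function R \<gamma> f"
  obtains P U G where
    "AE x in lborel. P x"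
    "\<And>a. a \<in> A \<Longrightarrow> U a \<in> borel_measurable borel"
    "\<And>a. a \<in> A \<Longrightarrow> G a \<in> borel_measurable (borel \<Otimes>\<^sub>M borel)"
    "\<And>a x. a \<in> A \<Longrightarrow> P x \<Longrightarrow> ennreal (comp_norm R a (f x)) = U a x"
    "\<And>a x h. a \<in> A \<Longrightarrow> P x \<Longrightarrow> P (x + h) \<Longrightarrow> ennreal (increment R \<Gamma> f a x h) = G a (x, h)"
proof -
  have "\<forall>a\<in>A. \<exists>\<sigma> :: nat \<Rightarrow> real^'d \<Rightarrow> 't.
        (\<forall>n. simple_function lebesgue (\<sigma> n)) \<and> (\<forall>n x. \<sigma> n x \<in> rs_space R a) \<and>
        (AE x in lebesgue. (\<lambda>n. rs_norm R a (\<sigma> n x - proj R a (f x))) \<longlonglongrightarrow> 0)"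
    using f by (simp add: modelled_function_def)
  from bchoice[OF this] obtain \<sigma> where \<sigma>: "\<And>a n. a \<in> A \<Longrightarrow> simple_function lebesgue (\<sigma> a n)"
      "\<And>a n x. a \<in> A \<Longrightarrow> \<sigma> a n x \<in> rs_space R a"
      "\<And>a. a \<in> A \<Longrightarrow> AE x in lebesgue. (\<lambda>n. rs_norm R a (\<sigma> a n x - proj R a (f x))) \<longlonglongrightarrow> 0"
    by blast
  define F where "F n x = (\<Sum>a\<in>A. \<sigma> a n x)" for n x
  define V where "V n = range (F n)" for n
  have F_simple: "simple_function lebesgue (F n)" for n
    unfolding F_def by (intro simple_function_sum \<sigma>)
  have F_T: "F n x \<in> T" for n x
    unfolding F_def using \<sigma>(2) by (rule T_I)
  have V: "finite (V n)" "V n \<noteq> {}" "V n \<subseteq> T" for n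
    using simple_functionD(1)[OF F_simple[of n]] F_T by (auto simp: V_def)
  have "\<exists>g. g \<in> measurable lborel (count_space (V n)) \<and> (AE x in lborel. F n x = g x)" for n
    by (rule simple_function_completion_finite_range[OF F_simple[of n] V(1,2)[of n]]) (auto simp: V_def)
  then obtain g where g: "\<And>n. g n \<in> measurable lborel (count_space (V n))" "\<And>n. AE x in lborel. F n x = g n x"
    by metis
  define P where "P x \<longleftrightarrow> (\<forall>n. F n x = g n x) \<and>
    (\<forall>a\<in>A. (\<lambda>n. rs_norm R a (\<sigma> a n x - proj R a (f x))) \<longlonglongrightarrow> 0)" for x
  have AE_P: "AE x in lborel. P x"
    unfolding P_def using g(2) \<sigma>(3)[unfolded AE_completion_iff] finite_A
    by (auto simp: AE_all_countable AE_finite_all)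
  define U where "U a x = liminf (\<lambda>n. ennreal (comp_norm R a (g n x)))" for a x
  define H where "H a n z = ennreal (comp_norm R a (g n (fst z + snd z) - \<Gamma> (fst z + snd z) (fst z) (g n (fst z))))"
    for a n and z :: "(real^'d) \<times> (real^'d)"
  define G where "G a z = liminf (\<lambda>n. H a n z)" for a z
  have U_meas: "U a \<in> borel_measurable borel" for a
  proof -
    have "(\<lambda>x. ennreal (comp_norm R a (g n x))) \<in> borel_measurable lborel" for n
      by (rule measurable_compose[OF g(1)]) simp
    then show ?thesis unfolding U_def by simp
  qed
  have G_meas: "G a \<in> borel_measurable (borel \<Otimes>\<^sub>M borel)" if a: "a \<in> A" for a
  proof -
    have "H a n \<in> borel_measurable (borel \<Otimes>\<^sub>M borel)" for n
    proof -
      let ?J = "\<lambda>i z. ennreal (comp_norm R a (snd i - \<Gamma> (fst z + snd z) (fst z) (fst i)))"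
      let ?i = "\<lambda>z. (g n (fst z), g n (fst z + snd z))"
      have J: "?J i \<in> borel_measurable (borel \<Otimes>\<^sub>M borel)" if "i \<in> V n \<times> V n" for i
      proof -
        have "continuous_on UNIV (\<lambda>z. comp_norm R a (snd i - \<Gamma> (fst z + snd z) (fst z) (fst i)))"
          using that a by (intro continuous_at_imp_continuous_on ballI isCont_comp_norm_\<Gamma> subsetD[OF V(3)]) auto
        then have "(\<lambda>z. comp_norm R a (snd i - \<Gamma> (fst z + snd z) (fst z) (fst i))) \<in> borel_measurable borel"
          by (rule borel_measurable_continuous_onI)
        then show ?thesis by (simp add: borel_prod)
      qed
      have "?i \<in> measurable (borel \<Otimes>\<^sub>M borel) (count_space (V n) \<Otimes>\<^sub>M count_space (V n))"
        using g(1)[of n] by (intro measurable_Pair) (auto intro!: measurable_compose[of _ _ borel])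
      then have i: "?i \<in> measurable (borel \<Otimes>\<^sub>M borel) (count_space (V n \<times> V n))"
        using V(1) by (simp add: pair_measure_countable countable_finite)
      have "(\<lambda>z. ?J (?i z) z) \<in> borel_measurable (borel \<Otimes>\<^sub>M borel)"
        using V(1)[of n]
        by (intro measurable_compose_countable'[where f="?J" and g="?i", OF J i] countable_finite finite_cartesian_product)
      then show ?thesis by (simp add: H_def[abs_def])
    qed
    then show ?thesis unfolding G_def by simp
  qed
  \<comment> \<open>Convergence of all components, as there are finitely many.\<close>
  have err: "(\<lambda>n. weighted_norm 1 (F n x - f x)) \<longlonglongrightarrow> 0" if "P x" for x
  proof -
    have "comp_norm R a (F n x - f x) = rs_norm R a (\<sigma> a n x - proj R a (f x))" if a: "a \<in> A" for a n
    proof -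
      have "proj R a (F n x) = (\<Sum>b\<in>A. if b = a then \<sigma> a n x else 0)"
        unfolding F_def linear_sum[OF linear_proj]
        using \<sigma>(2) by (intro sum.cong refl) (auto simp: proj_homogeneous[OF \<sigma>(2) A_index])
      then show ?thesis
        using a finite_A by (simp add: comp_norm_def linear_diff[OF linear_proj])
    qed
    then have "weighted_norm 1 (F n x - f x) = (\<Sum>a\<in>A. rs_norm R a (\<sigma> a n x - proj R a (f x)))" for n
      by (simp add: weighted_norm_def)
    then show ?thesis
      using \<open>P x\<close> tendsto_sum[of A "\<lambda>a n. rs_norm R a (\<sigma> a n x - proj R a (f x))" "\<lambda>_. 0" sequentially]
      by (simp add: P_def)
  qed
  show ?thesis
  proof (rule that[OF AE_P U_meas G_meas])
    fix a x assume a: "a \<in> A" and x: "P x"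
    have "(\<lambda>n. comp_norm R a (F n x) - comp_norm R a (f x)) \<longlonglongrightarrow> 0"
      by (rule Lim_null_comparison[OF _ err[OF x]]) (simp add: comp_norm_abs_diff_le[OF a])
    then have "(\<lambda>n. comp_norm R a (F n x)) \<longlonglongrightarrow> comp_norm R a (f x)"
      by (simp add: LIM_zero_iff)
    then have "(\<lambda>n. ennreal (comp_norm R a (g n x))) \<longlonglongrightarrow> ennreal (comp_norm R a (f x))"
      using x by (intro tendsto_ennrealI) (simp add: P_def)
    then show "ennreal (comp_norm R a (f x)) = U a x"
      unfolding U_def by (intro lim_imp_Liminf[symmetric]) auto
  next
    fix a x h assume a: "a \<in> A" and x: "P x" and y: "P (x + h)"
    obtain K where K: "0 \<le> K" "\<And>\<rho> x y \<tau>. 0 < \<rho> \<Longrightarrow> \<rho> \<le> 1 \<Longrightarrow> scaled_norm s (x - y) \<le> scaled_norm s h * \<rho> \<Longrightarrow>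
      \<tau> \<in> T \<Longrightarrow> weighted_norm \<rho> (\<Gamma> x y \<tau>) \<le> K * weighted_norm \<rho> \<tau>"
      by (rule weighted_norm_\<Gamma>_le) blast
    let ?u = "\<lambda>n. F n (x + h) - \<Gamma> (x + h) x (F n x)" and ?v = "f (x + h) - \<Gamma> (x + h) x (f x)"
    have bound: "\<bar>comp_norm R a (?u n) - comp_norm R a ?v\<bar> \<le> weighted_norm 1 (F n (x + h) - f (x + h)) + K * weighted_norm 1 (F n x - f x)" for n
    proof -
      have "\<bar>comp_norm R a (?u n) - comp_norm R a ?v\<bar> \<le> weighted_norm 1 (?u n - ?v)"
        by (rule comp_norm_abs_diff_le[OF a])
      also have "?u n - ?v = (F n (x + h) - f (x + h)) - \<Gamma> (x + h) x (F n x - f x)"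
        by (simp add: linear_diff[OF linear_\<Gamma>])
      also have "weighted_norm 1 \<dots> \<le> weighted_norm 1 (F n (x + h) - f (x + h)) + weighted_norm 1 (\<Gamma> (x + h) x (F n x - f x))"
        by (rule weighted_norm_diff)
      also have "weighted_norm 1 (\<Gamma> (x + h) x (F n x - f x)) \<le> K * weighted_norm 1 (F n x - f x)"
        by (rule K(2)) (auto intro!: subspace_diff[OF subspace_T] F_T modelled_mem_T[OF f])
      finally show ?thesis by simp
    qed
    have "(\<lambda>n. weighted_norm 1 (F n (x + h) - f (x + h)) + K * weighted_norm 1 (F n x - f x)) \<longlonglongrightarrow> 0 + K * 0"
      by (intro tendsto_add tendsto_mult tendsto_const err x y)
    then have lim: "(\<lambda>n. weighted_norm 1 (F n (x + h) - f (x + h)) + K * weighted_norm 1 (F n x - f x)) \<longlonglongrightarrow> 0" by simp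
    have "(\<lambda>n. comp_norm R a (?u n) - comp_norm R a ?v) \<longlonglongrightarrow> 0"
      by (rule Lim_null_comparison[OF always_eventually[OF allI] lim]) (use bound in simp)
    then have "(\<lambda>n. comp_norm R a (?u n)) \<longlonglongrightarrow> comp_norm R a ?v"
      by (simp add: LIM_zero_iff)
    then have "(\<lambda>n. H a n (x, h)) \<longlonglongrightarrow> ennreal (comp_norm R a ?v)"
      unfolding H_def using x y by (intro tendsto_ennrealI) (simp add: P_def)
    then show "ennreal (increment R \<Gamma> f a x h) = G a (x, h)"
      unfolding G_def increment_def by (intro lim_imp_Liminf[symmetric]) auto
  qed
qed

end

section \<open>Increments against averages\<close>

context regularity_model
begin

text \<open>The third point $z = x + k$ is near both $x$ and $y = x + h$, and the increments on the right hand
  side start at $x$ and at $y$ and both end at $z$.\<close>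

lemma increment_le_increments:
  obtains C where "0 \<le> C" "\<And>f a x h k l. (\<And>x. f x \<in> T) \<Longrightarrow> a \<in> A \<Longrightarrow> 0 < l \<Longrightarrow> l \<le> 1 \<Longrightarrow>
    scaled_norm s h \<le> 2 * l \<Longrightarrow> scaled_norm s k \<le> l \<Longrightarrow>
    increment R \<Gamma> f a x h \<le> C * l powr (- a) *
      (\<Sum>b\<in>A. l powr b * (increment R \<Gamma> f b x k + increment R \<Gamma> f b (x + h) (k - h)))"
proof -
  obtain C where C: "0 \<le> C" "\<And>\<rho> x y \<tau>. 0 < \<rho> \<Longrightarrow> \<rho> \<le> 1 \<Longrightarrow> scaled_norm s (x - y) \<le> 3 * \<rho> \<Longrightarrow>
    \<tau> \<in> T \<Longrightarrow> weighted_norm \<rho> (\<Gamma> x y \<tau>) \<le> C * weighted_norm \<rho> \<tau>"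
    by (rule weighted_norm_\<Gamma>_le) blast
  show ?thesis
  proof (rule that[OF C(1)])
    fix f :: "real^'d \<Rightarrow> 't" and a x h k l
    assume f: "\<And>x. f x \<in> T" and a: "a \<in> A" and l: "0 < l" "l \<le> 1"
      and h: "scaled_norm s h \<le> 2 * l" and k: "scaled_norm s k \<le> l"
    define y z where "y = x + h" and "z = x + k"
    define u v where "u = f z - \<Gamma> z x (f x)" and "v = f z - \<Gamma> z y (f y)"
    have uv: "u \<in> T" "v \<in> T"
      unfolding u_def v_def by (intro subspace_diff[OF subspace_T] f \<Gamma>_mem_T)+
    have eq: "f y - \<Gamma> y x (f x) = \<Gamma> y z (u - v)"
      by (simp add: u_def v_def linear_diff[OF linear_\<Gamma>] \<Gamma>_trans \<Gamma>_refl)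
    have "scaled_norm s (y - z) \<le> 3 * l"
      using scaled_norm_triangle[where s=s, OF s_pos, where x=h and y="- k"] h k by (simp add: y_def z_def s_pos)
    then have "weighted_norm l (f y - \<Gamma> y x (f x)) \<le> C * weighted_norm l (u - v)"
      unfolding eq using l uv by (intro C subspace_diff[OF subspace_T])
    also have "\<dots> \<le> C * (weighted_norm l u + weighted_norm l v)"
      by (intro mult_left_mono weighted_norm_diff C)
    finally have weighted_norm_le: "weighted_norm l (f y - \<Gamma> y x (f x)) \<le> C * (weighted_norm l u + weighted_norm l v)" .
    have "increment R \<Gamma> f a x h \<le> l powr (- a) * weighted_norm l (f y - \<Gamma> y x (f x))"
      unfolding increment_def y_def by (intro comp_norm_le_weighted_norm a l)
    also have "\<dots> \<le> l powr (- a) * (C * (weighted_norm l u + weighted_norm l v))"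
      by (intro mult_left_mono weighted_norm_le) simp
    also have "weighted_norm l u + weighted_norm l v = (\<Sum>b\<in>A. l powr b * (increment R \<Gamma> f b x k + increment R \<Gamma> f b (x + h) (k - h)))"
      by (simp add: weighted_norm_def increment_def u_def v_def y_def z_def sum.distrib distrib_left)
    finally show "increment R \<Gamma> f a x h \<le> C * l powr (- a) *
      (\<Sum>b\<in>A. l powr b * (increment R \<Gamma> f b x k + increment R \<Gamma> f b (x + h) (k - h)))"
      by (simp add: mult_ac)
  qed
qed

text \<open>The crude bound for increments at distance of order 1, where there is nothing to gain.\<close>

lemma increment_le_values:
  obtains C where "0 \<le> C" "\<And>f a x h. (\<And>x. f x \<in> T) \<Longrightarrow> a \<in> A \<Longrightarrow> scaled_norm s h \<le> 4 \<Longrightarrow>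
    increment R \<Gamma> f a x h \<le> C * (\<Sum>b\<in>A. comp_norm R b (f (x + h)) + comp_norm R b (f x))"
proof -
  obtain C where C: "0 \<le> C" "\<And>\<rho> x y \<tau>. 0 < \<rho> \<Longrightarrow> \<rho> \<le> 1 \<Longrightarrow> scaled_norm s (x - y) \<le> 4 * \<rho> \<Longrightarrow>
    \<tau> \<in> T \<Longrightarrow> weighted_norm \<rho> (\<Gamma> x y \<tau>) \<le> C * weighted_norm \<rho> \<tau>"
    by (rule weighted_norm_\<Gamma>_le) blast
  show ?thesis
  proof (rule that[of "1 + C"])
    fix f :: "real^'d \<Rightarrow> 't" and a x h
    assume f: "\<And>x. f x \<in> T" and a: "a \<in> A" and h: "scaled_norm s h \<le> 4"
    have "increment R \<Gamma> f a x h \<le> weighted_norm 1 (f (x + h) - \<Gamma> (x + h) x (f x))"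
      unfolding increment_def by (rule comp_norm_le_weighted_norm_1[OF a])
    also have "\<dots> \<le> weighted_norm 1 (f (x + h)) + weighted_norm 1 (\<Gamma> (x + h) x (f x))"
      by (rule weighted_norm_diff)
    also have "weighted_norm 1 (\<Gamma> (x + h) x (f x)) \<le> C * weighted_norm 1 (f x)"
      by (rule C(2)) (simp_all add: h f)
    also have "weighted_norm 1 (f (x + h)) + C * weighted_norm 1 (f x) \<le> (1 + C) * (weighted_norm 1 (f (x + h)) + weighted_norm 1 (f x))"
      using C(1) mult_nonneg_nonneg[OF C(1) weighted_norm_nonneg, of 1 "f (x + h)"] by (simp add: algebra_simps)
    finally show "increment R \<Gamma> f a x h \<le> (1 + C) * (\<Sum>b\<in>A. comp_norm R b (f (x + h)) + comp_norm R b (f x))"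
      by (simp add: weighted_norm_def sum.distrib)
  qed (use C in simp)
qed

end

text \<open>A modelled distribution \<open>f\<close> with Borel functions \<open>U\<close> and \<open>G\<close> that give the norms of its
  components and of its increments at all points satisfying \<open>P\<close>.\<close>

locale modelled_kernel = regularity_model s R PI \<Gamma> \<gamma>
  for s :: "'d::finite \<Rightarrow> nat" and R :: "'t::real_vector reg_structure"
    and PI :: "real^'d \<Rightarrow> 't \<Rightarrow> (real^'d \<Rightarrow> real) \<Rightarrow> real" and \<Gamma> and \<gamma> +
  fixes f :: "real^'d \<Rightarrow> 't" and P :: "real^'d \<Rightarrow> bool" and U :: "real \<Rightarrow> real^'d \<Rightarrow> ennreal"
    and G :: "real \<Rightarrow> (real^'d) \<times> (real^'d) \<Rightarrow> ennreal" and p :: ennreal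
  assumes f_T: "\<And>x. f x \<in> T"
    and AE_P: "AE x in lborel. P x"
    and U_measurable [measurable]: "\<And>a. a \<in> A \<Longrightarrow> U a \<in> borel_measurable borel"
    and G_measurable [measurable]: "\<And>a. a \<in> A \<Longrightarrow> G a \<in> borel_measurable (borel \<Otimes>\<^sub>M borel)"
    and U_eq: "\<And>a x. a \<in> A \<Longrightarrow> P x \<Longrightarrow> ennreal (comp_norm R a (f x)) = U a x"
    and G_eq: "\<And>a x h. a \<in> A \<Longrightarrow> P x \<Longrightarrow> P (x + h) \<Longrightarrow> ennreal (increment R \<Gamma> f a x h) = G a (x, h)"
    and p: "1 \<le> p"
begin

lemmas [measurable] = borel_measurable_scaled_norm[where s=s, OF s_pos] scaled_ball_borel[where s=s, OF s_pos]

lemma sigma_finite_lborel_vec: "sigma_finite_measure (lborel :: (real^'d) measure)"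
  by (rule sigma_finite_lborel)

lemma increment_nonneg: "a \<in> A \<Longrightarrow> 0 \<le> increment R \<Gamma> f a x h"
  unfolding increment_def by (intro comp_norm_nonneg A_index)

text \<open>The inverse power is a factor rather than a divisor because $1 / 0 = 0$ for real numbers, which is
  the value that the integrand in the norm of $\mathcal B^\gamma_{p,q}$ takes at $h = 0$.\<close>

definition increment_Lp :: "real \<Rightarrow> real^'d \<Rightarrow> ennreal" where
  "increment_Lp a h = L_norm lborel p (\<lambda>x. G a (x, h) * ennreal (1 / scaled_norm s h powr (\<gamma> - a)))"

definition average :: "real \<Rightarrow> real \<Rightarrow> real^'d \<Rightarrow> ennreal" where
  "average a l x = (\<integral>\<^sup>+h\<in>scaled_ball s 0 (4 * l). G a (x, h) * ennreal (1 / l powr (\<gamma> - a)) \<partial>lborel)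
     / emeasure lborel (scaled_ball s 0 (4 * l))"

definition average_Lp :: "real \<Rightarrow> real \<Rightarrow> ennreal" where
  "average_Lp a l = L_norm lborel p (average a l)"

lemma measurable_increment_Lp [measurable]:
  assumes [measurable]: "a \<in> A"
  shows "increment_Lp a \<in> borel_measurable borel"
proof -
  have "(\<lambda>h. L_norm lborel p (\<lambda>x. (\<lambda>(h, x). G a (x, h) * ennreal (1 / scaled_norm s h powr (\<gamma> - a))) (h, x)))
      \<in> borel_measurable borel"
    using sigma_finite_lborel_vec by (rule borel_measurable_L_norm) measurable
  then show ?thesis by (simp add: increment_Lp_def[abs_def])
qed

lemma measurable_average_pair:
  assumes [measurable]: "a \<in> A"
  shows "(\<lambda>(l, x). average a l x) \<in> borel_measurable (borel \<Otimes>\<^sub>M lborel)"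
proof -
  have ind: "indicator (scaled_ball s 0 (4 * l)) h = (if scaled_norm s h \<le> 4 * l then 1 else (0::ennreal))" for l h
    by (simp add: indicator_def scaled_ball_0_iff[where s=s, OF s_pos])
  have ball: "emeasure lborel (scaled_ball s 0 (4 * l)) = (\<integral>\<^sup>+h. (if scaled_norm s h \<le> 4 * l then 1 else (0::ennreal)) \<partial>lborel)" for l
    unfolding ind[symmetric] by simp
  show ?thesis
    unfolding average_def ball ind by measurable
qed

lemma measurable_average [measurable]: "a \<in> A \<Longrightarrow> average a l \<in> borel_measurable borel"
  using measurable_Pair2[OF measurable_average_pair, of a l] by simp

lemma measurable_average_Lp [measurable]: "a \<in> A \<Longrightarrow> average_Lp a \<in> borel_measurable borel"
  using borel_measurable_L_norm[OF sigma_finite_lborel_vec measurable_average_pair, of a p]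
  by (simp add: average_Lp_def[abs_def])

lemma AE_P_translate: "AE x in lborel. P (x + h)"
  using AE_P by (rule AE_lborel_translate)

lemma AE_P_translate': "AE h in lborel. P (x + h)"
  using AE_lborel_translate[OF AE_P, of x] by (simp add: add.commute)

lemma L_norm_component:
  assumes "a \<in> A"
  shows "L_norm lebesgue p (\<lambda>x. ennreal (comp_norm R a (f x))) = L_norm lborel p (U a)"
  using AE_P by (intro L_norm_completion_AE p) (use assms U_eq in \<open>auto elim: eventually_mono\<close>)

lemma L_norm_increments:
  assumes a: "a \<in> A"
  shows "L_norm (increment_measure s) q (\<lambda>h. L_norm lebesgue p (\<lambda>x.
      ennreal (increment R \<Gamma> f a x h / scaled_norm s h powr (\<gamma> - a)))) = L_norm (increment_lborel s) q (increment_Lp a)"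
proof -
  have "L_norm lebesgue p (\<lambda>x. ennreal (increment R \<Gamma> f a x h / scaled_norm s h powr (\<gamma> - a))) = increment_Lp a h" for h
    unfolding increment_Lp_def
  proof (rule L_norm_completion_AE[OF p])
    show "(\<lambda>x. G a (x, h) * ennreal (1 / scaled_norm s h powr (\<gamma> - a))) \<in> borel_measurable lborel"
      using a by measurable
    show "AE x in lborel. ennreal (increment R \<Gamma> f a x h / scaled_norm s h powr (\<gamma> - a)) =
        G a (x, h) * ennreal (1 / scaled_norm s h powr (\<gamma> - a))"
      using AE_P AE_P_translate[of h]
      by eventually_elim (use a in \<open>simp add: G_eq[symmetric] increment_nonneg flip: ennreal_mult\<close>)
  qed
  then show ?thesis
    unfolding increment_measure_def increment_lborel_def
    using a by (simp add: L_norm_density_completion)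
qed

lemma L_norm_averages:
  assumes a: "a \<in> A"
  shows "L_norm scale_measure q (\<lambda>l. L_norm lebesgue p (\<lambda>x.
        (\<integral>\<^sup>+h\<in>scaled_ball s 0 (4 * l). ennreal (increment R \<Gamma> f a x h / l powr (\<gamma> - a)) \<partial>lebesgue)
          / emeasure lebesgue (scaled_ball s 0 (4 * l)))) = L_norm scale_lborel q (average_Lp a)"
proof -
  have "L_norm lebesgue p (\<lambda>x.
        (\<integral>\<^sup>+h\<in>scaled_ball s 0 (4 * l). ennreal (increment R \<Gamma> f a x h / l powr (\<gamma> - a)) \<partial>lebesgue)
          / emeasure lebesgue (scaled_ball s 0 (4 * l))) = average_Lp a l" for l
    unfolding average_Lp_def
  proof (rule L_norm_completion_AE[OF p])
    show "average a l \<in> borel_measurable lborel" using a by simp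
    show "AE x in lborel. (\<integral>\<^sup>+h\<in>scaled_ball s 0 (4 * l). ennreal (increment R \<Gamma> f a x h / l powr (\<gamma> - a)) \<partial>lebesgue)
          / emeasure lebesgue (scaled_ball s 0 (4 * l)) = average a l x"
      using AE_P
    proof eventually_elim
      case (elim x)
      have "(\<integral>\<^sup>+h\<in>scaled_ball s 0 (4 * l). ennreal (increment R \<Gamma> f a x h / l powr (\<gamma> - a)) \<partial>lborel) =
          (\<integral>\<^sup>+h\<in>scaled_ball s 0 (4 * l). G a (x, h) * ennreal (1 / l powr (\<gamma> - a)) \<partial>lborel)"
      proof (intro nn_integral_cong_AE, use AE_P_translate'[of x] in eventually_elim)
        case (elim h)
        then show ?case
          using \<open>P x\<close> a by (simp add: G_eq[symmetric] increment_nonneg flip: ennreal_mult)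
      qed
      then show ?case by (simp add: average_def nn_integral_completion)
    qed
  qed
  then show ?thesis
    unfolding scale_measure_def scale_lborel_def
    using a by (simp add: L_norm_density_completion)
qed

text \<open>The pointwise bound of an increment by the increments to a third point is averaged over the
  positions $x + k$ of that point with $\|k\| \le \lambda$. Then $k$ and $k - h$ both lie in
  $Q(0, 4 \lambda)$, and the volume of that ball exceeds that of $Q(0, \lambda)$ by the factor
  $4^{|\mathfrak s|}$. The two averages, at $x$ and at $x + h$, have the same $L^p$-norm.\<close>

lemma increment_Lp_le_average_Lp:
  assumes C: "0 \<le> C" "\<And>a x h k l. a \<in> A \<Longrightarrow> 0 < l \<Longrightarrow> l \<le> 1 \<Longrightarrow>
    scaled_norm s h \<le> 2 * l \<Longrightarrow> scaled_norm s k \<le> l \<Longrightarrow>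
    increment R \<Gamma> f a x h \<le> C * l powr (- a) *
      (\<Sum>b\<in>A. l powr b * (increment R \<Gamma> f b x k + increment R \<Gamma> f b (x + h) (k - h)))"
    and a: "a \<in> A" and h: "h \<noteq> 0" "scaled_norm s h \<le> 1"
    and l: "scaled_norm s h / 2 \<le> l" "l \<le> scaled_norm s h"
  shows "increment_Lp a h \<le> ennreal (2 * C * 4 ^ scaling_size s) * (\<Sum>b\<in>A. average_Lp b l)"
proof -
  have l0: "0 < l" "l \<le> 1"
    using l h scaled_norm_pos[where s=s, OF s_pos h(1)] by linarith+
  define m where "m r = 2 ^ CARD('d) * r ^ scaling_size s" for r :: real
  have m: "0 < m l" "m (4 * l) = 4 ^ scaling_size s * m l"
    using l0 by (simp_all add: m_def power_mult_distrib)
  have vol: "emeasure lborel (scaled_ball s 0 r) = ennreal (m r)" if "0 \<le> r" for r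
    using that emeasure_scaled_ball[where s=s, OF s_pos] by (simp add: m_def)
  define I where "I b x = (\<integral>\<^sup>+k\<in>scaled_ball s 0 (4 * l). G b (x, k) \<partial>lborel)" for b x
  have average_eq: "average b l x = I b x * ennreal (1 / l powr (\<gamma> - b)) * ennreal (1 / m (4 * l))"
    if "b \<in> A" for b x
  proof -
    have "(\<integral>\<^sup>+k\<in>scaled_ball s 0 (4 * l). G b (x, k) * ennreal (1 / l powr (\<gamma> - b)) \<partial>lborel) =
        I b x * ennreal (1 / l powr (\<gamma> - b))"
      unfolding I_def using that by (subst nn_integral_multc[symmetric]) (auto simp: ac_simps)
    then show ?thesis
      using l0 m by (simp add: average_def vol divide_ennreal_def inverse_ennreal inverse_eq_divide)
  qed
  have pointwise: "G a (x, h) * ennreal (1 / scaled_norm s h powr (\<gamma> - a)) \<le>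
      ennreal (C * 4 ^ scaling_size s) * (\<Sum>b\<in>A. average b l x + average b l (x + h))"
    if x: "P x" "P (x + h)" for x
  proof -
    let ?Q = "scaled_ball s 0 l"
    have "ennreal (m l) * G a (x, h) = (\<integral>\<^sup>+k\<in>?Q. G a (x, h) \<partial>lborel)"
      using l0 by (simp add: nn_integral_cmult vol mult.commute)
    also have "\<dots> \<le> (\<integral>\<^sup>+k\<in>?Q. ennreal (C * l powr (- a)) *
        (\<Sum>b\<in>A. ennreal (l powr b) * (G b (x, k) + G b (x + h, k - h))) \<partial>lborel)"
    proof (intro nn_integral_mono_AE, use AE_P_translate'[of x] in eventually_elim)
      case (elim k)
      show ?case
      proof (cases "k \<in> ?Q")
        case True
        have G: "G b (x, k) = ennreal (increment R \<Gamma> f b x k)"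
            "G b (x + h, k - h) = ennreal (increment R \<Gamma> f b (x + h) (k - h))" if "b \<in> A" for b
          using x elim that by (simp_all add: G_eq)
        have "G a (x, h) \<le> ennreal (C * l powr (- a) *
            (\<Sum>b\<in>A. l powr b * (increment R \<Gamma> f b x k + increment R \<Gamma> f b (x + h) (k - h))))"
          unfolding G_eq[OF a x, symmetric]
          using True l h l0 by (intro ennreal_leI C a) (auto simp: scaled_ball_0_iff[where s=s, OF s_pos])
        also have "\<dots> = ennreal (C * l powr (- a)) *
            ennreal (\<Sum>b\<in>A. l powr b * (increment R \<Gamma> f b x k + increment R \<Gamma> f b (x + h) (k - h)))"
          using C by (intro ennreal_mult sum_nonneg mult_nonneg_nonneg add_nonneg_nonneg increment_nonneg) auto
        also have "ennreal (\<Sum>b\<in>A. l powr b * (increment R \<Gamma> f b x k + increment R \<Gamma> f b (x + h) (k - h))) =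
            (\<Sum>b\<in>A. ennreal (l powr b * (increment R \<Gamma> f b x k + increment R \<Gamma> f b (x + h) (k - h))))"
          by (intro sum_ennreal[symmetric] mult_nonneg_nonneg add_nonneg_nonneg increment_nonneg) auto
        also have "\<dots> = (\<Sum>b\<in>A. ennreal (l powr b) * (G b (x, k) + G b (x + h, k - h)))"
          by (intro sum.cong refl) (simp add: G ennreal_mult increment_nonneg)
        finally show ?thesis using True by simp
      qed simp
    qed
    also have "\<dots> = ennreal (C * l powr (- a)) *
        (\<Sum>b\<in>A. ennreal (l powr b) * ((\<integral>\<^sup>+k\<in>?Q. G b (x, k) \<partial>lborel) + (\<integral>\<^sup>+k\<in>?Q. G b (x + h, k - h) \<partial>lborel)))"
    proof -
      have "(\<integral>\<^sup>+k\<in>?Q. ennreal (C * l powr (- a)) *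
          (\<Sum>b\<in>A. ennreal (l powr b) * (G b (x, k) + G b (x + h, k - h))) \<partial>lborel) =
        (\<integral>\<^sup>+k. ennreal (C * l powr (- a)) *
          (\<Sum>b\<in>A. ennreal (l powr b) * (G b (x, k) * indicator ?Q k + G b (x + h, k - h) * indicator ?Q k)) \<partial>lborel)"
        by (intro nn_integral_cong) (simp add: indicator_def)
      also have "\<dots> = ennreal (C * l powr (- a)) *
        (\<Sum>b\<in>A. ennreal (l powr b) * ((\<integral>\<^sup>+k\<in>?Q. G b (x, k) \<partial>lborel) + (\<integral>\<^sup>+k\<in>?Q. G b (x + h, k - h) \<partial>lborel)))"
        by (simp add: nn_integral_cmult nn_integral_sum nn_integral_add)
      finally show ?thesis .
    qed
    also have "\<dots> \<le> ennreal (C * l powr (- a)) * (\<Sum>b\<in>A. ennreal (l powr b) * (I b x + I b (x + h)))"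
    proof (intro mult_left_mono sum_mono add_mono)
      fix b assume b [measurable]: "b \<in> A"
      show "(\<integral>\<^sup>+k\<in>?Q. G b (x, k) \<partial>lborel) \<le> I b x"
        unfolding I_def using l0
        by (intro nn_integral_mono mult_left_mono) (auto simp: indicator_def scaled_ball_0_iff[where s=s, OF s_pos])
      have "(\<integral>\<^sup>+k\<in>?Q. G b (x + h, k - h) \<partial>lborel) \<le>
          (\<integral>\<^sup>+k. G b (x + h, k - h) * indicator (scaled_ball s 0 (4 * l)) (k - h) \<partial>lborel)"
      proof (intro nn_integral_mono mult_left_mono)
        fix k
        have "scaled_norm s (k - h) \<le> scaled_norm s k + scaled_norm s h"
          using scaled_norm_triangle[where s=s, OF s_pos, where x=k and y="- h"] by (simp add: s_pos)
        then show "indicator ?Q k \<le> (indicator (scaled_ball s 0 (4 * l)) (k - h) :: ennreal)"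
          using l l0 by (auto simp: indicator_def scaled_ball_0_iff[where s=s, OF s_pos])
      qed simp
      also have "\<dots> = (\<integral>\<^sup>+k. G b (x + h, k) * indicator (scaled_ball s 0 (4 * l)) k \<partial>distr lborel borel ((+) (- h)))"
        by (subst nn_integral_distr) auto
      also have "\<dots> = I b (x + h)"
        by (simp add: I_def lborel_distr_plus del: minus_add_distrib)
      finally show "(\<integral>\<^sup>+k\<in>?Q. G b (x + h, k - h) \<partial>lborel) \<le> I b (x + h)" .
    qed auto
    finally have mG: "ennreal (m l) * G a (x, h) \<le>
      ennreal (C * l powr (- a)) * (\<Sum>b\<in>A. ennreal (l powr b) * (I b x + I b (x + h)))" .
    have "1 / scaled_norm s h powr (\<gamma> - a) \<le> l powr (a - \<gamma>)"
    proof -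
      have "1 / scaled_norm s h powr (\<gamma> - a) \<le> 1 / l powr (\<gamma> - a)"
        using l l0 A_less[OF a] by (intro divide_left_mono powr_mono2 mult_pos_pos) auto
      then show ?thesis by (simp add: powr_diff powr_minus field_simps)
    qed
    then have "G a (x, h) * ennreal (1 / scaled_norm s h powr (\<gamma> - a)) \<le>
        ennreal (1 / m l) * ennreal (m l) * G a (x, h) * ennreal (l powr (a - \<gamma>))"
      using m by (simp add: mult_left_mono ennreal_leI flip: ennreal_mult)
    also have "\<dots> \<le> ennreal (1 / m l) * (ennreal (C * l powr (- a)) * (\<Sum>b\<in>A. ennreal (l powr b) * (I b x + I b (x + h))))
        * ennreal (l powr (a - \<gamma>))"
      unfolding mult.assoc[of "ennreal (1 / m l)"] by (intro mult_right_mono mult_left_mono mG) auto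
    also have "\<dots> = (\<Sum>b\<in>A. (ennreal (1 / m l) * ennreal (C * l powr (- a)) * ennreal (l powr (a - \<gamma>)) * ennreal (l powr b)) * (I b x + I b (x + h)))"
      by (simp add: sum_distrib_left sum_distrib_right ac_simps)
    also have "\<dots> = (\<Sum>b\<in>A. ennreal (C * 4 ^ scaling_size s) * (average b l x + average b l (x + h)))"
    proof (intro sum.cong refl)
      fix b assume b: "b \<in> A"
      have "1 / m l * (C * l powr (- a)) * l powr (a - \<gamma>) * l powr b =
          C * 4 ^ scaling_size s * (1 / l powr (\<gamma> - b) * (1 / m (4 * l)))"
        using l0 m by (simp add: powr_diff powr_minus field_simps)
      then have "ennreal (1 / m l) * ennreal (C * l powr (- a)) * ennreal (l powr (a - \<gamma>)) * ennreal (l powr b) =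
          ennreal (C * 4 ^ scaling_size s) * (ennreal (1 / l powr (\<gamma> - b)) * ennreal (1 / m (4 * l)))"
        using m C l0 by (simp flip: ennreal_mult)
      then show "(ennreal (1 / m l) * ennreal (C * l powr (- a)) * ennreal (l powr (a - \<gamma>)) * ennreal (l powr b)) * (I b x + I b (x + h)) =
        ennreal (C * 4 ^ scaling_size s) * (average b l x + average b l (x + h))"
        by (simp add: average_eq[OF b] distrib_left distrib_right ac_simps)
    qed
    finally show ?thesis by (simp add: sum_distrib_left)
  qed
  have "increment_Lp a h \<le> L_norm lborel p (\<lambda>x. ennreal (C * 4 ^ scaling_size s) * (\<Sum>b\<in>A. average b l x + average b l (x + h)))"
    unfolding increment_Lp_def
  proof (rule L_norm_mono_AE[OF p])
    show "(\<lambda>x. G a (x, h) * ennreal (1 / scaled_norm s h powr (\<gamma> - a))) \<in> borel_measurable lborel"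
      using a by measurable
    show "AE x in lborel. G a (x, h) * ennreal (1 / scaled_norm s h powr (\<gamma> - a)) \<le>
      ennreal (C * 4 ^ scaling_size s) * (\<Sum>b\<in>A. average b l x + average b l (x + h))"
      using AE_P AE_P_translate[of h] by eventually_elim (rule pointwise)
  qed
  also have "\<dots> \<le> ennreal (C * 4 ^ scaling_size s) * L_norm lborel p (\<lambda>x. \<Sum>b\<in>A. average b l x + average b l (x + h))"
    by (intro L_norm_cmult_le p) measurable
  also have "\<dots> \<le> ennreal (C * 4 ^ scaling_size s) * (\<Sum>b\<in>A. L_norm lborel p (\<lambda>x. average b l x + average b l (x + h)))"
    by (intro mult_left_mono L_norm_sum_le sigma_finite_lborel finite_A p) auto
  also have "\<dots> \<le> ennreal (C * 4 ^ scaling_size s) * (\<Sum>b\<in>A. average_Lp b l + average_Lp b l)"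
  proof (intro mult_left_mono sum_mono)
    fix b assume b [measurable]: "b \<in> A"
    have "L_norm lborel p (\<lambda>x. average b l x + average b l (x + h)) \<le>
        L_norm lborel p (average b l) + L_norm lborel p (\<lambda>x. average b l (x + h))"
      by (intro L_norm_add_le sigma_finite_lborel p) auto
    then show "L_norm lborel p (\<lambda>x. average b l x + average b l (x + h)) \<le> average_Lp b l + average_Lp b l"
      using L_norm_translation[OF measurable_average[OF b]] by (simp add: average_Lp_def)
  qed simp
  also have "\<dots> = ennreal (2 * C * 4 ^ scaling_size s) * (\<Sum>b\<in>A. average_Lp b l)"
  proof -
    have "(\<Sum>b\<in>A. average_Lp b l + average_Lp b l) = 2 * (\<Sum>b\<in>A. average_Lp b l)"
      by (simp add: sum_distrib_left mult_2)
    moreover have "ennreal (2 * C * 4 ^ scaling_size s) = 2 * ennreal (C * 4 ^ scaling_size s)"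
      using C ennreal_mult[of 2 "C * 4 ^ scaling_size s"] by (simp add: mult.assoc)
    ultimately show ?thesis by (simp only: mult_ac)
  qed
  finally show ?thesis .
qed

text \<open>Minkowski's inequality, with $\psi$ any bound of the $L^p$-norms under the integral.\<close>

lemma average_Lp_le_average:
  assumes a [measurable]: "a \<in> A" and l: "0 < l"
    and \<psi> [measurable]: "\<psi> \<in> borel_measurable borel"
    and le: "\<And>h. h \<noteq> 0 \<Longrightarrow> scaled_norm s h \<le> 4 * l \<Longrightarrow>
      L_norm lborel p (\<lambda>x. G a (x, h) * ennreal (1 / l powr (\<gamma> - a))) \<le> \<psi> h"
  shows "average_Lp a l \<le> (\<integral>\<^sup>+h\<in>scaled_ball s 0 (4 * l). \<psi> h \<partial>lborel) / emeasure lborel (scaled_ball s 0 (4 * l))"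
proof -
  let ?Q = "scaled_ball s 0 (4 * l)" and ?c = "ennreal (1 / l powr (\<gamma> - a))"
  define F where "F z = G a z * ?c * indicator ?Q (snd z)" for z
  have F [measurable]: "F \<in> borel_measurable (lborel \<Otimes>\<^sub>M lborel)"
    unfolding F_def by measurable
  have "average_Lp a l = L_norm lborel p (\<lambda>x. inverse (emeasure lborel ?Q) * (\<integral>\<^sup>+h. F (x, h) \<partial>lborel))"
    by (simp add: average_Lp_def average_def[abs_def] F_def divide_ennreal_def mult.commute)
  also have "\<dots> \<le> inverse (emeasure lborel ?Q) * L_norm lborel p (\<lambda>x. \<integral>\<^sup>+h. F (x, h) \<partial>lborel)"
    by (intro L_norm_cmult_le p) measurable
  also have "\<dots> \<le> inverse (emeasure lborel ?Q) * (\<integral>\<^sup>+h. L_norm lborel p (\<lambda>x. F (x, h)) \<partial>lborel)"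
    by (intro mult_left_mono L_norm_nn_integral_le sigma_finite_lborel F p) simp
  also have "\<dots> \<le> inverse (emeasure lborel ?Q) * (\<integral>\<^sup>+h\<in>?Q. \<psi> h \<partial>lborel)"
  proof (intro mult_left_mono nn_integral_mono_AE, use AE_lborel_singleton[of "0::real^'d"] in eventually_elim)
    case (elim h)
    show ?case
    proof (cases "h \<in> ?Q")
      case True
      then show ?thesis using le[of h] elim by (simp add: F_def scaled_ball_0_iff[where s=s, OF s_pos])
    next
      case False
      have "L_norm lborel p (\<lambda>x::real^'d. 0 * 0) \<le> 0 * L_norm lborel p (\<lambda>x::real^'d. 0)"
        by (intro L_norm_cmult_le p) simp
      then show ?thesis using False by (simp add: F_def)
    qed
  qed simp
  finally show ?thesis by (simp add: divide_ennreal_def mult.commute)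
qed

text \<open>On $Q(0, 4 \lambda)$ the weight $\lambda^{\zeta - \gamma}$ is at most $4^{\gamma - \zeta}$ times
  $\|h\|^{\zeta - \gamma}$, since $\zeta < \gamma$.\<close>

lemma average_Lp_le_average_increment_Lp:
  assumes a [measurable]: "a \<in> A" and l: "0 < l"
  shows "average_Lp a l \<le> (\<integral>\<^sup>+h\<in>scaled_ball s 0 (4 * l). ennreal (4 powr (\<gamma> - a)) * increment_Lp a h \<partial>lborel)
    / emeasure lborel (scaled_ball s 0 (4 * l))"
proof (rule average_Lp_le_average[OF a l])
  fix h :: "real^'d" assume h: "h \<noteq> 0" "scaled_norm s h \<le> 4 * l"
  let ?r = "scaled_norm s h"
  have r: "0 < ?r" using scaled_norm_pos[where s=s, OF s_pos h(1)] .
  have "?r powr (\<gamma> - a) \<le> (4 * l) powr (\<gamma> - a)"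
    using h A_less[OF a] r by (intro powr_mono2) auto
  then have "1 / l powr (\<gamma> - a) \<le> 4 powr (\<gamma> - a) * (1 / ?r powr (\<gamma> - a))"
    using l r by (simp add: powr_mult field_simps)
  then have le: "ennreal (1 / l powr (\<gamma> - a)) \<le> ennreal (4 powr (\<gamma> - a)) * ennreal (1 / ?r powr (\<gamma> - a))"
    by (subst ennreal_mult[symmetric]) (auto intro: ennreal_leI)
  have "L_norm lborel p (\<lambda>x. G a (x, h) * ennreal (1 / l powr (\<gamma> - a))) \<le>
      L_norm lborel p (\<lambda>x. ennreal (4 powr (\<gamma> - a)) * (G a (x, h) * ennreal (1 / ?r powr (\<gamma> - a))))"
  proof (intro L_norm_mono_AE p AE_I2)
    fix x
    show "G a (x, h) * ennreal (1 / l powr (\<gamma> - a)) \<le> ennreal (4 powr (\<gamma> - a)) * (G a (x, h) * ennreal (1 / ?r powr (\<gamma> - a)))"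
      using mult_left_mono[OF le, of "G a (x, h)"] by (simp add: mult_ac)
  qed measurable
  also have "\<dots> \<le> ennreal (4 powr (\<gamma> - a)) * increment_Lp a h"
    unfolding increment_Lp_def by (intro L_norm_cmult_le p) measurable
  finally show "L_norm lborel p (\<lambda>x. G a (x, h) * ennreal (1 / l powr (\<gamma> - a))) \<le> ennreal (4 powr (\<gamma> - a)) * increment_Lp a h" .
qed measurable

text \<open>For $\lambda$ of order 1 the weight $\lambda^{\zeta - \gamma}$ is bounded, and so are the increments in
  terms of the values at $x$ and $x + h$, whose $L^p$-norms agree by translation invariance.\<close>

lemma average_Lp_le_values:
  assumes C: "0 \<le> C" "\<And>a x h. a \<in> A \<Longrightarrow> scaled_norm s h \<le> 4 \<Longrightarrow>
    increment R \<Gamma> f a x h \<le> C * (\<Sum>b\<in>A. comp_norm R b (f (x + h)) + comp_norm R b (f x))"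
    and a [measurable]: "a \<in> A" and l: "1 / 4 < l" "l \<le> 1"
  shows "average_Lp a l \<le> ennreal (2 * C * 4 powr (\<gamma> - a)) * (\<Sum>b\<in>A. L_norm lborel p (U b))"
proof -
  let ?K = "ennreal (2 * C * 4 powr (\<gamma> - a)) * (\<Sum>b\<in>A. L_norm lborel p (U b))"
  have c: "1 / l powr (\<gamma> - a) \<le> 4 powr (\<gamma> - a)"
  proof -
    have "(1 / l) powr (\<gamma> - a) \<le> 4 powr (\<gamma> - a)"
      using l A_less[OF a] by (intro powr_mono2) (auto simp: field_simps)
    then show ?thesis using l by (simp add: powr_divide)
  qed
  have "average_Lp a l \<le> (\<integral>\<^sup>+h\<in>scaled_ball s 0 (4 * l). ?K \<partial>lborel) / emeasure lborel (scaled_ball s 0 (4 * l))"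
  proof (rule average_Lp_le_average[OF a])
    fix h :: "real^'d" assume "scaled_norm s h \<le> 4 * l"
    then have h: "scaled_norm s h \<le> 4" using l by simp
    have "L_norm lborel p (\<lambda>x. G a (x, h) * ennreal (1 / l powr (\<gamma> - a))) \<le>
        L_norm lborel p (\<lambda>x. ennreal (C * 4 powr (\<gamma> - a)) * (\<Sum>b\<in>A. U b (x + h) + U b x))"
    proof (intro L_norm_mono_AE p, measurable, use AE_P AE_P_translate[of h] in eventually_elim)
      case (elim x)
      have nonneg: "0 \<le> (\<Sum>b\<in>A. comp_norm R b (f (x + h)) + comp_norm R b (f x))"
        by (intro sum_nonneg add_nonneg_nonneg comp_norm_nonneg A_index)
      have "G a (x, h) * ennreal (1 / l powr (\<gamma> - a)) =
          ennreal (increment R \<Gamma> f a x h * (1 / l powr (\<gamma> - a)))"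
        unfolding G_eq[OF a elim, symmetric]
        using increment_nonneg[OF a] by (intro ennreal_mult[symmetric]) auto
      also have "\<dots> \<le> ennreal (C * (\<Sum>b\<in>A. comp_norm R b (f (x + h)) + comp_norm R b (f x)) * 4 powr (\<gamma> - a))"
        using C nonneg c by (intro ennreal_leI mult_mono C(2) a h mult_nonneg_nonneg) auto
      also have "\<dots> = ennreal (C * 4 powr (\<gamma> - a)) * ennreal (\<Sum>b\<in>A. comp_norm R b (f (x + h)) + comp_norm R b (f x))"
        using C nonneg by (subst ennreal_mult[symmetric]) (auto simp: mult_ac)
      also have "ennreal (\<Sum>b\<in>A. comp_norm R b (f (x + h)) + comp_norm R b (f x)) =
          (\<Sum>b\<in>A. ennreal (comp_norm R b (f (x + h)) + comp_norm R b (f x)))"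
        by (intro sum_ennreal[symmetric] add_nonneg_nonneg comp_norm_nonneg A_index)
      also have "\<dots> = (\<Sum>b\<in>A. U b (x + h) + U b x)"
        using elim by (intro sum.cong refl) (simp add: U_eq[symmetric] comp_norm_nonneg[OF A_index])
      finally show ?case .
    qed
    also have "\<dots> \<le> ennreal (C * 4 powr (\<gamma> - a)) * L_norm lborel p (\<lambda>x. \<Sum>b\<in>A. U b (x + h) + U b x)"
      by (intro L_norm_cmult_le p) measurable
    also have "\<dots> \<le> ennreal (C * 4 powr (\<gamma> - a)) * (\<Sum>b\<in>A. L_norm lborel p (\<lambda>x. U b (x + h) + U b x))"
      by (intro mult_left_mono L_norm_sum_le sigma_finite_lborel finite_A p) auto
    also have "\<dots> \<le> ennreal (C * 4 powr (\<gamma> - a)) * (\<Sum>b\<in>A. 2 * L_norm lborel p (U b))"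
    proof (intro mult_left_mono sum_mono)
      fix b assume b [measurable]: "b \<in> A"
      have "L_norm lborel p (\<lambda>x. U b (x + h) + U b x) \<le> L_norm lborel p (\<lambda>x. U b (x + h)) + L_norm lborel p (U b)"
        by (intro L_norm_add_le sigma_finite_lborel p) auto
      then show "L_norm lborel p (\<lambda>x. U b (x + h) + U b x) \<le> 2 * L_norm lborel p (U b)"
        using L_norm_translation[OF U_measurable[OF b]] by (simp add: mult_2)
    qed simp
    also have "\<dots> = ?K"
    proof -
      have "ennreal (2 * C * 4 powr (\<gamma> - a)) = 2 * ennreal (C * 4 powr (\<gamma> - a))"
        using C ennreal_mult[of 2 "C * 4 powr (\<gamma> - a)"] by (simp add: mult.assoc)
      then show ?thesis by (simp only: sum_distrib_left[symmetric] mult_ac)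
    qed
    finally show "L_norm lborel p (\<lambda>x. G a (x, h) * ennreal (1 / l powr (\<gamma> - a))) \<le> ?K" .
  qed (use l in auto)
  also have "\<dots> = ?K * emeasure lborel (scaled_ball s 0 (4 * l)) / emeasure lborel (scaled_ball s 0 (4 * l))"
    by (simp add: nn_integral_cmult)
  also have "\<dots> = ?K"
    using l emeasure_scaled_ball[where s=s, OF s_pos] by (intro ennreal_mult_divide_eq) auto
  finally show ?thesis .
qed

end

context regularity_model
begin

lemma modelled_kernelE:
  assumes f: "modelled_function R \<gamma> f" and p: "1 \<le> p"
  obtains P U G where "modelled_kernel s R PI \<Gamma> \<gamma> f P U G p"
proof -
  obtain P U G where
    "AE x in lborel. P x"
    "\<And>a. a \<in> A \<Longrightarrow> U a \<in> borel_measurable borel"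
    "\<And>a. a \<in> A \<Longrightarrow> G a \<in> borel_measurable (borel \<Otimes>\<^sub>M borel)"
    "\<And>a x. a \<in> A \<Longrightarrow> P x \<Longrightarrow> ennreal (comp_norm R a (f x)) = U a x"
    "\<And>a x h. a \<in> A \<Longrightarrow> P x \<Longrightarrow> P (x + h) \<Longrightarrow> ennreal (increment R \<Gamma> f a x h) = G a (x, h)"
    by (rule modelled_Borel_version[OF f]) blast
  then have "modelled_kernel s R PI \<Gamma> \<gamma> f P U G p"
    using p modelled_mem_T[OF f] by unfold_locales auto
  then show ?thesis by (rule that)
qed

text \<open>The constant must not depend on $f$, so it is fixed before the Borel versions are chosen.\<close>

lemma B_norm_le_D_norm:
  assumes p: "1 \<le> p" and q: "1 \<le> q"
  obtains C where "0 < C" "\<And>f. modelled_function R \<gamma> f \<Longrightarrow>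
    B_norm s R \<Gamma> \<gamma> p q f \<le> ennreal C * D_norm s R \<Gamma> \<gamma> p q f"
proof -
  obtain C0 where C0: "0 \<le> C0" "\<And>f a x h k l. (\<And>x. f x \<in> T) \<Longrightarrow> a \<in> A \<Longrightarrow> 0 < l \<Longrightarrow> l \<le> 1 \<Longrightarrow>
    scaled_norm s h \<le> 2 * l \<Longrightarrow> scaled_norm s k \<le> l \<Longrightarrow>
    increment R \<Gamma> f a x h \<le> C0 * l powr (- a) *
      (\<Sum>b\<in>A. l powr b * (increment R \<Gamma> f b x k + increment R \<Gamma> f b (x + h) (k - h)))"
    by (rule increment_le_increments) blast
  define C1 where "C1 = 2 * C0 * 4 ^ scaling_size s"
  define C2 :: real where "C2 = 2 ^ (CARD('d) + scaling_size s + 1)"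
  define C where "C = 1 + C2 * C1 * card A"
  have C12: "0 \<le> C1" "0 \<le> C2" using C0 by (simp_all add: C1_def C2_def)
  show ?thesis
  proof (rule that[of C])
    show "0 < C" using C12 by (auto simp: C_def intro!: add_pos_nonneg)
    fix f :: "real^'d \<Rightarrow> 't" assume f: "modelled_function R \<gamma> f"
    obtain P U G where "modelled_kernel s R PI \<Gamma> \<gamma> f P U G p"
      by (rule modelled_kernelE[OF f p])
    then interpret modelled_kernel s R PI \<Gamma> \<gamma> f P U G p .
    define X where "X = (SUP a\<in>A. L_norm lebesgue p (\<lambda>x. ennreal (comp_norm R a (f x))))"
    define Y where "Y = (SUP a\<in>A. L_norm scale_lborel q (average_Lp a))"
    have D: "D_norm s R \<Gamma> \<gamma> p q f = X + Y"
      unfolding D_norm_def X_def Y_def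
      by (intro arg_cong2[where f="(+)"] SUP_cong refl L_norm_averages)
    have B: "B_norm s R \<Gamma> \<gamma> p q f = X + (SUP a\<in>A. L_norm (increment_lborel s) q (increment_Lp a))"
      unfolding B_norm_def X_def
      by (intro arg_cong2[where f="(+)"] SUP_cong refl L_norm_increments)
    have "L_norm (increment_lborel s) q (increment_Lp a) \<le> ennreal (C2 * C1 * card A) * Y" if a: "a \<in> A" for a
    proof -
      have "L_norm (increment_lborel s) q (increment_Lp a) \<le> ennreal C2 * L_norm scale_lborel q (\<lambda>l. ennreal C1 * (\<Sum>b\<in>A. average_Lp b l))"
        unfolding C1_def C2_def
        by (intro L_norm_increment_le_scale[where s=s, OF s_pos] q increment_Lp_le_average_Lp[OF C0(1) C0(2)[OF f_T]] measurable_increment_Lp a) auto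
      also have "\<dots> \<le> ennreal C2 * (ennreal C1 * L_norm scale_lborel q (\<lambda>l. \<Sum>b\<in>A. average_Lp b l))"
        by (intro mult_left_mono L_norm_cmult_le q) auto
      also have "\<dots> \<le> ennreal C2 * (ennreal C1 * (\<Sum>b\<in>A. L_norm scale_lborel q (average_Lp b)))"
        by (intro mult_left_mono L_norm_sum_le sigma_finite_scale_lborel finite_A q) auto
      also have "\<dots> \<le> ennreal C2 * (ennreal C1 * (of_nat (card A) * Y))"
        unfolding Y_def by (intro mult_left_mono sum_le_card_SUP) auto
      also have "\<dots> = ennreal (C2 * C1 * card A) * Y"
        using C12 by (simp add: ennreal_mult ennreal_of_nat_eq_real_of_nat mult.assoc)
      finally show ?thesis .
    qed
    then have "B_norm s R \<Gamma> \<gamma> p q f \<le> X + ennreal (C2 * C1 * card A) * Y"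
      unfolding B by (intro add_left_mono SUP_least)
    also have "\<dots> \<le> ennreal C * X + ennreal C * Y"
    proof (intro add_mono mult_right_mono ennreal_leI)
      have "1 \<le> C" using C12 by (simp add: C_def)
      then show "X \<le> ennreal C * X"
        using mult_right_mono[of 1 "ennreal C" X] ennreal_leI[of 1 C] by simp
    qed (auto simp: C_def)
    finally show "B_norm s R \<Gamma> \<gamma> p q f \<le> ennreal C * D_norm s R \<Gamma> \<gamma> p q f"
      by (simp add: D distrib_left)
  qed
qed

lemma D_norm_le_B_norm:
  assumes p: "1 \<le> p" and q: "1 \<le> q"
  obtains C where "0 < C" "\<And>f. modelled_function R \<gamma> f \<Longrightarrow>
    D_norm s R \<Gamma> \<gamma> p q f \<le> ennreal C * B_norm s R \<Gamma> \<gamma> p q f"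
proof -
  obtain C0 where C0: "0 \<le> C0" "\<And>f a x h. (\<And>x. f x \<in> T) \<Longrightarrow> a \<in> A \<Longrightarrow> scaled_norm s h \<le> 4 \<Longrightarrow>
    increment R \<Gamma> f a x h \<le> C0 * (\<Sum>b\<in>A. comp_norm R b (f (x + h)) + comp_norm R b (f x))"
    by (rule increment_le_values) blast
  define E where "E = (\<Sum>a\<in>A. 4 powr (\<gamma> - a))"
  have E: "4 powr (\<gamma> - a) \<le> E" if "a \<in> A" for a
    unfolding E_def using that finite_A by (intro member_le_sum) auto
  have E0: "0 \<le> E" unfolding E_def by (intro sum_nonneg) auto
  define C where "C = 1 + 5 * (2 * C0 * E * card A) + 5 * E"
  show ?thesis
  proof (rule that[of C])
    show "0 < C" using C0 E0 by (auto simp: C_def intro!: add_pos_nonneg)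
    fix f :: "real^'d \<Rightarrow> 't" assume f: "modelled_function R \<gamma> f"
    obtain P U G where "modelled_kernel s R PI \<Gamma> \<gamma> f P U G p"
      by (rule modelled_kernelE[OF f p])
    then interpret modelled_kernel s R PI \<Gamma> \<gamma> f P U G p .
    define X where "X = (SUP a\<in>A. L_norm lborel p (U a))"
    define Y where "Y = (SUP a\<in>A. L_norm (increment_lborel s) q (increment_Lp a))"
    have D: "D_norm s R \<Gamma> \<gamma> p q f = X + (SUP a\<in>A. L_norm scale_lborel q (average_Lp a))"
      unfolding D_norm_def X_def
      by (intro arg_cong2[where f="(+)"] SUP_cong refl L_norm_averages L_norm_component)
    have B: "B_norm s R \<Gamma> \<gamma> p q f = X + Y"
      unfolding B_norm_def X_def Y_def
      by (intro arg_cong2[where f="(+)"] SUP_cong refl L_norm_increments L_norm_component)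
    have "L_norm scale_lborel q (average_Lp a) \<le> ennreal (5 * E) * Y + ennreal (5 * (2 * C0 * E * card A)) * X"
      if a [measurable]: "a \<in> A" for a
    proof -
      have "L_norm scale_lborel q (average_Lp a) \<le> 5 * (L_norm (increment_lborel s) q (\<lambda>h. ennreal (4 powr (\<gamma> - a)) * increment_Lp a h) +
          ennreal (2 * C0 * 4 powr (\<gamma> - a)) * (\<Sum>b\<in>A. L_norm lborel p (U b)))"
        by (intro L_norm_scale_le_increment[where s=s, OF s_pos] q average_Lp_le_average_increment_Lp average_Lp_le_values[OF C0(1) C0(2)[OF f_T]] a) auto
      also have "\<dots> \<le> 5 * (ennreal E * Y + ennreal (2 * C0 * E) * (of_nat (card A) * X))"
      proof (intro mult_left_mono add_mono mult_mono)
        have "L_norm (increment_lborel s) q (\<lambda>h. ennreal (4 powr (\<gamma> - a)) * increment_Lp a h) \<le>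
            ennreal (4 powr (\<gamma> - a)) * L_norm (increment_lborel s) q (increment_Lp a)"
          by (intro L_norm_cmult_le q) auto
        also have "\<dots> \<le> ennreal E * Y"
          unfolding Y_def by (intro mult_mono ennreal_leI E SUP_upper a) auto
        finally show "L_norm (increment_lborel s) q (\<lambda>h. ennreal (4 powr (\<gamma> - a)) * increment_Lp a h) \<le> ennreal E * Y" .
        show "(\<Sum>b\<in>A. L_norm lborel p (U b)) \<le> of_nat (card A) * X"
          unfolding X_def by (rule sum_le_card_SUP)
        show "ennreal (2 * C0 * 4 powr (\<gamma> - a)) \<le> ennreal (2 * C0 * E)"
          using C0 by (intro ennreal_leI mult_left_mono E a) auto
      qed auto
      also have "\<dots> = ennreal (5 * E) * Y + ennreal (5 * (2 * C0 * E * card A)) * X"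
      proof -
        have "ennreal (5 * E) = 5 * ennreal E"
          using E0 ennreal_mult[of 5 E] by simp
        moreover have "ennreal (5 * (2 * C0 * E * card A)) = 5 * (ennreal (2 * C0 * E) * of_nat (card A))"
          using E0 C0 ennreal_mult[of 5 "2 * C0 * E * card A"] ennreal_mult[of "2 * C0 * E" "card A"]
          by (simp add: ennreal_of_nat_eq_real_of_nat)
        ultimately show ?thesis by (simp only: distrib_left mult.assoc)
      qed
      finally show ?thesis .
    qed
    then have "D_norm s R \<Gamma> \<gamma> p q f \<le> X + (ennreal (5 * E) * Y + ennreal (5 * (2 * C0 * E * card A)) * X)"
      unfolding D by (intro add_left_mono SUP_least)
    also have "\<dots> = (1 + ennreal (5 * (2 * C0 * E * card A))) * X + ennreal (5 * E) * Y"
      by (simp only: distrib_right mult_1 add_ac)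
    also have "\<dots> \<le> ennreal C * X + ennreal C * Y"
    proof (intro add_mono mult_right_mono ennreal_leI)
      have "1 + ennreal (5 * (2 * C0 * E * card A)) = ennreal (1 + 5 * (2 * C0 * E * card A))"
        using C0 E0 by (subst ennreal_plus) auto
      also have "\<dots> \<le> ennreal C" using E0 by (intro ennreal_leI) (simp add: C_def)
      finally show "1 + ennreal (5 * (2 * C0 * E * card A)) \<le> ennreal C" .
    qed (use C0 E0 in \<open>auto simp: C_def\<close>)
    finally show "D_norm s R \<Gamma> \<gamma> p q f \<le> ennreal C * B_norm s R \<Gamma> \<gamma> p q f"
      by (simp add: B distrib_left)
  qed
qed

end

theorem corollary8p4:
  fixes s :: "'d::finite \<Rightarrow> nat"
    and R :: "'t::real_vector reg_structure"
    and PI :: "real^'d \<Rightarrow> 't \<Rightarrow> (real^'d \<Rightarrow> real) \<Rightarrow> real"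
    and \<Gamma> :: "real^'d \<Rightarrow> real^'d \<Rightarrow> 't \<Rightarrow> 't"
    and \<gamma> :: real and p q :: ennreal
  assumes "\<And>i. 0 < s i"
    and "regularity_structure R"
    and "model s R PI \<Gamma>"
    and "0 < \<gamma>" and "\<gamma> \<notin> rs_index R"
    and "1 \<le> p" and "1 \<le> q"
  shows "D_space s R \<Gamma> \<gamma> p q = B_space s R \<Gamma> \<gamma> p q \<and>
    (\<exists>c C. 0 < c \<and> 0 < C \<and> (\<forall>f\<in>D_space s R \<Gamma> \<gamma> p q.
       ennreal c * B_norm s R \<Gamma> \<gamma> p q f \<le> D_norm s R \<Gamma> \<gamma> p q f \<and>
       D_norm s R \<Gamma> \<gamma> p q f \<le> ennreal C * B_norm s R \<Gamma> \<gamma> p q f))"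
proof -
  interpret regularity_model s R PI \<Gamma> \<gamma>
    using assms by unfold_locales auto
  obtain C1 where C1: "0 < C1" "\<And>f. modelled_function R \<gamma> f \<Longrightarrow>
      B_norm s R \<Gamma> \<gamma> p q f \<le> ennreal C1 * D_norm s R \<Gamma> \<gamma> p q f"
    by (rule B_norm_le_D_norm[OF \<open>1 \<le> p\<close> \<open>1 \<le> q\<close>]) blast
  obtain C2 where C2: "0 < C2" "\<And>f. modelled_function R \<gamma> f \<Longrightarrow>
      D_norm s R \<Gamma> \<gamma> p q f \<le> ennreal C2 * B_norm s R \<Gamma> \<gamma> p q f"
    by (rule D_norm_le_B_norm[OF \<open>1 \<le> p\<close> \<open>1 \<le> q\<close>]) blast
  have lower: "ennreal (1 / C1) * B_norm s R \<Gamma> \<gamma> p q f \<le> D_norm s R \<Gamma> \<gamma> p q f"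
    if "modelled_function R \<gamma> f" for f
  proof -
    have "ennreal (1 / C1) * B_norm s R \<Gamma> \<gamma> p q f \<le> ennreal (1 / C1) * (ennreal C1 * D_norm s R \<Gamma> \<gamma> p q f)"
      by (intro mult_left_mono C1(2) that) simp
    also have "\<dots> = D_norm s R \<Gamma> \<gamma> p q f"
      using C1(1) by (simp flip: mult.assoc ennreal_mult)
    finally show ?thesis .
  qed
  have "D_norm s R \<Gamma> \<gamma> p q f < \<infinity> \<longleftrightarrow> B_norm s R \<Gamma> \<gamma> p q f < \<infinity>" if "modelled_function R \<gamma> f" for f
    using C1(2)[OF that] C2(2)[OF that]
    by (auto simp: ennreal_mult_less_top intro: le_less_trans)
  then have "D_space s R \<Gamma> \<gamma> p q = B_space s R \<Gamma> \<gamma> p q"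
    by (auto simp: D_space_def B_space_def)
  moreover have "\<forall>f\<in>D_space s R \<Gamma> \<gamma> p q.
       ennreal (1 / C1) * B_norm s R \<Gamma> \<gamma> p q f \<le> D_norm s R \<Gamma> \<gamma> p q f \<and>
       D_norm s R \<Gamma> \<gamma> p q f \<le> ennreal C2 * B_norm s R \<Gamma> \<gamma> p q f"
    using lower C2(2) by (auto simp: D_space_def)
  moreover have "0 < 1 / C1" using C1(1) by simp
  ultimately show ?thesis using C2(1) by blast
qed

end
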